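(* Let $n\ge2$ be an integer, $1<p<n$ and $0<\alpha<p$. Put $p^*=\frac{np}{n-p}$, $p^*(\alpha)=\frac{p(n-\alpha)}{n-p}$, $r=\frac{\alpha}{p^*(\alpha)}$ and $\bar\theta=\max\Big\{\frac{p}{p^*(\alpha)},\frac{p^*-1}{p^*(\alpha)}\Big\}>0$. Then there exists a constant $C=C(n,p,\alpha)>0$ such that for any $\theta\in(\bar\theta,1)$ and any $m\in[1,p^*(\alpha))$, $$\Big(\int_{\mathbb{R}^n}\frac{|u(y)|^{p^*(\alpha)}}{|y|^\alpha}dy\Big)^{\frac{1}{p^*(\alpha)}}\le C\,\|u\|_{D^{1,p}(\mathbb{R}^n)}^{\theta}\,\|u\|_{L^{m,\frac{n-p}{p}m+mr}(\mathbb{R}^n,|y|^{-mr})}^{1-\theta}\qquad\text{for all }u\in D^{1,p}(\mathbb{R}^n).$$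
   Context: $D^{1,p}(\mathbb{R}^n)=\{u\in L^{p^*}(\mathbb{R}^n):\nabla u\in L^p(\mathbb{R}^n)\}$ is the completion of $C_0^\infty(\mathbb{R}^n)$ under $\|u\|_{D^{1,p}}=(\int_{\mathbb{R}^n}|\nabla u|^pdx)^{1/p}$. For $m\in[1,\infty)$, $\gamma,\lambda>0$ with $\gamma+\lambda\in(0,n)$, the weighted Morrey norm of a Lebesgue measurable $u:\mathbb{R}^n\to\mathbb{R}$ is $$\|u\|_{L^{m,\gamma+\lambda}(\mathbb{R}^n,|y|^{-\lambda})}=\sup_{R>0,\,x\in\mathbb{R}^n}\Big\{R^{\gamma+\lambda-n}\int_{B_R(x)}\frac{|u(y)|^m}{|y|^\lambda}dy\Big\}^{1/m};$$ here it is used with $\gamma=\frac{n-p}{p}m$ and $\lambda=mr$. *)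

theory Defs
  imports "HOL-Analysis.Analysis"
begin

text \<open>Only used with exponents \<open>a > 0\<close>, where \<open>\<infinity>\<close> to the power \<open>a\<close> is \<open>\<infinity>\<close>.\<close>

definition ennpowr :: "ennreal \<Rightarrow> real \<Rightarrow> ennreal" where
  "ennpowr x a = (if x = \<infinity> then \<infinity> else ennreal (enn2real x powr a))"

primrec C_k :: "nat \<Rightarrow> ('a::euclidean_space \<Rightarrow> real) \<Rightarrow> bool" where
  "C_k 0 f \<longleftrightarrow> continuous_on UNIV f"
| "C_k (Suc k) f \<longleftrightarrow> f differentiable_on UNIV \<and>
     (\<forall>b\<in>Basis. C_k k (\<lambda>x. frechet_derivative f (at x) b))"

definition test_functions :: "('a::euclidean_space \<Rightarrow> real) set" where
  "test_functions = {\<phi>. (\<forall>k. C_k k \<phi>) \<and> compact (closure {x. \<phi> x \<noteq> 0})}"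

definition locally_integrable ::
    "('a::euclidean_space \<Rightarrow> 'b::{banach, second_countable_topology}) \<Rightarrow> bool" where
  "locally_integrable f \<longleftrightarrow> (\<forall>K. compact K \<longrightarrow> set_integrable lebesgue K f)"

definition has_weak_gradient ::
    "('a::euclidean_space \<Rightarrow> real) \<Rightarrow> ('a \<Rightarrow> 'a) \<Rightarrow> bool" where
  "has_weak_gradient u G \<longleftrightarrow>
     locally_integrable u \<and> locally_integrable G \<and>
     (\<forall>\<phi>\<in>test_functions. \<forall>b\<in>Basis.
        (LINT x|lebesgue. u x * frechet_derivative \<phi> (at x) b)
          = - (LINT x|lebesgue. (G x \<bullet> b) * \<phi> x))"

text \<open>A weak gradient is unique only up to null sets; \<open>weak_gradient\<close> picks a representative,
  and it is unspecified if \<open>u\<close> has no weak gradient.\<close>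

definition weak_gradient :: "('a::euclidean_space \<Rightarrow> real) \<Rightarrow> 'a \<Rightarrow> 'a" where
  "weak_gradient u = (SOME G. has_weak_gradient u G)"

definition Lp_functions :: "real \<Rightarrow> ('a::euclidean_space \<Rightarrow> 'b::euclidean_space) set" where
  "Lp_functions q = {f. f \<in> borel_measurable lebesgue \<and>
                        integrable lebesgue (\<lambda>x. norm (f x) powr q)}"

definition sobolev_exponent :: "nat \<Rightarrow> real \<Rightarrow> real" where
  "sobolev_exponent n p = real n * p / (real n - p)"

definition hardy_sobolev_exponent :: "nat \<Rightarrow> real \<Rightarrow> real \<Rightarrow> real" where
  "hardy_sobolev_exponent n p \<alpha> = p * (real n - \<alpha>) / (real n - p)"

definition D1p :: "real \<Rightarrow> ('a::euclidean_space \<Rightarrow> real) set" where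
  "D1p p = {u. u \<in> Lp_functions (sobolev_exponent DIM('a) p) \<and>
               (\<exists>G. has_weak_gradient u G) \<and> weak_gradient u \<in> Lp_functions p}"

definition D1p_norm :: "real \<Rightarrow> ('a::euclidean_space \<Rightarrow> real) \<Rightarrow> ennreal" where
  "D1p_norm p u =
     ennpowr (\<integral>\<^sup>+ x. ennreal (norm (weak_gradient u x) powr p) \<partial>lebesgue) (1 / p)"

text \<open>\<open>morrey_norm m \<kappa> l u\<close> is the norm of \<open>L\<^sup>m\<^sup>,\<^sup>\<kappa>\<close> with weight
  \<open>|y|\<close> to the power \<open>-l\<close>; here \<open>\<kappa> = \<gamma> + l\<close>.\<close>

definition morrey_norm :: "real \<Rightarrow> real \<Rightarrow> real \<Rightarrow> ('a::euclidean_space \<Rightarrow> real) \<Rightarrow> ennreal" where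
  "morrey_norm m \<kappa> l u =
     (SUP (R, x) \<in> {0<..} \<times> UNIV.
        ennpowr (ennreal (R powr (\<kappa> - real DIM('a))) *
                 (\<integral>\<^sup>+ y\<in>ball x R. ennreal (\<bar>u y\<bar> powr m / norm y powr l) \<partial>lebesgue))
                (1 / m))"

end

theory Submission
  imports Defs
begin

text \<open>
  Write \<open>q\<close> for the Hardy-Sobolev exponent, \<open>r = \<alpha> / q\<close>, \<open>v(y) = |u(y)| / |y|\<close> to the power \<open>r\<close>,
  \<open>M\<close> for the Morrey norm and \<open>g\<close> for the norm of the weak gradient.
  The endpoint exponent \<open>p / q\<close> is reached by Hedberg's trick: mollification shows that
  a multiple \<open>w\<close> of the Hardy-Littlewood maximal function of \<open>g\<close> is an upper gradient
  of \<open>u\<close> off a null set, whence a pointwise Poincare inequality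
  \<open>|u(x)| \<le> A |x|\<^sup>r R\<^sup>-\<^sup>n\<^sup>/\<^sup>q M + C R Mw(x)\<close> for \<open>0 < R \<le> |x|\<close>, where \<open>Mw\<close> is the maximal
  function of \<open>w\<close>. Optimising \<open>R\<close> bounds the \<open>q\<close>-th power of \<open>v\<close> by \<open>M\<close> to the power \<open>q - p\<close> times
  the \<open>p\<close>-th power of \<open>Mw\<close>, except where the optimal \<open>R\<close> exceeds \<open>|x|\<close>; there the \<open>p\<close>-th power of
  \<open>|u| / |x|\<close> takes over, which Hardy's inequality controls. Larger \<open>\<theta>\<close> follow because \<open>M\<close> is bounded
  by the norm of \<open>v\<close> in \<open>L\<^sup>q\<close>, hence by the gradient norm.
\<close>

section \<open>Smooth bump functions\<close>

text \<open>Mollifying \<open>u\<close> moves the derivative onto a smooth kernel and from there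
  onto the weak gradient; the result is bounded by the maximal function of the gradient for every
  mollification radius. Since this bound does not change with the radius, only the almost everywhere
  convergence of the mollified \<open>u\<close> is needed in the limit, and no convergence of
  gradients. The price is that the Poincare inequality applies the maximal operator once more; the
  strong type inequality, which rests on \<open>p > 1\<close>, is used twice to undo both. The
  restriction of \<open>R\<close> to at most \<open>|x|\<close> comes from the weight: the ball then
  lies where \<open>|y| \<le> 2|x|\<close>, so \<open>|y|^r\<close> is at most a multiple of
  \<open>|x|^r\<close> and unweighted means of \<open>|u|\<close> are controlled by the Morrey norm.
  The constant has to serve all \<theta> and \<open>m\<close> at once. Hoelder's inequality is
  therefore used with constants \<open>(\<omega> + 1)^s\<close>, \<omega> the volume of the unit
  ball and \<open>s\<close> the exponent, whose \<open>s\<close>-th root is free of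
  \<open>s\<close>; the dependence on \<theta> disappears in a maximum with 1.\<close>

lemma C_k_Suc_I:
  assumes "\<And>x. (f has_derivative f' x) (at x)"
    and "\<And>b. b \<in> Basis \<Longrightarrow> C_k k (\<lambda>x. f' x b)"
  shows "C_k (Suc k) f"
proof -
  have "frechet_derivative f (at x) = f' x" for x
    using frechet_derivative_at[OF assms(1)] by simp
  then show ?thesis
    using assms by (auto simp: differentiable_on_def differentiable_def intro: has_derivative_at_withinI)
qed

lemma C_k_Suc_has_derivative:
  assumes "C_k (Suc k) f"
  shows "(f has_derivative frechet_derivative f (at x)) (at x)"
  using assms by (auto simp: differentiable_on_def frechet_derivative_works)

lemma C_k_Suc_lower: "C_k (Suc k) f \<Longrightarrow> C_k k f"
proof (induction k arbitrary: f)
  case 0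
  then show ?case by (auto simp: differentiable_imp_continuous_on)
next
  case (Suc k)
  show ?case
  proof (rule C_k_Suc_I)
    show "(f has_derivative frechet_derivative f (at x)) (at x)" for x
      by (rule C_k_Suc_has_derivative[OF Suc.prems])
    show "C_k k (\<lambda>x. frechet_derivative f (at x) b)" if "b \<in> Basis" for b
      using Suc.prems that by (intro Suc.IH) auto
  qed
qed

lemma C_k_const: "C_k k (\<lambda>x. c)"
proof (induction k arbitrary: c)
  case (Suc k)
  show ?case by (rule C_k_Suc_I[where f' = "\<lambda>x h. 0"]) (auto intro: Suc)
qed auto

lemma C_k_inner_left: "C_k k (\<lambda>x. (x - a) \<bullet> b)"
proof (cases k)
  case (Suc j)
  show ?thesis unfolding Suc
    by (rule C_k_Suc_I[where f' = "\<lambda>x h. h \<bullet> b"]) (auto intro!: derivative_eq_intros C_k_const)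
qed (auto intro!: continuous_intros)

lemma C_k_add: "C_k k f \<Longrightarrow> C_k k g \<Longrightarrow> C_k k (\<lambda>x. f x + g x)"
proof (induction k arbitrary: f g)
  case (Suc k)
  show ?case
  proof (rule C_k_Suc_I)
    show "((\<lambda>x. f x + g x) has_derivative
        (\<lambda>h. frechet_derivative f (at x) h + frechet_derivative g (at x) h)) (at x)" for x
      by (intro has_derivative_add C_k_Suc_has_derivative[OF Suc.prems(1)] C_k_Suc_has_derivative[OF Suc.prems(2)])
    show "C_k k (\<lambda>x. frechet_derivative f (at x) b + frechet_derivative g (at x) b)"
      if "b \<in> Basis" for b
      using Suc.prems that by (intro Suc.IH) auto
  qed
qed (auto intro: continuous_intros)

lemma C_k_mult: "C_k k f \<Longrightarrow> C_k k g \<Longrightarrow> C_k k (\<lambda>x. f x * g x)"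
proof (induction k arbitrary: f g)
  case (Suc k)
  show ?case
  proof (rule C_k_Suc_I)
    show "((\<lambda>x. f x * g x) has_derivative
        (\<lambda>h. f x * frechet_derivative g (at x) h + frechet_derivative f (at x) h * g x)) (at x)" for x
      by (intro has_derivative_mult C_k_Suc_has_derivative[OF Suc.prems(1)] C_k_Suc_has_derivative[OF Suc.prems(2)])
    show "C_k k (\<lambda>x. f x * frechet_derivative g (at x) b + frechet_derivative f (at x) b * g x)"
      if "b \<in> Basis" for b
      using Suc.prems that C_k_Suc_lower[OF Suc.prems(1)] C_k_Suc_lower[OF Suc.prems(2)]
      by (intro C_k_add Suc.IH) auto
  qed
qed (auto intro: continuous_intros)

text \<open>The classical flat function \<open>exp (- 1 / t)\<close> times a polynomial in
  \<open>1 / t\<close>. The polynomial is carried along because this family is closed under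
  differentiation, so that smoothness of all orders follows by induction with \<open>P\<close>
  arbitrary.\<close>

definition flat_exp :: "real poly \<Rightarrow> real \<Rightarrow> real" where
  "flat_exp P t = (if t > 0 then poly P (1 / t) * exp (- 1 / t) else 0)"

lemma poly_inverse_times_exp_tendsto_0:
  fixes P :: "real poly"
  shows "((\<lambda>t. poly P (1 / t) * exp (- 1 / t)) \<longlongrightarrow> 0) (at_right 0)"
proof -
  have "((\<lambda>x. x ^ k / exp x) \<longlongrightarrow> (0::real)) at_top" for k
    by (rule tendsto_power_div_exp_0)
  then have "((\<lambda>x. \<Sum>i\<le>degree P. coeff P i * (x ^ i / exp x)) \<longlongrightarrow> (\<Sum>i\<le>degree P. coeff P i * 0)) at_top"
    by (rule_tac tendsto_sum, rule_tac tendsto_mult[OF tendsto_const], simp)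
  then have "((\<lambda>x. poly P x / exp x) \<longlongrightarrow> 0) at_top"
    by (simp add: poly_altdef sum_divide_distrib)
  then have "((\<lambda>t. poly P (inverse t) / exp (inverse t)) \<longlongrightarrow> 0) (at_right 0)"
    by (rule filterlim_compose[OF _ filterlim_inverse_at_top_right])
  then show ?thesis
    by (simp add: exp_minus field_simps)
qed

text \<open>With \<open>s = 1 / t\<close> the chain rule contributes \<open>- s^2\<close>, and
  differentiating \<open>P s * exp (- s)\<close> in \<open>s\<close> gives
  \<open>(P' - P) s * exp (- s)\<close>; this is the polynomial
  \<open>X^2 * (P - P')\<close>.\<close>

lemma flat_exp_has_derivative:
  "(flat_exp P has_real_derivative flat_exp ([:0, 0, 1:] * (P - pderiv P)) t) (at t)"
proof -
  consider "t > 0" | "t < 0" | "t = 0" by linarith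
  then show ?thesis
  proof cases
    case 1
    have "((\<lambda>t. poly P (1 / t) * exp (- 1 / t)) has_real_derivative
        flat_exp ([:0, 0, 1:] * (P - pderiv P)) t) (at t)"
      using 1 by (auto intro!: derivative_eq_intros simp: flat_exp_def field_simps power2_eq_square)
    then show ?thesis
      by (rule DERIV_cong_ev[THEN iffD1, rotated -1])
         (use 1 in \<open>auto simp: flat_exp_def intro!: eventually_mono[OF eventually_nhds_in_open[of "{0<..}"]]\<close>)
  next
    case 2
    have "((\<lambda>t. 0) has_real_derivative flat_exp ([:0, 0, 1:] * (P - pderiv P)) t) (at t)"
      using 2 by (auto simp: flat_exp_def)
    then show ?thesis
      by (rule DERIV_cong_ev[THEN iffD1, rotated -1])
         (use 2 in \<open>auto simp: flat_exp_def intro!: eventually_mono[OF eventually_nhds_in_open[of "{..<0}"]]\<close>)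
  next
    case 3
    \<comment> \<open>Dividing by \<open>y\<close> multiplies the polynomial by \<open>X\<close>, so
      the difference quotient at the origin is again a member of the family and tends to 0.\<close>
    have "((\<lambda>y. flat_exp P y / y) \<longlongrightarrow> 0) (at_right 0)"
      using poly_inverse_times_exp_tendsto_0[of "[:0, 1:] * P"]
      by (rule Lim_transform_eventually)
         (auto simp: flat_exp_def eventually_at_filter)
    moreover have "((\<lambda>y. flat_exp P y / y) \<longlongrightarrow> 0) (at_left 0)"
      by (rule Lim_transform_eventually[OF tendsto_const])
         (auto simp: flat_exp_def eventually_at_filter)
    ultimately have "((\<lambda>y. flat_exp P y / y) \<longlongrightarrow> 0) (at 0)"
      by (simp add: filterlim_at_split)
    then show ?thesis
      using 3 by (simp add: has_field_derivative_iff flat_exp_def)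
  qed
qed

lemma C_k_flat_exp_compose:
  assumes "\<And>k. C_k k f"
  shows "C_k k (\<lambda>x. flat_exp P (f x))"
proof (induction k arbitrary: P)
  case 0
  have "continuous_on UNIV (flat_exp P)"
    using flat_exp_has_derivative by (meson DERIV_continuous_on has_field_derivative_at_within)
  moreover have "continuous_on UNIV f" using assms[of 0] by simp
  ultimately show ?case
    using continuous_on_compose2[of UNIV "flat_exp P" UNIV f] by auto
next
  case (Suc k)
  let ?Q = "[:0, 0, 1:] * (P - pderiv P)"
  show ?case
  proof (rule C_k_Suc_I)
    show "((\<lambda>x. flat_exp P (f x)) has_derivative
        (\<lambda>h. flat_exp ?Q (f x) * frechet_derivative f (at x) h)) (at x)" for x
      using has_derivative_compose[OF C_k_Suc_has_derivative[OF assms[of "Suc 0"]]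
          flat_exp_has_derivative[of P "f x", unfolded has_field_derivative_def]]
      by simp
    show "C_k k (\<lambda>x. flat_exp ?Q (f x) * frechet_derivative f (at x) b)" if "b \<in> Basis" for b
      using assms[of "Suc k"] that by (intro C_k_mult Suc.IH) auto
  qed
qed

text \<open>This is \<open>exp (- 1 / (1 - |x|^2))\<close> on the unit ball. The norm is squared to
  make the inner function a polynomial in the coordinates, hence smooth at the origin as
  well.\<close>

definition bump :: "'a::euclidean_space \<Rightarrow> real" where
  "bump x = flat_exp 1 (1 - (norm x)\<^sup>2)"

lemma bump_nonneg: "bump x \<ge> 0"
  by (auto simp: bump_def flat_exp_def)

lemma bump_le_1: "bump x \<le> 1"
  by (auto simp: bump_def flat_exp_def)

lemma bump_eq_0_iff: "bump x = 0 \<longleftrightarrow> norm x \<ge> 1"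
proof -
  have "(norm x)\<^sup>2 < 1 \<longleftrightarrow> norm x < 1"
    by (simp add: power_less_one_iff abs_square_less_1)
  then show ?thesis by (auto simp: bump_def flat_exp_def not_less)
qed

lemma bump_minus: "bump (- x) = bump x"
  by (simp add: bump_def)

lemma bump_rescaled_test_function:
  fixes a :: "'a::euclidean_space"
  assumes "e > 0"
  shows "(\<lambda>y. c * bump ((y - a) /\<^sub>R e)) \<in> test_functions"
proof -
  \<comment> \<open>The squared norm is treated as a sum over an arbitrary finite set, so that
    smoothness follows by induction from sums and products of affine functions;
    \<open>B = Basis\<close> is the case of interest.\<close>
  have "C_k k (\<lambda>y. 1 + (\<Sum>b\<in>B. (- 1 / e\<^sup>2) * ((y - a) \<bullet> b * ((y - a) \<bullet> b))))" if "finite B" for k and B :: "'a set"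
    using that
  proof (induction B)
    case empty
    then show ?case by (simp add: C_k_const)
  next
    case (insert b B)
    have "C_k k (\<lambda>y. (- 1 / e\<^sup>2) * ((y - a) \<bullet> b * ((y - a) \<bullet> b)) + (1 + (\<Sum>b\<in>B. (- 1 / e\<^sup>2) * ((y - a) \<bullet> b * ((y - a) \<bullet> b)))))"
      by (intro C_k_add C_k_mult C_k_const C_k_inner_left insert)
    then show ?case using insert by (simp add: algebra_simps)
  qed
  note sum = this[OF finite_Basis]
  have "C_k k (\<lambda>y. 1 - (norm ((y - a) /\<^sub>R e))\<^sup>2)" for k
  proof -
    have "1 + (\<Sum>b\<in>Basis. (- 1 / e\<^sup>2) * ((y - a) \<bullet> b * ((y - a) \<bullet> b))) = 1 - (norm ((y - a) /\<^sub>R e))\<^sup>2" for y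
    proof -
      have "(norm ((y - a) /\<^sub>R e))\<^sup>2 = (norm (y - a))\<^sup>2 / e\<^sup>2"
        using assms by (simp add: power_mult_distrib power_inverse divide_inverse mult.commute)
      also have "\<dots> = (\<Sum>b\<in>Basis. (1 / e\<^sup>2) * ((y - a) \<bullet> b * ((y - a) \<bullet> b)))"
        unfolding power2_norm_eq_inner
        by (subst euclidean_inner) (simp only: sum_divide_distrib times_divide_eq_left mult_1_left)
      finally show ?thesis by (simp add: sum_negf del: inner_diff_left)
    qed
    then show ?thesis using sum[of k] by (simp only:)
  qed
  then have "C_k k (\<lambda>y. c * bump ((y - a) /\<^sub>R e))" for k
    unfolding bump_def by (intro C_k_mult C_k_const C_k_flat_exp_compose)
  moreover have "{y. c * bump ((y - a) /\<^sub>R e) \<noteq> 0} \<subseteq> cball a e"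
  proof (rule subsetI)
    fix y assume "y \<in> {y. c * bump ((y - a) /\<^sub>R e) \<noteq> 0}"
    then have "norm (y - a) / e < 1"
      using assms by (simp add: bump_eq_0_iff not_le divide_inverse_commute)
    then show "y \<in> cball a e"
      using assms by (simp add: dist_norm norm_minus_commute)
  qed
  then have "compact (closure {y. c * bump ((y - a) /\<^sub>R e) \<noteq> 0})"
    by (meson bounded_cball bounded_subset compact_closure)
  ultimately show ?thesis by (simp add: test_functions_def)
qed

section \<open>Translations in \<open>L\<^sup>1\<close>\<close>

lemma nn_integral_lborel_affine:
  fixes f :: "'a::euclidean_space \<Rightarrow> ennreal"
  assumes [measurable]: "f \<in> borel_measurable borel" and "c \<noteq> 0"
  shows "(\<integral>\<^sup>+x. f (a + c *\<^sub>R x) \<partial>lborel) = ennreal (1 / \<bar>c\<bar> ^ DIM('a)) * (\<integral>\<^sup>+x. f x \<partial>lborel)"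
proof -
  have "(\<integral>\<^sup>+x. f x \<partial>lborel) = ennreal (\<bar>c\<bar> ^ DIM('a)) * (\<integral>\<^sup>+x. f (a + c *\<^sub>R x) \<partial>lborel)"
    by (subst lborel_affine[OF \<open>c \<noteq> 0\<close>, of a])
       (simp add: nn_integral_density nn_integral_distr nn_integral_cmult)
  then show ?thesis
    using \<open>c \<noteq> 0\<close> by (simp add: mult.assoc[symmetric] ennreal_mult[symmetric])
qed

lemma nn_integral_lborel_translate:
  fixes f :: "'a::euclidean_space \<Rightarrow> ennreal"
  assumes "f \<in> borel_measurable borel"
  shows "(\<integral>\<^sup>+x. f (x + a) \<partial>lborel) = (\<integral>\<^sup>+x. f x \<partial>lborel)"
  using nn_integral_lborel_affine[OF assms, of 1 a] by (simp add: add.commute)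

lemma nn_integral_lborel_reflect:
  fixes f :: "'a::euclidean_space \<Rightarrow> ennreal"
  assumes "f \<in> borel_measurable borel"
  shows "(\<integral>\<^sup>+x. f (a - x) \<partial>lborel) = (\<integral>\<^sup>+x. f x \<partial>lborel)"
  using nn_integral_lborel_affine[OF assms, of "-1" a] by simp

lemma AE_lborel_affine:
  fixes a :: "'a::euclidean_space" and P :: "'a \<Rightarrow> bool"
  assumes "AE x in lborel. P x" and "c \<noteq> 0"
  shows "AE x in lborel. P (a + c *\<^sub>R x)"
proof -
  obtain N where N: "\<And>x. x \<in> space lborel - N \<Longrightarrow> P x" "N \<in> null_sets lborel"
    using AE_E3[OF assms(1)] by blast
  then have [measurable]: "N \<in> sets borel" by auto
  have "(\<integral>\<^sup>+x. indicator N (a + c *\<^sub>R x) \<partial>lborel) = 0"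
    using N by (subst nn_integral_lborel_affine) (auto simp: \<open>c \<noteq> 0\<close>)
  then have "AE x in lborel. indicator N (a + c *\<^sub>R x) = (0::ennreal)"
    by (subst (asm) nn_integral_0_iff_AE) auto
  then show ?thesis
    by eventually_elim (use N(1) in \<open>auto split: split_indicator_asm\<close>)
qed

text \<open>Outer regularity of the complement of \<open>A\<close> supplies a closed inner set
  \<open>- V\<close>, and a large ball makes it compact. What is lost outside the ball is small
  because \<open>A\<close> has finite measure and the sets \<open>B k\<close> decrease to the empty
  set. Each of the three errors takes a third of \<open>e\<close>.\<close>

lemma open_compact_sandwich:
  fixes A :: "'a::euclidean_space set"
  assumes A: "A \<in> sets lborel" "emeasure lborel A < \<infinity>" and "e > 0"
  obtains K U where "compact K" "open U" "K \<subseteq> A" "A \<subseteq> U" "emeasure lborel (U - K) \<le> ennreal e"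
proof -
  have [measurable]: "A \<in> sets borel" using A by simp
  obtain U where U: "open U" "A \<subseteq> U" "emeasure lborel (U - A) < ennreal (e / 3)"
    using outer_regular_lborel[of A "e / 3"] A \<open>e > 0\<close> by auto
  obtain V where V: "open V" "- A \<subseteq> V" "emeasure lborel (V - (- A)) < ennreal (e / 3)"
    using outer_regular_lborel[of "- A" "e / 3"] A \<open>e > 0\<close> by auto
  have [measurable]: "U \<in> sets borel" "V \<in> sets borel" using U V by auto
  define B where "B k = A - cball 0 (real k)" for k
  have "(\<lambda>k. emeasure lborel (B k)) \<longlonglongrightarrow> emeasure lborel (\<Inter>k. B k)"
  proof (rule Lim_emeasure_decseq)
    show "range B \<subseteq> sets lborel" by (auto simp: B_def)
    show "decseq B" by (auto simp: B_def decseq_def)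
    show "emeasure lborel (B k) \<noteq> \<infinity>" for k
      using A(2) emeasure_mono[of "B k" A lborel] by (auto simp: B_def top_unique)
  qed
  moreover have "(\<Inter>k. B k) = {}"
    using real_arch_simple by (fastforce simp: B_def)
  ultimately have "(\<lambda>k. emeasure lborel (B k)) \<longlonglongrightarrow> 0" by simp
  then have "eventually (\<lambda>k. emeasure lborel (B k) < ennreal (e / 3)) sequentially"
    using \<open>e > 0\<close> by (intro order_tendstoD) auto
  then obtain k where k: "emeasure lborel (B k) < ennreal (e / 3)"
    by (auto simp: eventually_sequentially)
  define K where "K = - V \<inter> cball 0 (real k)"
  show ?thesis
  proof (rule that)
    show "compact K" unfolding K_def using V by (intro closed_Int_compact) auto
    show "open U" "A \<subseteq> U" by fact+
    show "K \<subseteq> A" using V by (auto simp: K_def)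
    have "emeasure lborel (U - K) \<le> emeasure lborel ((U - A) \<union> (V - (- A)) \<union> B k)"
      by (rule emeasure_mono) (auto simp: K_def B_def)
    also have "\<dots> \<le> emeasure lborel ((U - A) \<union> (V - (- A))) + emeasure lborel (B k)"
      by (rule emeasure_subadditive) (auto simp: B_def)
    also have "\<dots> \<le> emeasure lborel (U - A) + emeasure lborel (V - (- A)) + emeasure lborel (B k)"
      by (intro add_right_mono emeasure_subadditive) auto
    also have "\<dots> \<le> ennreal (e / 3) + ennreal (e / 3) + ennreal (e / 3)"
      using U V k by (intro add_mono) auto
    also have "\<dots> = ennreal e"
      using \<open>e > 0\<close> by (simp flip: ennreal_plus)
    finally show "emeasure lborel (U - K) \<le> ennreal e" .
  qed
qed

text \<open>Continuity of translations in the mean is the source of the convergence of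
  mollifications. Indicators rest on the compact-open sandwich, sums split \<open>e\<close> in
  halves, and limits split it in thirds, where the shifted error equals the unshifted one by
  translation invariance.\<close>

lemma integrable_translation_continuous:
  fixes f :: "'a::euclidean_space \<Rightarrow> real"
  assumes "integrable lborel f" and "e > 0"
  obtains d where "d > 0"
    "\<And>h. norm h < d \<Longrightarrow> (\<integral>\<^sup>+x. ennreal \<bar>f (x + h) - f x\<bar> \<partial>lborel) \<le> ennreal e"
proof -
  have "\<forall>e>0. \<exists>d>0. \<forall>h. norm h < d \<longrightarrow> (\<integral>\<^sup>+x. ennreal \<bar>f (x + h) - f x\<bar> \<partial>lborel) \<le> ennreal e"
    using assms(1)
  proof (induction f rule: integrable_induct)
    case (base A c)
    show ?case
    proof (intro allI impI)
      fix e :: real assume "e > 0"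
      \<comment> \<open>Two copies of \<open>U - K\<close> will be counted with weight
        \<open>|c|\<close>; the \<open>+ 1\<close> keeps the denominator positive for
        \<open>c = 0\<close>.\<close>
      define e' where "e' = e / (2 * (\<bar>c\<bar> + 1))"
      have "e' > 0" using \<open>e > 0\<close> by (simp add: e'_def)
      obtain K U where KU: "compact K" "open U" "K \<subseteq> A" "A \<subseteq> U" "emeasure lborel (U - K) \<le> ennreal e'"
        using open_compact_sandwich[OF base(1) _ \<open>e' > 0\<close>] base by auto
      have [measurable]: "A \<in> sets borel" "U \<in> sets borel" "K \<in> sets borel"
        using base KU borel_open borel_compact by auto
      obtain d where d: "d > 0" "\<And>x y. x \<in> K \<Longrightarrow> y \<in> - U \<Longrightarrow> d \<le> dist x y"
      proof -
        have "closed (- U)" "K \<inter> - U = {}" using KU by auto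
        then show ?thesis
          using separate_compact_closed[OF KU(1), of "- U"] that by blast
      qed
      show "\<exists>d>0. \<forall>h. norm h < d \<longrightarrow>
          (\<integral>\<^sup>+x. ennreal \<bar>indicat_real A (x + h) *\<^sub>R c - indicat_real A x *\<^sub>R c\<bar> \<partial>lborel) \<le> ennreal e"
      proof (intro exI conjI allI impI)
        fix h :: 'a assume h: "norm h < d"
        have inU: "x + h \<in> U" "x - h \<in> U" if "x \<in> K" for x
          using d(2)[OF that, of "x + h"] d(2)[OF that, of "x - h"] h by (auto simp: dist_norm)
        have "ennreal \<bar>indicat_real A (x + h) *\<^sub>R c - indicat_real A x *\<^sub>R c\<bar>
            \<le> ennreal \<bar>c\<bar> * (indicator (U - K) (x + h) + indicator (U - K) x)" for x
        proof (cases "x + h \<in> A \<longleftrightarrow> x \<in> A")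
          case True
          then show ?thesis by (simp add: indicator_def)
        next
          case False
          \<comment> \<open>The one of the two points that belongs to \<open>A\<close> lies in
            \<open>U - K\<close> or in \<open>K\<close>. In the second case the shift is too short
            to leave \<open>U\<close>, and the other point, being outside \<open>A\<close>, is
            outside \<open>K\<close>; so it lies in \<open>U - K\<close>.\<close>
          then have "x + h \<in> U - K \<or> x \<in> U - K"
            using KU(3,4) inU(1)[of x] inU(2)[of "x + h"] by auto
          then have "1 \<le> (indicator (U - K) (x + h) + indicator (U - K) x :: ennreal)"
            by (auto simp: indicator_def)
          then have "ennreal \<bar>c\<bar> * 1 \<le> ennreal \<bar>c\<bar> * (indicator (U - K) (x + h) + indicator (U - K) x)"
            by (rule mult_left_mono) simp
          moreover have "\<bar>indicat_real A (x + h) *\<^sub>R c - indicat_real A x *\<^sub>R c\<bar> = \<bar>c\<bar>"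
            using False by (auto simp: indicator_def)
          ultimately show ?thesis by simp
        qed
        then have "(\<integral>\<^sup>+x. ennreal \<bar>indicat_real A (x + h) *\<^sub>R c - indicat_real A x *\<^sub>R c\<bar> \<partial>lborel)
            \<le> (\<integral>\<^sup>+x. ennreal \<bar>c\<bar> * (indicator (U - K) (x + h) + indicator (U - K) x) \<partial>lborel)"
          by (intro nn_integral_mono)
        also have "\<dots> = ennreal \<bar>c\<bar> * ((\<integral>\<^sup>+x. indicator (U - K) (x + h) \<partial>lborel) + emeasure lborel (U - K))"
          by (subst nn_integral_cmult, measurable, subst nn_integral_add) auto
        also have "(\<integral>\<^sup>+x. indicator (U - K) (x + h) \<partial>lborel) = emeasure lborel (U - K)"
          by (subst nn_integral_lborel_translate) auto
        also have "ennreal \<bar>c\<bar> * (emeasure lborel (U - K) + emeasure lborel (U - K))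
            \<le> ennreal \<bar>c\<bar> * (ennreal e' + ennreal e')"
          using KU by (intro mult_left_mono add_mono) auto
        also have "\<dots> = ennreal (\<bar>c\<bar> * (e' + e'))"
          using \<open>e' > 0\<close> by (simp add: ennreal_mult ennreal_plus[symmetric] del: ennreal_plus)
        also have "\<dots> \<le> ennreal e"
        proof (rule ennreal_leI)
          have "\<bar>c\<bar> + 1 \<noteq> 0" by linarith
          then have "e' * (2 * (\<bar>c\<bar> + 1)) = e"
            unfolding e'_def by (subst nonzero_eq_divide_eq[symmetric]) simp_all
          then show "\<bar>c\<bar> * (e' + e') \<le> e"
            using \<open>e' > 0\<close> by (simp add: algebra_simps)
        qed
        finally show "(\<integral>\<^sup>+x. ennreal \<bar>indicat_real A (x + h) *\<^sub>R c - indicat_real A x *\<^sub>R c\<bar> \<partial>lborel) \<le> ennreal e" .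
      qed (rule d)
    qed
  next
    case (add f g)
    show ?case
    proof (intro allI impI)
      fix e :: real assume "e > 0"
      have [measurable]: "f \<in> borel_measurable borel" "g \<in> borel_measurable borel"
        using add(1,2) by (auto dest: borel_measurable_integrable)
      obtain d1 where d1: "d1 > 0" "\<And>h. norm h < d1 \<Longrightarrow> (\<integral>\<^sup>+x. ennreal \<bar>f (x + h) - f x\<bar> \<partial>lborel) \<le> ennreal (e / 2)"
        using add(3) \<open>e > 0\<close> half_gt_zero by blast
      obtain d2 where d2: "d2 > 0" "\<And>h. norm h < d2 \<Longrightarrow> (\<integral>\<^sup>+x. ennreal \<bar>g (x + h) - g x\<bar> \<partial>lborel) \<le> ennreal (e / 2)"
        using add(4) \<open>e > 0\<close> half_gt_zero by blast
      show "\<exists>d>0. \<forall>h. norm h < d \<longrightarrow> (\<integral>\<^sup>+x. ennreal \<bar>f (x + h) + g (x + h) - (f x + g x)\<bar> \<partial>lborel) \<le> ennreal e"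
      proof (intro exI conjI allI impI)
        show "min d1 d2 > 0" using d1 d2 by simp
        fix h :: 'a assume h: "norm h < min d1 d2"
        have "(\<integral>\<^sup>+x. ennreal \<bar>f (x + h) + g (x + h) - (f x + g x)\<bar> \<partial>lborel)
            \<le> (\<integral>\<^sup>+x. ennreal \<bar>f (x + h) - f x\<bar> + ennreal \<bar>g (x + h) - g x\<bar> \<partial>lborel)"
          by (intro nn_integral_mono) (auto simp flip: ennreal_plus intro!: ennreal_leI)
        also have "\<dots> = (\<integral>\<^sup>+x. ennreal \<bar>f (x + h) - f x\<bar> \<partial>lborel) + (\<integral>\<^sup>+x. ennreal \<bar>g (x + h) - g x\<bar> \<partial>lborel)"
          by (rule nn_integral_add) auto
        also have "\<dots> \<le> ennreal (e / 2) + ennreal (e / 2)"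
          using d1 d2 h by (intro add_mono) auto
        also have "\<dots> = ennreal e" using \<open>e > 0\<close> by (simp flip: ennreal_plus)
        finally show "(\<integral>\<^sup>+x. ennreal \<bar>f (x + h) + g (x + h) - (f x + g x)\<bar> \<partial>lborel) \<le> ennreal e" .
      qed
    qed
  next
    case (lim f s)
    show ?case
    proof (intro allI impI)
      fix e :: real assume "e > 0"
      have [measurable]: "f \<in> borel_measurable borel" "\<And>i. s i \<in> borel_measurable borel"
        using lim(1,4) by (auto dest: borel_measurable_integrable)
      have "(\<lambda>i. \<integral>\<^sup>+x. norm (f x - s i x) \<partial>lborel) \<longlonglongrightarrow> 0"
      proof (rule nn_integral_dominated_convergence_norm[where w = "\<lambda>x. 2 * norm (f x)"])
        show "AE x in lborel. norm (s j x) \<le> 2 * norm (f x)" for j using lim(3) by auto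
        show "(\<integral>\<^sup>+x. ennreal (2 * norm (f x)) \<partial>lborel) < \<infinity>"
          using lim(4) by (simp add: ennreal_mult nn_integral_cmult integrable_iff_bounded ennreal_mult_less_top)
        show "AE x in lborel. (\<lambda>i. s i x) \<longlonglongrightarrow> f x" using lim(2) by auto
      qed auto
      then have "eventually (\<lambda>i. (\<integral>\<^sup>+x. norm (f x - s i x) \<partial>lborel) < ennreal (e / 3)) sequentially"
        using \<open>e > 0\<close> by (intro order_tendstoD) auto
      then obtain i where i: "(\<integral>\<^sup>+x. norm (f x - s i x) \<partial>lborel) \<le> ennreal (e / 3)"
        unfolding eventually_sequentially using less_imp_le by blast
      obtain d where d: "d > 0" "\<And>h. norm h < d \<Longrightarrow> (\<integral>\<^sup>+x. ennreal \<bar>s i (x + h) - s i x\<bar> \<partial>lborel) \<le> ennreal (e / 3)"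
        using lim(5)[of i, rule_format, of "e / 3"] \<open>e > 0\<close> by auto
      show "\<exists>d>0. \<forall>h. norm h < d \<longrightarrow> (\<integral>\<^sup>+x. ennreal \<bar>f (x + h) - f x\<bar> \<partial>lborel) \<le> ennreal e"
      proof (intro exI conjI allI impI)
        fix h :: 'a assume h: "norm h < d"
        have "(\<integral>\<^sup>+x. ennreal \<bar>f (x + h) - f x\<bar> \<partial>lborel)
            \<le> (\<integral>\<^sup>+x. ennreal (norm (f (x + h) - s i (x + h))) + ennreal \<bar>s i (x + h) - s i x\<bar> + ennreal (norm (f x - s i x)) \<partial>lborel)"
          by (intro nn_integral_mono) (auto simp flip: ennreal_plus intro!: ennreal_leI)
        also have "\<dots> = (\<integral>\<^sup>+x. ennreal (norm (f (x + h) - s i (x + h))) \<partial>lborel) + (\<integral>\<^sup>+x. ennreal \<bar>s i (x + h) - s i x\<bar> \<partial>lborel) + (\<integral>\<^sup>+x. ennreal (norm (f x - s i x)) \<partial>lborel)"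
          by (simp add: nn_integral_add)
        also have "(\<integral>\<^sup>+x. ennreal (norm (f (x + h) - s i (x + h))) \<partial>lborel) = (\<integral>\<^sup>+x. ennreal (norm (f x - s i x)) \<partial>lborel)"
          by (rule nn_integral_lborel_translate) auto
        also have "(\<integral>\<^sup>+x. ennreal (norm (f x - s i x)) \<partial>lborel) + (\<integral>\<^sup>+x. ennreal \<bar>s i (x + h) - s i x\<bar> \<partial>lborel) + (\<integral>\<^sup>+x. ennreal (norm (f x - s i x)) \<partial>lborel)
            \<le> ennreal (e / 3) + ennreal (e / 3) + ennreal (e / 3)"
          using i d h by (intro add_mono) auto
        also have "\<dots> = ennreal e" using \<open>e > 0\<close> by (simp flip: ennreal_plus)
        finally show "(\<integral>\<^sup>+x. ennreal \<bar>f (x + h) - f x\<bar> \<partial>lborel) \<le> ennreal e" .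
      qed (rule d)
    qed
  qed
  then show ?thesis using that \<open>e > 0\<close> by blast
qed

section \<open>The Hardy-Littlewood maximal function\<close>

lemma ennpowr_ennreal: "x \<ge> 0 \<Longrightarrow> ennpowr (ennreal x) a = ennreal (x powr a)"
  by (simp add: ennpowr_def)

lemma ennpowr_top [simp]: "ennpowr top a = top"
  by (simp add: ennpowr_def)

lemma ennpowr_0 [simp]: "ennpowr 0 a = 0"
  by (simp add: ennpowr_def)

lemma ennpowr_mono: "x \<le> y \<Longrightarrow> 0 \<le> a \<Longrightarrow> ennpowr x a \<le> ennpowr y a"
  by (cases x; cases y) (auto simp: ennpowr_ennreal top_unique intro!: ennreal_leI powr_mono2)

lemma ennpowr_cmult:
  "c > 0 \<Longrightarrow> ennpowr (ennreal c * x) a = ennreal (c powr a) * ennpowr x a"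
proof (cases x)
  case (real b)
  assume "c > 0"
  then have "ennpowr (ennreal c * x) a = ennpowr (ennreal (c * b)) a"
    using real by (simp add: ennreal_mult)
  also have "\<dots> = ennreal ((c * b) powr a)"
    using real \<open>c > 0\<close> by (intro ennpowr_ennreal) simp
  also have "\<dots> = ennreal (c powr a) * ennpowr x a"
    using real \<open>c > 0\<close> by (simp add: ennpowr_ennreal powr_mult ennreal_mult)
  finally show ?thesis .
qed (simp add: ennreal_mult_top)

lemma ennpowr_measurable [measurable (raw)]:
  assumes [measurable]: "f \<in> borel_measurable M"
  shows "(\<lambda>x. ennpowr (f x) a) \<in> borel_measurable M"
  unfolding ennpowr_def by measurable

lemma ball_sets_borel [measurable]: "ball x r \<in> sets borel"
  by simp

lemma emeasure_lborel_ball: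
  fixes c :: "'a::euclidean_space"
  assumes "r \<ge> 0"
  shows "emeasure lborel (ball c r) = ennreal (r ^ DIM('a) * measure lborel (ball (0::'a) 1))"
  using emeasure_eq_ennreal_measure[of lborel "ball c r"] emeasure_lborel_ball_finite[of c r]
    content_ball_conv_unit_ball[OF assms, of c] by auto

lemma content_unit_ball_pos: "measure lborel (ball (0::'a::euclidean_space) 1) > 0"
  by (rule content_ball_pos) simp

text \<open>The averages are normalised by \<open>R ^ DIM('a)\<close> and not by the volume of the
  ball, which is why the unit ball volume shows up in later constants. Extended values let the
  operator be applied to its own output.\<close>

definition hl_maximal :: "('a::euclidean_space \<Rightarrow> ennreal) \<Rightarrow> 'a \<Rightarrow> ennreal" where
  "hl_maximal g x =
     (SUP R\<in>{0<..}. ennreal (1 / R ^ DIM('a)) * (\<integral>\<^sup>+y\<in>ball x R. g y \<partial>lborel))"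

lemma nn_integral_ball_le_hl_maximal:
  fixes x :: "'a::euclidean_space"
  assumes "R > 0"
  shows "(\<integral>\<^sup>+y\<in>ball x R. g y \<partial>lborel) \<le> ennreal (R ^ DIM('a)) * hl_maximal g x"
proof -
  have "ennreal (1 / R ^ DIM('a)) * (\<integral>\<^sup>+y\<in>ball x R. g y \<partial>lborel) \<le> hl_maximal g x"
    unfolding hl_maximal_def using assms by (intro SUP_upper) auto
  then have "ennreal (R ^ DIM('a)) * (ennreal (1 / R ^ DIM('a)) * (\<integral>\<^sup>+y\<in>ball x R. g y \<partial>lborel))
      \<le> ennreal (R ^ DIM('a)) * hl_maximal g x"
    by (rule mult_left_mono) auto
  then show ?thesis
    using assms by (simp add: mult.assoc[symmetric] ennreal_mult[symmetric])
qed

lemma less_hl_maximal_iff: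
  fixes x :: "'a::euclidean_space"
  shows "t < hl_maximal g x \<longleftrightarrow>
    (\<exists>R>0. t < ennreal (1 / R ^ DIM('a)) * (\<integral>\<^sup>+y\<in>ball x R. g y \<partial>lborel))"
  by (auto simp: hl_maximal_def less_SUP_iff)

text \<open>Lower semicontinuity: if the average over a ball exceeds \<open>t\<close>, monotone
  convergence makes the integral over a slightly smaller concentric ball large enough too, and that
  smaller ball lies in the ball of radius \<open>R\<close> about any nearby centre.\<close>

lemma open_hl_maximal_superlevel:
  fixes g :: "'a::euclidean_space \<Rightarrow> ennreal"
  assumes [measurable]: "g \<in> borel_measurable borel"
  shows "open {x. t < hl_maximal g x}"
proof (rule openI)
  fix x assume "x \<in> {x. t < hl_maximal g x}"
  then obtain R where R: "R > 0" "t < ennreal (1 / R ^ DIM('a)) * (\<integral>\<^sup>+y\<in>ball x R. g y \<partial>lborel)"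
    by (auto simp: less_hl_maximal_iff)
  have "(\<integral>\<^sup>+y\<in>ball x R. g y \<partial>lborel) = (\<integral>\<^sup>+y. (SUP k. g y * indicator (ball x (R - 1 / Suc k)) y) \<partial>lborel)"
  proof (intro nn_integral_cong antisym)
    fix y
    show "(SUP k. g y * indicator (ball x (R - 1 / Suc k)) y) \<le> g y * indicator (ball x R) y"
      by (intro SUP_least) (auto split: split_indicator intro: less_le_trans)
    show "g y * indicator (ball x R) y \<le> (SUP k. g y * indicator (ball x (R - 1 / Suc k)) y)"
    proof (cases "y \<in> ball x R")
      case True
      then obtain k where "1 / Suc k < R - dist x y"
        using nat_approx_posE[of "R - dist x y"] by auto
      then show ?thesis
        by (intro SUP_upper2[of k]) (auto split: split_indicator)
    qed auto
  qed
  also have "\<dots> = (SUP k. \<integral>\<^sup>+y\<in>ball x (R - 1 / Suc k). g y \<partial>lborel)"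
  proof (rule nn_integral_monotone_convergence_SUP)
    show "incseq (\<lambda>k y. g y * indicator (ball x (R - 1 / Suc k)) y)"
    proof (intro incseq_SucI le_funI)
      fix k y
      have "1 / Suc (Suc k) \<le> 1 / Suc k" by (simp add: field_simps)
      then show "g y * indicator (ball x (R - 1 / Suc k)) y \<le> g y * indicator (ball x (R - 1 / Suc (Suc k))) y"
        by (auto split: split_indicator)
    qed
  qed (intro borel_measurable_times_ennreal borel_measurable_indicator, auto)
  finally have "t < (SUP k. ennreal (1 / R ^ DIM('a)) * (\<integral>\<^sup>+y\<in>ball x (R - 1 / Suc k). g y \<partial>lborel))"
    using R(2) by (simp add: SUP_mult_left_ennreal)
  then obtain k where k: "t < ennreal (1 / R ^ DIM('a)) * (\<integral>\<^sup>+y\<in>ball x (R - 1 / Suc k). g y \<partial>lborel)"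
    by (auto simp: less_SUP_iff)
  show "\<exists>e>0. ball x e \<subseteq> {x. t < hl_maximal g x}"
  proof (intro exI conjI subsetI CollectI)
    show "(0::real) < 1 / Suc k" by simp
    fix z assume z: "z \<in> ball x (1 / Suc k)"
    have "ball x (R - 1 / Suc k) \<subseteq> ball z R"
    proof
      fix y assume "y \<in> ball x (R - 1 / Suc k)"
      then show "y \<in> ball z R"
        using z dist_triangle[of z y x] by (simp add: dist_commute)
    qed
    then have "(\<integral>\<^sup>+y\<in>ball x (R - 1 / Suc k). g y \<partial>lborel) \<le> (\<integral>\<^sup>+y\<in>ball z R. g y \<partial>lborel)"
      by (intro nn_integral_mono) (auto split: split_indicator)
    then have "t < ennreal (1 / R ^ DIM('a)) * (\<integral>\<^sup>+y\<in>ball z R. g y \<partial>lborel)"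
      using k by (meson less_le_trans mult_left_mono zero_le)
    then show "t < hl_maximal g z"
      using R(1) by (auto simp: less_hl_maximal_iff)
  qed
qed

lemma hl_maximal_measurable [measurable]:
  assumes "g \<in> borel_measurable borel"
  shows "hl_maximal g \<in> borel_measurable borel"
  by (rule borel_measurableI_greater) (use open_hl_maximal_superlevel[OF assms] in auto)

lemma nn_integral_count_space_indicator_le:
  assumes "\<And>i j. i \<in> C \<Longrightarrow> j \<in> C \<Longrightarrow> x \<in> B i \<Longrightarrow> x \<in> B j \<Longrightarrow> i = j"
  shows "(\<integral>\<^sup>+i. indicator (B i) x \<partial>count_space C) \<le> (1::ennreal)"
proof (cases "\<exists>i\<in>C. x \<in> B i")
  case True
  then obtain i where i: "i \<in> C" "x \<in> B i" by auto
  have "(\<integral>\<^sup>+j. indicator (B j) x \<partial>count_space C) = (\<integral>\<^sup>+j. indicator {i} j \<partial>count_space C :: ennreal)"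
    using i assms by (intro nn_integral_cong) (auto split: split_indicator)
  also have "\<dots> = 1" using i by (subst nn_integral_indicator) auto
  finally show ?thesis by simp
next
  case False
  then have "(\<integral>\<^sup>+j. indicator (B j) x \<partial>count_space C) = (\<integral>\<^sup>+j. 0 \<partial>count_space C :: ennreal)"
    by (intro nn_integral_cong) auto
  then show ?thesis by simp
qed

text \<open>Sums over the Vitali family are written as integrals against counting measure, so that
  exchanging sum and integral needs no enumeration of the family.\<close>

lemma emeasure_UN_le_nn_integral_count_space:
  assumes "countable C" "\<And>i. i \<in> C \<Longrightarrow> B i \<in> sets M"
  shows "emeasure M (\<Union>i\<in>C. B i) \<le> (\<integral>\<^sup>+i. emeasure M (B i) \<partial>count_space C)"
proof -
  have "emeasure M (\<Union>i\<in>C. B i) = (\<integral>\<^sup>+x. indicator (\<Union>i\<in>C. B i) x \<partial>M)"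
    using assms by (subst nn_integral_indicator) (auto intro!: sets.countable_UN')
  also have "\<dots> \<le> (\<integral>\<^sup>+x. \<integral>\<^sup>+i. indicator (B i) x \<partial>count_space C \<partial>M)"
  proof (intro nn_integral_mono)
    fix x
    show "indicator (\<Union>i\<in>C. B i) x \<le> (\<integral>\<^sup>+i. indicator (B i) x \<partial>count_space C :: ennreal)"
    proof (cases "x \<in> (\<Union>i\<in>C. B i)")
      case True
      then obtain i where i: "i \<in> C" "x \<in> B i" by auto
      have "(1::ennreal) = (\<integral>\<^sup>+j. indicator {i} j \<partial>count_space C)"
        using i by (subst nn_integral_indicator) auto
      also have "\<dots> \<le> (\<integral>\<^sup>+j. indicator (B j) x \<partial>count_space C)"
        using i by (intro nn_integral_mono) (auto split: split_indicator)
      finally show ?thesis using True by simp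
    qed auto
  qed
  also have "\<dots> = (\<integral>\<^sup>+i. \<integral>\<^sup>+x. indicator (B i) x \<partial>M \<partial>count_space C)"
    using assms by (intro nn_integral_count_space_nn_integral) auto
  also have "\<dots> = (\<integral>\<^sup>+i. emeasure M (B i) \<partial>count_space C)"
    using assms by (intro nn_integral_cong) auto
  finally show ?thesis .
qed

text \<open>Vitali covering: among the balls on which the average of \<open>g\<close> exceeds
  \<open>t\<close>, a countable disjoint subfamily has fivefold enlargements covering the superlevel
  set. Each enlargement has volume at most \<open>5^n \<omega> / t\<close> times the integral of
  \<open>g\<close> over the original ball, and disjointness bounds the sum of these integrals by the
  full integral.\<close>

lemma hl_maximal_weak_type:
  fixes g :: "'a::euclidean_space \<Rightarrow> ennreal"
  assumes [measurable]: "g \<in> borel_measurable borel" and "t > 0"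
  shows "emeasure lborel {x. ennreal t < hl_maximal g x}
    \<le> ennreal (5 ^ DIM('a) * measure lborel (ball (0::'a) 1) / t) * (\<integral>\<^sup>+x. g x \<partial>lborel)"
proof (cases "(\<integral>\<^sup>+x. g x \<partial>lborel) = \<infinity>")
  case True
  then show ?thesis
    using \<open>t > 0\<close> content_unit_ball_pos[where 'a = 'a] by (simp add: ennreal_mult_top)
next
  case False
  then obtain I where I: "(\<integral>\<^sup>+x. g x \<partial>lborel) = ennreal I" "I \<ge> 0"
    by (cases "\<integral>\<^sup>+x. g x \<partial>lborel") auto
  let ?w = "measure lborel (ball (0::'a) 1)"
  define K :: "('a \<times> real) set" where
    "K = {(x, R). R > 0 \<and> ennreal t < ennreal (1 / R ^ DIM('a)) * (\<integral>\<^sup>+y\<in>ball x R. g y \<partial>lborel)}"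
  have K: "snd i > 0" "ennreal (t * snd i ^ DIM('a)) \<le> (\<integral>\<^sup>+y\<in>ball (fst i) (snd i). g y \<partial>lborel)"
    if "i \<in> K" for i
  proof -
    obtain x R where i: "i = (x, R)" by (cases i)
    show "snd i > 0" using that by (auto simp: K_def i)
    have R: "R > 0" using that by (auto simp: K_def i)
    have "ennreal (t * R ^ DIM('a)) = ennreal (R ^ DIM('a)) * ennreal t"
      using \<open>t > 0\<close> R by (simp add: ennreal_mult[symmetric] mult.commute)
    also have "\<dots> \<le> ennreal (R ^ DIM('a)) * (ennreal (1 / R ^ DIM('a)) * (\<integral>\<^sup>+y\<in>ball x R. g y \<partial>lborel))"
      using that by (intro mult_left_mono) (auto simp: K_def i)
    also have "\<dots> = (\<integral>\<^sup>+y\<in>ball x R. g y \<partial>lborel)"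
      using R by (simp add: mult.assoc[symmetric] ennreal_mult[symmetric])
    finally show "ennreal (t * snd i ^ DIM('a)) \<le> (\<integral>\<^sup>+y\<in>ball (fst i) (snd i). g y \<partial>lborel)"
      by (simp add: i)
  qed
  \<comment> \<open>The covering lemma requires bounded radii. A large average over a large ball
    would exceed the total integral \<open>I\<close>; radii above 1 are dominated by their
    \<open>n\<close>-th power, which avoids a root.\<close>
  have bound: "snd i \<le> max 1 (I / t)" if "i \<in> K" for i
  proof (cases "snd i \<le> 1")
    case False
    have "ennreal (t * snd i ^ DIM('a)) \<le> (\<integral>\<^sup>+y. g y \<partial>lborel)"
      using K(2)[OF that] by (rule order_trans) (auto intro!: nn_integral_mono split: split_indicator)
    then have "t * snd i ^ DIM('a) \<le> I"
      using I by (simp add: ennreal_le_iff)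
    moreover have "snd i \<le> snd i ^ DIM('a)"
      using False by (intro self_le_power) auto
    ultimately have "t * snd i \<le> I"
      using \<open>t > 0\<close> by (smt (verit) mult_left_mono)
    then have "snd i \<le> I / t" using \<open>t > 0\<close> by (simp add: field_simps)
    then show ?thesis by simp
  qed auto
  have cover: "{x. ennreal t < hl_maximal g x} \<subseteq> (\<Union>i\<in>K. ball (fst i) (snd i))"
    by (force simp: less_hl_maximal_iff K_def)
  obtain C where C: "countable C" "C \<subseteq> K"
     "pairwise (\<lambda>i j. disjnt (ball (fst i) (snd i)) (ball (fst j) (snd j))) C"
     "{x. ennreal t < hl_maximal g x} \<subseteq> (\<Union>i\<in>C. ball (fst i) (5 * snd i))"
  proof -
    have "\<And>i. i \<in> K \<Longrightarrow> 0 < snd i \<and> snd i \<le> max 1 (I / t)"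
      using K(1) bound by blast
    from Vitali_covering_lemma_balls[OF cover this] show ?thesis
      using that by blast
  qed
  have "emeasure lborel {x. ennreal t < hl_maximal g x} \<le> emeasure lborel (\<Union>i\<in>C. ball (fst i) (5 * snd i))"
    using C by (intro emeasure_mono) (auto intro!: borel_open open_UN)
  also have "\<dots> \<le> (\<integral>\<^sup>+i. emeasure lborel (ball (fst i) (5 * snd i)) \<partial>count_space C)"
    using C by (intro emeasure_UN_le_nn_integral_count_space) auto
  also have "\<dots> \<le> (\<integral>\<^sup>+i. ennreal (5 ^ DIM('a) * ?w / t) * (\<integral>\<^sup>+y\<in>ball (fst i) (snd i). g y \<partial>lborel) \<partial>count_space C)"
  proof (intro nn_integral_mono)
    fix i assume "i \<in> space (count_space C)"
    then have i: "i \<in> K" using C by auto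
    have "emeasure lborel (ball (fst i) (5 * snd i)) = ennreal (5 ^ DIM('a) * ?w / t) * ennreal (t * snd i ^ DIM('a))"
      using K(1)[OF i] \<open>t > 0\<close>
      by (subst emeasure_lborel_ball) (auto simp: power_mult_distrib ennreal_mult[symmetric] mult_ac)
    also have "\<dots> \<le> ennreal (5 ^ DIM('a) * ?w / t) * (\<integral>\<^sup>+y\<in>ball (fst i) (snd i). g y \<partial>lborel)"
      by (intro mult_left_mono K(2)[OF i]) auto
    finally show "emeasure lborel (ball (fst i) (5 * snd i)) \<le> \<dots>" .
  qed
  also have "\<dots> = ennreal (5 ^ DIM('a) * ?w / t) * (\<integral>\<^sup>+i. (\<integral>\<^sup>+y\<in>ball (fst i) (snd i). g y \<partial>lborel) \<partial>count_space C)"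
    by (rule nn_integral_cmult) auto
  also have "(\<integral>\<^sup>+i. (\<integral>\<^sup>+y\<in>ball (fst i) (snd i). g y \<partial>lborel) \<partial>count_space C)
      = (\<integral>\<^sup>+y. (\<integral>\<^sup>+i. g y * indicator (ball (fst i) (snd i)) y \<partial>count_space C) \<partial>lborel)"
    using C by (intro nn_integral_count_space_nn_integral[symmetric]) auto
  also have "\<dots> = (\<integral>\<^sup>+y. g y * (\<integral>\<^sup>+i. indicator (ball (fst i) (snd i)) y \<partial>count_space C) \<partial>lborel)"
    by (intro nn_integral_cong nn_integral_cmult) auto
  also have "\<dots> \<le> (\<integral>\<^sup>+y. g y * 1 \<partial>lborel)"
  proof (intro nn_integral_mono mult_left_mono nn_integral_count_space_indicator_le)
    fix y i j assume "i \<in> C" "j \<in> C" "y \<in> ball (fst i) (snd i)" "y \<in> ball (fst j) (snd j)"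
    then show "i = j" using C(3) unfolding pairwise_def disjnt_def by blast
  qed auto
  finally show ?thesis
    by (simp add: mult_left_mono)
qed

section \<open>Layer-cake formula and the strong type inequality\<close>

lemma nn_integral_powr_Icc:
  assumes "a > 0" "b \<ge> 0"
  shows "(\<integral>\<^sup>+t\<in>{0..b}. ennreal (t powr (a - 1)) \<partial>lborel) = ennreal (b powr a / a)"
proof -
  have "((\<lambda>t. t powr (a - 1)) has_integral (b powr (a - 1 + 1) / (a - 1 + 1))) {0..b}"
    using assms by (intro has_integral_powr_from_0) auto
  then have "((\<lambda>t. t powr (a - 1) * indicator {0..b} t) has_integral (b powr a / a)) UNIV"
    by (subst (asm) has_integral_restrict_UNIV[symmetric])
       (simp add: indicator_def of_bool_def if_distrib cong: if_cong)
  then have "(\<integral>\<^sup>+t. ennreal (t powr (a - 1) * indicator {0..b} t) \<partial>lborel) = ennreal (b powr a / a)"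
    by (intro nn_integral_has_integral_lborel) auto
  then show ?thesis
    by (simp add: ennreal_mult'' ennreal_indicator)
qed

lemma layer_cake_ennpowr:
  assumes "a > 0"
  shows "(\<integral>\<^sup>+t. ennreal (t powr (a - 1)) * indicator {t. 0 \<le> t \<and> ennreal t < x} t \<partial>lborel)
    = ennreal (1 / a) * ennpowr x a"
proof (cases x)
  case (real b)
  have "(\<integral>\<^sup>+t. ennreal (t powr (a - 1)) * indicator {t. 0 \<le> t \<and> ennreal t < x} t \<partial>lborel)
      = (\<integral>\<^sup>+t\<in>{0..b}. ennreal (t powr (a - 1)) \<partial>lborel)"
    using AE_lborel_singleton[of b]
    by (intro nn_integral_cong_AE, eventually_elim)
       (auto simp: real ennreal_less_iff split: split_indicator)
  then show ?thesis
    using assms real by (simp add: nn_integral_powr_Icc ennpowr_ennreal ennreal_mult[symmetric])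
next
  case top
  have "ennreal (real k powr a / a)
      \<le> (\<integral>\<^sup>+t. ennreal (t powr (a - 1)) * indicator {t. 0 \<le> t \<and> ennreal t < x} t \<partial>lborel)" for k
    unfolding nn_integral_powr_Icc[OF assms of_nat_0_le_iff, symmetric]
    by (intro nn_integral_mono) (auto simp: top split: split_indicator)
  moreover have "filterlim (\<lambda>k. real k powr a / a) at_top sequentially"
    using assms by real_asymp
  ultimately have "(\<integral>\<^sup>+t. ennreal (t powr (a - 1)) * indicator {t. 0 \<le> t \<and> ennreal t < x} t \<partial>lborel) = \<infinity>"
    using LIMSEQ_le_const2[OF ennreal_tendsto_top_eq_at_top[THEN iffD2], of "\<lambda>k. real k powr a / a"]
    by (simp add: top_unique)
  then show ?thesis
    using assms by (simp add: top ennreal_mult_top)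
qed

text \<open>Writing \<omega> for the unit ball volume: \<open>1 + \<omega>\<close> is the rescaling
  of levels caused by truncation, \<open>5^n \<omega>\<close> is the weak type constant, and
  \<open>p / (p - 1)\<close> collects the factors of the two layer-cake formulas, with exponents
  \<open>p\<close> and \<open>p - 1\<close>.\<close>

definition maximal_const :: "'a::euclidean_space itself \<Rightarrow> real \<Rightarrow> real" where
  "maximal_const _ p = (1 + measure lborel (ball (0::'a) 1)) powr p *
     (5 ^ DIM('a) * measure lborel (ball (0::'a) 1) * (p / (p - 1)))"

lemma maximal_const_pos: "p > 1 \<Longrightarrow> maximal_const TYPE('a::euclidean_space) p > 0"
  unfolding maximal_const_def
  by (intro mult_pos_pos divide_pos_pos)
     (use content_unit_ball_pos[where 'a = 'a] in \<open>auto simp: add_nonneg_eq_0_iff\<close>)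

text \<open>With the chosen normalisation the maximal function of the constant \<open>t\<close> is
  \<omega> times \<open>t\<close>, and the operator is subadditive. It serves to cut off the part of
  \<open>g\<close> below height \<open>t\<close>.\<close>

lemma hl_maximal_add_const_le:
  fixes g :: "'a::euclidean_space \<Rightarrow> ennreal"
  assumes [measurable]: "g \<in> borel_measurable borel" "g' \<in> borel_measurable borel"
    and "\<And>y. g y \<le> g' y + ennreal t" "t \<ge> 0"
  shows "hl_maximal g x \<le> hl_maximal g' x + ennreal (measure lborel (ball (0::'a) 1) * t)"
  unfolding hl_maximal_def[of g]
proof (rule SUP_least)
  fix R :: real assume "R \<in> {0<..}"
  then have R: "R > 0" by simp
  have "(\<integral>\<^sup>+y\<in>ball x R. g y \<partial>lborel) \<le> (\<integral>\<^sup>+y. g' y * indicator (ball x R) y + ennreal t * indicator (ball x R) y \<partial>lborel)"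
    using assms(3) by (intro nn_integral_mono) (auto split: split_indicator)
  also have "\<dots> = (\<integral>\<^sup>+y\<in>ball x R. g' y \<partial>lborel) + ennreal t * emeasure lborel (ball x R)"
    by (subst nn_integral_add, measurable, subst nn_integral_cmult_indicator, auto)
  also have "\<dots> \<le> ennreal (R ^ DIM('a)) * hl_maximal g' x + ennreal t * ennreal (R ^ DIM('a) * measure lborel (ball (0::'a) 1))"
    using R by (intro add_mono nn_integral_ball_le_hl_maximal) (auto simp: emeasure_lborel_ball)
  also have "\<dots> = ennreal (R ^ DIM('a)) * (hl_maximal g' x + ennreal (measure lborel (ball (0::'a) 1) * t))"
    using R \<open>t \<ge> 0\<close> by (simp add: distrib_left ennreal_mult[symmetric] mult_ac)
  finally have "ennreal (1 / R ^ DIM('a)) * (\<integral>\<^sup>+y\<in>ball x R. g y \<partial>lborel)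
      \<le> ennreal (1 / R ^ DIM('a)) * (ennreal (R ^ DIM('a)) * (hl_maximal g' x + ennreal (measure lborel (ball (0::'a) 1) * t)))"
    by (rule mult_left_mono) auto
  then show "ennreal (1 / R ^ DIM('a)) * (\<integral>\<^sup>+y\<in>ball x R. g y \<partial>lborel)
      \<le> hl_maximal g' x + ennreal (measure lborel (ball (0::'a) 1) * t)"
    using R by (simp add: mult.assoc[symmetric] ennreal_mult[symmetric])
qed

text \<open>Marcinkiewicz interpolation with the trivial bound for bounded functions. Where the
  maximal function exceeds \<open>(1 + \<omega>) t\<close>, that of the part of \<open>g\<close>
  above height \<open>t\<close> exceeds \<open>t\<close>. The weak type bound at each level,
  integrated against \<open>t powr (p - 1)\<close> and followed by Fubini, leaves a layer-cake
  integral of exponent \<open>p - 1\<close>, which converges at 0 because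
  \<open>p > 1\<close>.\<close>

lemma hl_maximal_strong_type:
  fixes g :: "'a::euclidean_space \<Rightarrow> ennreal"
  assumes [measurable]: "g \<in> borel_measurable borel" and "p > 1"
  shows "(\<integral>\<^sup>+x. ennpowr (hl_maximal g x) p \<partial>lborel)
    \<le> ennreal (maximal_const TYPE('a) p) * (\<integral>\<^sup>+x. ennpowr (g x) p \<partial>lborel)"
proof -
  let ?w = "measure lborel (ball (0::'a) 1)"
  have w: "?w > 0" by (rule content_unit_ball_pos)
  define A where "A = 5 ^ DIM('a) * ?w"
  have A: "A > 0" using w unfolding A_def by (intro mult_pos_pos) auto
  \<comment> \<open>Truncation at height \<open>t\<close> costs \<open>\<omega> t\<close>, and
    \<open>t + \<omega> t = c * t\<close>; dividing the maximal function by \<open>c\<close> makes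
    the truncation height agree with the level.\<close>
  define c where "c = 1 + ?w"
  have c: "c > 0" using w unfolding c_def by linarith
  define h where "h x = ennreal (1 / c) * hl_maximal g x" for x
  have [measurable]: "h \<in> borel_measurable borel" unfolding h_def by measurable
  have Mh: "hl_maximal g x = ennreal c * h x" for x
    using c by (simp add: h_def mult.assoc[symmetric] ennreal_mult[symmetric])
  have level: "emeasure lborel {x. ennreal t < h x}
      \<le> ennreal (A / t) * (\<integral>\<^sup>+x. g x * indicator {x. ennreal t < g x} x \<partial>lborel)" if "t > 0" for t
  proof -
    let ?g = "\<lambda>x. g x * indicator {x. ennreal t < g x} x"
    have "hl_maximal g x \<le> hl_maximal ?g x + ennreal (?w * t)" for x
      using that by (intro hl_maximal_add_const_le) (auto split: split_indicator)
    then have "{x. ennreal t < h x} \<subseteq> {x. ennreal t < hl_maximal ?g x}"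
    proof (safe, goal_cases)
      case (1 x)
      have "ennreal c * ennreal t < ennreal c * h x"
        using c by (intro ennreal_mult_strict_left_mono 1(2)) auto
      also have "\<dots> \<le> hl_maximal ?g x + ennreal (?w * t)"
        using 1(1)[of x] by (simp add: Mh)
      finally have *: "ennreal t + ennreal (?w * t) < hl_maximal ?g x + ennreal (?w * t)"
        using that w by (simp add: c_def ennreal_mult[symmetric] ennreal_plus[symmetric] algebra_simps del: ennreal_plus)
      show ?case
      proof (rule ccontr)
        assume "\<not> ennreal t < hl_maximal ?g x"
        then have "hl_maximal ?g x + ennreal (?w * t) \<le> ennreal t + ennreal (?w * t)"
          by (intro add_right_mono) simp
        with * show False by simp
      qed
    qed
    then have "emeasure lborel {x. ennreal t < h x} \<le> emeasure lborel {x. ennreal t < hl_maximal ?g x}"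
      by (intro emeasure_mono) auto
    also have "\<dots> \<le> ennreal (A / t) * (\<integral>\<^sup>+x. ?g x \<partial>lborel)"
      using that unfolding A_def by (intro hl_maximal_weak_type) auto
    finally show ?thesis .
  qed
  have "(\<integral>\<^sup>+x. ennreal (1 / p) * ennpowr (h x) p \<partial>lborel)
      = (\<integral>\<^sup>+x. \<integral>\<^sup>+t. ennreal (t powr (p - 1)) * indicator {t. 0 \<le> t \<and> ennreal t < h x} t \<partial>lborel \<partial>lborel)"
    using \<open>p > 1\<close> by (simp add: layer_cake_ennpowr)
  also have "\<dots> = (\<integral>\<^sup>+t. \<integral>\<^sup>+x. ennreal (t powr (p - 1)) * indicator {t. 0 \<le> t \<and> ennreal t < h x} t \<partial>lborel \<partial>lborel)"
    by (rule lborel_pair.Fubini') measurable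
  also have "\<dots> \<le> (\<integral>\<^sup>+t. \<integral>\<^sup>+x. ennreal A * (g x * (ennreal (t powr (p - 1 - 1)) * indicator {t. 0 \<le> t \<and> ennreal t < g x} t)) \<partial>lborel \<partial>lborel)"
  proof (rule nn_integral_mono)
    fix t :: real
    show "(\<integral>\<^sup>+x. ennreal (t powr (p - 1)) * indicator {t. 0 \<le> t \<and> ennreal t < h x} t \<partial>lborel)
        \<le> (\<integral>\<^sup>+x. ennreal A * (g x * (ennreal (t powr (p - 1 - 1)) * indicator {t. 0 \<le> t \<and> ennreal t < g x} t)) \<partial>lborel)"
    proof (cases "t > 0")
      case True
      have "(\<integral>\<^sup>+x. ennreal (t powr (p - 1)) * indicator {t. 0 \<le> t \<and> ennreal t < h x} t \<partial>lborel)
          = (\<integral>\<^sup>+x. ennreal (t powr (p - 1)) * indicator {x. ennreal t < h x} x \<partial>lborel)"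
        using True by (intro nn_integral_cong) (auto split: split_indicator)
      also have "\<dots> = ennreal (t powr (p - 1)) * emeasure lborel {x. ennreal t < h x}"
        by (subst nn_integral_cmult) auto
      also have "\<dots> \<le> ennreal (t powr (p - 1)) * (ennreal (A / t) * (\<integral>\<^sup>+x. g x * indicator {x. ennreal t < g x} x \<partial>lborel))"
        by (intro mult_left_mono level True) auto
      also have "\<dots> = ennreal (A * t powr (p - 1 - 1)) * (\<integral>\<^sup>+x. g x * indicator {x. ennreal t < g x} x \<partial>lborel)"
      proof -
        have "t powr (p - 1) * (A / t) = A * t powr (p - 1 - 1)"
          using True by (simp add: powr_diff power2_eq_square)
        then show ?thesis
          using True A by (simp only: mult.assoc[symmetric] ennreal_mult'[symmetric] powr_ge_zero)
      qed
      also have "\<dots> = (\<integral>\<^sup>+x. ennreal (A * t powr (p - 1 - 1)) * (g x * indicator {x. ennreal t < g x} x) \<partial>lborel)"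
        by (subst nn_integral_cmult) auto
      also have "\<dots> = (\<integral>\<^sup>+x. ennreal A * (g x * (ennreal (t powr (p - 1 - 1)) * indicator {t. 0 \<le> t \<and> ennreal t < g x} t)) \<partial>lborel)"
        using True A by (intro nn_integral_cong) (auto simp: ennreal_mult mult_ac split: split_indicator)
      finally show ?thesis by simp
    next
      case False
      then have "(\<integral>\<^sup>+x. ennreal (t powr (p - 1)) * indicator {t. 0 \<le> t \<and> ennreal t < h x} t \<partial>lborel) = (\<integral>\<^sup>+x. 0 \<partial>(lborel :: 'a measure))"
        by (intro nn_integral_cong) (cases "t = 0", auto split: split_indicator)
      then show ?thesis by simp
    qed
  qed
  also have "\<dots> = (\<integral>\<^sup>+x. \<integral>\<^sup>+t. ennreal A * (g x * (ennreal (t powr (p - 1 - 1)) * indicator {t. 0 \<le> t \<and> ennreal t < g x} t)) \<partial>lborel \<partial>lborel)"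
    by (rule lborel_pair.Fubini') measurable
  also have "\<dots> = (\<integral>\<^sup>+x. ennreal A * (g x * (ennreal (1 / (p - 1)) * ennpowr (g x) (p - 1))) \<partial>lborel)"
    using \<open>p > 1\<close> by (simp add: nn_integral_cmult layer_cake_ennpowr[of "p - 1", simplified])
  also have "\<dots> \<le> (\<integral>\<^sup>+x. ennreal (A / (p - 1)) * ennpowr (g x) p \<partial>lborel)"
  proof (rule nn_integral_mono)
    fix x
    show "ennreal A * (g x * (ennreal (1 / (p - 1)) * ennpowr (g x) (p - 1))) \<le> ennreal (A / (p - 1)) * ennpowr (g x) p"
    proof (cases "g x")
      case (real b)
      have "b * b powr (p - 1) = b powr p"
        using real(1) \<open>p > 1\<close> by (cases "b = 0") (auto simp: powr_diff)
      then have "A * (b * (1 / (p - 1) * b powr (p - 1))) = A / (p - 1) * b powr p"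
        by simp
      then show ?thesis
        using real A \<open>p > 1\<close> by (simp add: ennpowr_ennreal ennreal_mult[symmetric])
    next
      case top
      then show ?thesis using A \<open>p > 1\<close> by (simp add: ennreal_mult_top)
    qed
  qed
  also have "\<dots> = ennreal (A / (p - 1)) * (\<integral>\<^sup>+x. ennpowr (g x) p \<partial>lborel)"
    by (subst nn_integral_cmult) auto
  finally have main: "ennreal (1 / p) * (\<integral>\<^sup>+x. ennpowr (h x) p \<partial>lborel) \<le> ennreal (A / (p - 1)) * (\<integral>\<^sup>+x. ennpowr (g x) p \<partial>lborel)"
    by (subst (asm) nn_integral_cmult) auto
  have "(\<integral>\<^sup>+x. ennpowr (hl_maximal g x) p \<partial>lborel) = ennreal (c powr p) * (\<integral>\<^sup>+x. ennpowr (h x) p \<partial>lborel)"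
    using c by (simp add: Mh ennpowr_cmult nn_integral_cmult)
  also have "\<dots> = ennreal (c powr p * p) * (ennreal (1 / p) * (\<integral>\<^sup>+x. ennpowr (h x) p \<partial>lborel))"
    using \<open>p > 1\<close> by (simp add: mult.assoc[symmetric] ennreal_mult[symmetric])
  also have "\<dots> \<le> ennreal (c powr p * p) * (ennreal (A / (p - 1)) * (\<integral>\<^sup>+x. ennpowr (g x) p \<partial>lborel))"
    by (intro mult_left_mono main) auto
  also have "\<dots> = ennreal (maximal_const TYPE('a) p) * (\<integral>\<^sup>+x. ennpowr (g x) p \<partial>lborel)"
  proof -
    have "c powr p * p * (A / (p - 1)) = maximal_const TYPE('a) p"
      unfolding maximal_const_def A_def c_def by simp
    then show ?thesis
      using \<open>p > 1\<close> A by (simp add: mult.assoc[symmetric] ennreal_mult[symmetric])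
  qed
  finally show ?thesis .
qed

section \<open>Mollification\<close>

lemma continuous_on_bump: "continuous_on A bump"
proof -
  have "(\<lambda>y. 1 * bump ((y - 0) /\<^sub>R 1)) \<in> (test_functions :: ('a \<Rightarrow> real) set)"
    by (rule bump_rescaled_test_function) simp
  then have "C_k 0 (bump :: 'a \<Rightarrow> real)"
    unfolding test_functions_def by (auto simp del: C_k.simps)
  then show ?thesis by (auto intro: continuous_on_subset)
qed

lemma bump_measurable [measurable]: "bump \<in> borel_measurable borel"
  by (rule borel_measurable_continuous_onI[OF continuous_on_bump])

definition bump_mass :: "'a::euclidean_space itself \<Rightarrow> real" where
  "bump_mass _ = enn2real (\<integral>\<^sup>+x. ennreal (bump (x::'a)) \<partial>lborel)"

lemma bump_mass:
  shows bump_mass_pos: "bump_mass TYPE('a::euclidean_space) > 0"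
    and nn_integral_bump: "(\<integral>\<^sup>+x. ennreal (bump (x::'a)) \<partial>lborel) = ennreal (bump_mass TYPE('a))"
proof -
  have "(\<integral>\<^sup>+x. ennreal (bump (x::'a)) \<partial>lborel) \<le> (\<integral>\<^sup>+x. indicator (ball (0::'a) 1) x \<partial>lborel)"
  proof (rule nn_integral_mono)
    fix x :: 'a
    show "ennreal (bump x) \<le> indicator (ball 0 1) x"
      using bump_le_1[of x] bump_eq_0_iff[of x] by (auto split: split_indicator)
  qed
  also have "\<dots> < \<infinity>" using emeasure_lborel_ball_finite[of "0::'a" 1] by simp
  finally have fin: "(\<integral>\<^sup>+x. ennreal (bump (x::'a)) \<partial>lborel) < \<infinity>" .
  then show eq: "(\<integral>\<^sup>+x. ennreal (bump (x::'a)) \<partial>lborel) = ennreal (bump_mass TYPE('a))"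
    by (simp add: bump_mass_def)
  have "(\<integral>\<^sup>+x. ennreal (bump (x::'a)) \<partial>lborel) \<noteq> 0"
  proof
    assume "(\<integral>\<^sup>+x. ennreal (bump (x::'a)) \<partial>lborel) = 0"
    then have "AE x in lborel. ennreal (bump (x::'a)) = 0"
      by (subst (asm) nn_integral_0_iff_AE) auto
    then have "AE x in lborel. (x::'a) \<notin> ball 0 1"
    proof eventually_elim
      case (elim x)
      then have "bump x = 0" using bump_nonneg[of x] by simp
      then show ?case by (simp add: bump_eq_0_iff)
    qed
    then have "emeasure lborel (ball (0::'a) 1) = 0"
      using AE_iff_null_sets[of "ball 0 1" "lborel :: 'a measure"] by (auto dest: null_setsD1)
    then show False
      using content_unit_ball_pos[where 'a = 'a] by (simp add: measure_def)
  qed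
  then show "bump_mass TYPE('a) > 0"
    unfolding eq ennreal_eq_0_iff by simp
qed

definition mollifier :: "real \<Rightarrow> 'a::euclidean_space \<Rightarrow> real" where
  "mollifier e z = (1 / (bump_mass TYPE('a) * e ^ DIM('a))) * bump (z /\<^sub>R e)"

lemma mollifier_nonneg: "e > 0 \<Longrightarrow> mollifier e (z::'a::euclidean_space) \<ge> 0"
  using bump_mass_pos[where 'a = 'a] bump_nonneg
  by (auto simp: mollifier_def less_imp_le intro!: divide_nonneg_nonneg mult_nonneg_nonneg)

lemma mollifier_eq_0: "e > 0 \<Longrightarrow> norm z \<ge> e \<Longrightarrow> mollifier e z = 0"
  by (simp add: mollifier_def bump_eq_0_iff divide_inverse_commute[symmetric] mult.commute)

lemma mollifier_le:
  fixes z :: "'a::euclidean_space"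
  shows "e > 0 \<Longrightarrow> mollifier e z \<le> 1 / (bump_mass TYPE('a) * e ^ DIM('a)) * indicator (ball 0 e) z"
  using bump_mass_pos[where 'a = 'a] bump_le_1[of "z /\<^sub>R e"] mollifier_eq_0[of e z]
  by (auto simp: mollifier_def field_simps split: split_indicator)

lemma mollifier_measurable [measurable]: "mollifier e \<in> borel_measurable borel"
  unfolding mollifier_def[abs_def] by measurable

lemma mollifier_test_function:
  "e > 0 \<Longrightarrow> (\<lambda>y. mollifier e (y - z)) \<in> test_functions"
  unfolding mollifier_def by (rule bump_rescaled_test_function)

lemma mollifier_minus_commute: "mollifier e (z - y) = mollifier e (y - z)"
  using bump_minus[of "(y - z) /\<^sub>R e"] by (simp add: mollifier_def scaleR_diff_right)

lemma nn_integral_mollifier: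
  assumes "e > 0"
  shows "(\<integral>\<^sup>+z. ennreal (mollifier e z) \<partial>(lborel :: 'a::euclidean_space measure)) = 1"
proof -
  let ?n = "DIM('a)" and ?c = "bump_mass TYPE('a)"
  have "ennreal (mollifier e z) = ennreal (1 / (?c * e ^ ?n)) * ennreal (bump (0 + (1 / e) *\<^sub>R z))" for z :: 'a
    using assms bump_mass_pos[where 'a = 'a] unfolding mollifier_def
    by (subst ennreal_mult') (auto simp: inverse_eq_divide less_imp_le)
  then have "(\<integral>\<^sup>+z. ennreal (mollifier e z) \<partial>(lborel :: 'a measure))
      = ennreal (1 / (?c * e ^ ?n)) * (\<integral>\<^sup>+z. ennreal (bump (0 + (1 / e) *\<^sub>R z)) \<partial>(lborel :: 'a measure))"
    by (simp only:) (subst nn_integral_cmult, auto)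
  also have "\<dots> = ennreal (1 / (?c * e ^ ?n)) * (ennreal (1 / \<bar>1 / e\<bar> ^ ?n) * ennreal ?c)"
    using assms by (subst nn_integral_lborel_affine) (auto simp: nn_integral_bump)
  also have "\<dots> = 1"
    using assms bump_mass_pos[where 'a = 'a]
    by (simp add: ennreal_mult[symmetric] power_divide less_imp_le del: ennreal_mult)
  finally show ?thesis .
qed

definition mollify :: "real \<Rightarrow> ('a::euclidean_space \<Rightarrow> real) \<Rightarrow> 'a \<Rightarrow> real" where
  "mollify e f x = (LINT y|lborel. f y * mollifier e (x - y))"

lemma mollifier_bounded: "e > 0 \<Longrightarrow> \<bar>mollifier e (z::'a::euclidean_space)\<bar> \<le> 1 / (bump_mass TYPE('a) * e ^ DIM('a))"
  using mollifier_le[of e z] mollifier_nonneg[of e z] bump_mass_pos[where 'a = 'a]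
  by (auto split: split_indicator_asm)

lemma integrable_times_mollifier:
  fixes f :: "'a::euclidean_space \<Rightarrow> real"
  assumes "integrable lborel f" "e > 0"
  shows "integrable lborel (\<lambda>y. f y * mollifier e (x - y))"
proof (rule Bochner_Integration.integrable_bound)
  let ?c = "1 / (bump_mass TYPE('a) * e ^ DIM('a))"
  show "integrable lborel (\<lambda>y. f y * ?c)"
    using assms by auto
  show "AE y in lborel. norm (f y * mollifier e (x - y)) \<le> norm (f y * ?c)"
  proof (intro always_eventually allI)
    fix y
    have "\<bar>f y\<bar> * \<bar>mollifier e (x - y)\<bar> \<le> \<bar>f y\<bar> * \<bar>?c\<bar>"
      by (intro mult_left_mono order_trans[OF mollifier_bounded[OF assms(2)] abs_ge_self]) auto
    then show "norm (f y * mollifier e (x - y)) \<le> norm (f y * ?c)"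
      by (simp only: real_norm_def abs_mult)
  qed
  have [measurable]: "f \<in> borel_measurable borel"
    using borel_measurable_integrable[OF assms(1)] by simp
  show "(\<lambda>y. f y * mollifier e (x - y)) \<in> borel_measurable lborel"
    by measurable
qed

text \<open>As the kernel has mass 1, the difference is the kernel average of
  \<open>f (x - z) - f x\<close> over \<open>z\<close>. Fubini turns its norm into an average of
  translation differences with \<open>|z| < e\<close>.\<close>

lemma mollify_L1_diff:
  fixes f :: "'a::euclidean_space \<Rightarrow> real"
  assumes f: "integrable lborel f" and e: "e > 0"
    and le: "\<And>h. norm h < e \<Longrightarrow> (\<integral>\<^sup>+x. ennreal \<bar>f (x + h) - f x\<bar> \<partial>lborel) \<le> ennreal d"
  shows "(\<integral>\<^sup>+x. ennreal \<bar>mollify e f x - f x\<bar> \<partial>lborel) \<le> ennreal d"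
proof -
  have [measurable]: "f \<in> borel_measurable borel" using f by (auto dest: borel_measurable_integrable)
  have "ennreal \<bar>mollify e f x - f x\<bar> \<le> (\<integral>\<^sup>+z. ennreal \<bar>f (x - z) - f x\<bar> * ennreal (mollifier e z) \<partial>lborel)" for x
  proof -
    have int: "integrable lborel (\<lambda>y. mollifier e (x - y))"
      using e by (intro integrableI_nonneg)
        (auto simp: mollifier_nonneg nn_integral_lborel_reflect[of "\<lambda>z. ennreal (mollifier e z)"] nn_integral_mollifier)
    have "(LINT y|lborel. mollifier e (x - y)) = 1"
      using e by (subst integral_eq_nn_integral)
        (auto simp: mollifier_nonneg nn_integral_lborel_reflect[of "\<lambda>z. ennreal (mollifier e z)"] nn_integral_mollifier)
    then have "mollify e f x - f x = (LINT y|lborel. f y * mollifier e (x - y)) - (LINT y|lborel. f x * mollifier e (x - y))"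
      by (simp add: mollify_def)
    also have "\<dots> = (LINT y|lborel. f y * mollifier e (x - y) - f x * mollifier e (x - y))"
      using integrable_times_mollifier[OF f e] int by (intro Bochner_Integration.integral_diff[symmetric]) auto
    finally have "ennreal \<bar>mollify e f x - f x\<bar> = ennreal (norm (LINT y|lborel. f y * mollifier e (x - y) - f x * mollifier e (x - y)))"
      by simp
    also have "\<dots> \<le> (\<integral>\<^sup>+y. ennreal (norm (f y * mollifier e (x - y) - f x * mollifier e (x - y))) \<partial>lborel)"
      using integrable_times_mollifier[OF f e] int by (intro integral_norm_bound_ennreal) auto
    also have "\<dots> = (\<integral>\<^sup>+y. (\<lambda>z. ennreal \<bar>f (x - z) - f x\<bar> * ennreal (mollifier e z)) (x - y) \<partial>lborel)"
      using e by (intro nn_integral_cong)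
        (auto simp: left_diff_distrib[symmetric] abs_mult mollifier_nonneg ennreal_mult)
    also have "\<dots> = (\<integral>\<^sup>+z. ennreal \<bar>f (x - z) - f x\<bar> * ennreal (mollifier e z) \<partial>lborel)"
      by (rule nn_integral_lborel_reflect) measurable
    finally show ?thesis .
  qed
  then have "(\<integral>\<^sup>+x. ennreal \<bar>mollify e f x - f x\<bar> \<partial>lborel)
      \<le> (\<integral>\<^sup>+x. \<integral>\<^sup>+z. ennreal \<bar>f (x - z) - f x\<bar> * ennreal (mollifier e z) \<partial>lborel \<partial>lborel)"
    by (rule nn_integral_mono)
  also have "\<dots> = (\<integral>\<^sup>+z. \<integral>\<^sup>+x. ennreal \<bar>f (x - z) - f x\<bar> * ennreal (mollifier e z) \<partial>lborel \<partial>lborel)"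
    by (rule lborel_pair.Fubini') measurable
  also have "\<dots> = (\<integral>\<^sup>+z. (\<integral>\<^sup>+x. ennreal \<bar>f (x - z) - f x\<bar> \<partial>lborel) * ennreal (mollifier e z) \<partial>lborel)"
    by (intro nn_integral_cong nn_integral_multc) measurable
  also have "\<dots> \<le> (\<integral>\<^sup>+z. ennreal d * ennreal (mollifier e z) \<partial>(lborel :: 'a measure))"
  proof (rule nn_integral_mono)
    fix z :: 'a
    show "(\<integral>\<^sup>+x. ennreal \<bar>f (x - z) - f x\<bar> \<partial>lborel) * ennreal (mollifier e z) \<le> ennreal d * ennreal (mollifier e z)"
    proof (cases "norm z < e")
      case True
      then show ?thesis using le[of "- z"] by (intro mult_right_mono) auto
    next
      case False
      then show ?thesis using e by (simp add: mollifier_eq_0)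
    qed
  qed
  also have "\<dots> = ennreal d"
    using e by (simp add: nn_integral_cmult nn_integral_mollifier)
  finally show ?thesis .
qed

lemma mollify_measurable [measurable]:
  assumes [measurable]: "f \<in> borel_measurable borel"
  shows "mollify e f \<in> borel_measurable borel"
  unfolding mollify_def[abs_def] by measurable

text \<open>Convergence in the mean gives almost everywhere convergence along a subsequence, which
  is all that the limit of the segment inequality requires. The radii \<open>1 / (k + 2)\<close> are
  just a positive null sequence bounded by \<open>1 / 2\<close>.\<close>

lemma mollify_AE_subseq:
  fixes f :: "'a::euclidean_space \<Rightarrow> real"
  assumes f: "integrable lborel f"
  shows "\<exists>r. strict_mono r \<and> (AE x in lborel. (\<lambda>k. mollify (1 / (real (r k) + 2)) f x) \<longlonglongrightarrow> f x)"
proof -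
  have [measurable]: "f \<in> borel_measurable borel" using f by (auto dest: borel_measurable_integrable)
  define D where "D k = (\<integral>\<^sup>+x. ennreal \<bar>mollify (1 / (real k + 2)) f x - f x\<bar> \<partial>lborel)" for k
  have small: "eventually (\<lambda>k. D k \<le> ennreal d) sequentially" if "d > 0" for d
  proof -
    obtain e where e: "e > 0" "\<And>h. norm h < e \<Longrightarrow> (\<integral>\<^sup>+x. ennreal \<bar>f (x + h) - f x\<bar> \<partial>lborel) \<le> ennreal d"
      using integrable_translation_continuous[OF f \<open>d > 0\<close>] by blast
    have "eventually (\<lambda>k. 1 / (real k + 2) < e) sequentially"
      using e(1) by real_asymp
    then show ?thesis
    proof eventually_elim
      case (elim k)
      then show ?case unfolding D_def
        by (intro mollify_L1_diff f e(2)) auto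
    qed
  qed
  then have "D \<longlonglongrightarrow> 0"
  proof (intro order_tendstoI)
    fix a :: ennreal assume "0 < a"
    then obtain d where d: "d > 0" "ennreal d < a"
    proof (cases a)
      case (real b)
      then show ?thesis using \<open>0 < a\<close> that[of "b / 2"] by (auto simp: ennreal_less_iff)
    next
      case top
      then show ?thesis using that[of 1] by auto
    qed
    show "eventually (\<lambda>k. D k < a) sequentially"
      using small[OF d(1)] by eventually_elim (use d in auto)
  qed auto
  \<comment> \<open>Integrability of the difference is needed before a subsequence can be extracted.
    It comes from the same lemma, with the crude translation bound of twice the norm of
    \<open>f\<close>.\<close>
  have fin: "D k < \<infinity>" for k
  proof -
    define I where "I = (LINT x|lborel. \<bar>f x\<bar>)"
    have I: "(\<integral>\<^sup>+x. ennreal \<bar>f x\<bar> \<partial>lborel) = ennreal I" "I \<ge> 0"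
      unfolding I_def using f by (auto intro!: nn_integral_eq_integral)
    have "(\<integral>\<^sup>+x. ennreal \<bar>f (x + h) - f x\<bar> \<partial>lborel) \<le> ennreal (I + I)" for h
    proof -
      have "(\<integral>\<^sup>+x. ennreal \<bar>f (x + h) - f x\<bar> \<partial>lborel) \<le> (\<integral>\<^sup>+x. ennreal \<bar>f (x + h)\<bar> + ennreal \<bar>f x\<bar> \<partial>lborel)"
        by (intro nn_integral_mono) (auto simp flip: ennreal_plus intro!: ennreal_leI)
      also have "\<dots> = (\<integral>\<^sup>+x. ennreal \<bar>f (x + h)\<bar> \<partial>lborel) + (\<integral>\<^sup>+x. ennreal \<bar>f x\<bar> \<partial>lborel)"
        by (rule nn_integral_add) auto
      also have "(\<integral>\<^sup>+x. ennreal \<bar>f (x + h)\<bar> \<partial>lborel) = (\<integral>\<^sup>+x. ennreal \<bar>f x\<bar> \<partial>lborel)"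
        by (rule nn_integral_lborel_translate) auto
      finally show ?thesis using I by (simp only: ennreal_plus)
    qed
    then have "D k \<le> ennreal (I + I)"
      unfolding D_def by (intro mollify_L1_diff f) auto
    then show ?thesis by (rule le_less_trans) simp
  qed
  have int: "integrable lborel (\<lambda>x. mollify (1 / (real k + 2)) f x - f x)" for k
    using fin[of k] by (intro integrableI_bounded) (auto simp: D_def)
  have "(\<lambda>k. LINT x|lborel. norm (mollify (1 / (real k + 2)) f x - f x)) = (\<lambda>k. enn2real (D k))"
    by (auto simp: D_def integral_eq_nn_integral)
  moreover have "(\<lambda>k. enn2real (D k)) \<longlonglongrightarrow> 0"
    using \<open>D \<longlonglongrightarrow> 0\<close> by (intro tendsto_enn2real) auto
  ultimately obtain r where r: "strict_mono r"
      "AE x in lborel. (\<lambda>k. mollify (1 / (real (r k) + 2)) f x - f x) \<longlonglongrightarrow> 0"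
    using tendsto_L1_AE_subseq[of lborel "\<lambda>k x. mollify (1 / (real k + 2)) f x - f x"] int by auto
  have "AE x in lborel. (\<lambda>k. mollify (1 / (real (r k) + 2)) f x) \<longlonglongrightarrow> f x"
    using r(2) by eventually_elim (simp add: LIM_zero_iff)
  with r(1) show ?thesis by blast
qed

section \<open>Weak gradients and upper gradients\<close>

lemma mollifier_C_k:
  assumes "e > 0"
  shows "C_k k (mollifier e :: 'a::euclidean_space \<Rightarrow> real)"
  using mollifier_test_function[OF assms, of "0 :: 'a"] by (simp add: test_functions_def)

lemma mollifier_has_derivative:
  "e > 0 \<Longrightarrow> (mollifier e has_derivative frechet_derivative (mollifier e) (at z)) (at z)"
  by (rule C_k_Suc_has_derivative[OF mollifier_C_k])

lemma frechet_derivative_mollifier_continuous: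
  fixes h :: "'a::euclidean_space"
  assumes "e > 0"
  shows "continuous_on UNIV (\<lambda>z. frechet_derivative (mollifier e) (at z) h)"
proof -
  have "C_k (Suc 0) (mollifier e :: 'a \<Rightarrow> real)"
    by (rule mollifier_C_k[OF assms])
  then have cont: "continuous_on UNIV (\<lambda>z::'a. frechet_derivative (mollifier e) (at z) b)" if "b \<in> Basis" for b
    using that by simp
  have "frechet_derivative (mollifier e) (at z) h
      = (\<Sum>b\<in>Basis. (h \<bullet> b) * frechet_derivative (mollifier e) (at z) b)" for z :: 'a
  proof -
    have lin: "linear (frechet_derivative (mollifier e) (at z))"
      using mollifier_has_derivative[OF assms] by (rule has_derivative_linear)
    have "frechet_derivative (mollifier e) (at z) h
        = frechet_derivative (mollifier e) (at z) (\<Sum>b\<in>Basis. (h \<bullet> b) *\<^sub>R b)"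
      by (simp add: euclidean_representation)
    also have "\<dots> = (\<Sum>b\<in>Basis. (h \<bullet> b) * frechet_derivative (mollifier e) (at z) b)"
      by (simp add: linear_sum[OF lin] linear_scale[OF lin])
    finally show ?thesis .
  qed
  then show ?thesis
    using cont by (auto intro!: continuous_intros)
qed

lemma frechet_derivative_mollifier_eq_0:
  fixes z :: "'a::euclidean_space"
  assumes "e > 0" "norm z > e"
  shows "frechet_derivative (mollifier e) (at z) = (\<lambda>h. 0)"
proof -
  have "((\<lambda>z. 0) has_derivative (\<lambda>h. 0)) (at z)" by simp
  then have "(mollifier e has_derivative (\<lambda>h. 0)) (at z)"
    by (rule has_derivative_transform_within_open[where s = "- cball 0 e"])
       (use assms in \<open>auto simp: mollifier_eq_0\<close>)
  then show ?thesis by (rule frechet_derivative_at[symmetric])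
qed

lemma frechet_derivative_mollifier_bound:
  fixes h :: "'a::euclidean_space"
  assumes "e > 0"
  obtains B where "B \<ge> 0"
    "\<And>z. \<bar>frechet_derivative (mollifier e) (at z) h\<bar> \<le> B * indicator (cball 0 e) z"
proof -
  have "compact ((\<lambda>z. frechet_derivative (mollifier e) (at z) h) ` cball 0 e)"
    by (intro compact_continuous_image continuous_on_subset[OF frechet_derivative_mollifier_continuous[OF assms]]) auto
  then obtain B where B: "B > 0" "\<forall>z\<in>cball 0 e. \<bar>frechet_derivative (mollifier e) (at z) h\<bar> \<le> B"
    unfolding compact_eq_bounded_closed bounded_pos by auto
  from B show ?thesis
    using frechet_derivative_mollifier_eq_0[OF assms, where 'a = 'a]
    by (intro that[of B]) (auto split: split_indicator)
qed

text \<open>Borel representatives are used because compositions with affine maps and integrands on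
  products, as needed for Fubini, stay measurable for them. \<open>has_weak_gradient_borel\<close>
  brings Lebesgue measurable functions into this setting.\<close>

locale borel_weak_gradient =
  fixes u :: "'a::euclidean_space \<Rightarrow> real" and G :: "'a \<Rightarrow> 'a"
  assumes u_measurable [measurable]: "u \<in> borel_measurable borel"
    and G_measurable [measurable]: "G \<in> borel_measurable borel"
    and u_integrable: "\<And>K. compact K \<Longrightarrow> set_integrable lborel K u"
    and G_integrable: "\<And>K. compact K \<Longrightarrow> set_integrable lborel K G"
    and weak: "\<And>\<phi> b. \<phi> \<in> test_functions \<Longrightarrow> b \<in> Basis \<Longrightarrow>
       (LINT x|lborel. u x * frechet_derivative \<phi> (at x) b) = - (LINT x|lborel. (G x \<bullet> b) * \<phi> x)"
begin

lemma integrable_times_compactly_supported: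
  assumes [measurable]: "k \<in> borel_measurable borel" and "\<And>y. \<bar>k y\<bar> \<le> B * indicator (cball x R) y"
  shows "integrable lborel (\<lambda>y. u y * k y)" "integrable lborel (\<lambda>y. (G y \<bullet> b) * k y)"
proof -
  have B: "B * indicator (cball x R) y \<le> \<bar>B\<bar> * indicator (cball x R) y" for y
    by (auto split: split_indicator)
  show "integrable lborel (\<lambda>y. u y * k y)"
  proof (rule Bochner_Integration.integrable_bound)
    show "integrable lborel (\<lambda>y. \<bar>B\<bar> * (indicator (cball x R) y *\<^sub>R u y))"
      using u_integrable[of "cball x R"] by (intro integrable_mult_right) (simp add: set_integrable_def)
    show "AE y in lborel. norm (u y * k y) \<le> norm (\<bar>B\<bar> * (indicator (cball x R) y *\<^sub>R u y))"
    proof (intro always_eventually allI)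
      fix y
      have "\<bar>u y\<bar> * \<bar>k y\<bar> \<le> \<bar>u y\<bar> * (\<bar>B\<bar> * indicator (cball x R) y)"
        by (intro mult_left_mono order_trans[OF assms(2) B]) auto
      then show "norm (u y * k y) \<le> norm (\<bar>B\<bar> * (indicator (cball x R) y *\<^sub>R u y))"
        by (simp add: abs_mult mult_ac)
    qed
  qed measurable
  show "integrable lborel (\<lambda>y. (G y \<bullet> b) * k y)"
  proof (rule Bochner_Integration.integrable_bound)
    show "integrable lborel (\<lambda>y. \<bar>B\<bar> * norm (indicator (cball x R) y *\<^sub>R G y) * norm b)"
      using G_integrable[of "cball x R"]
      by (intro integrable_mult_left integrable_mult_right integrable_norm) (simp add: set_integrable_def)
    show "AE y in lborel. norm ((G y \<bullet> b) * k y) \<le> norm (\<bar>B\<bar> * norm (indicator (cball x R) y *\<^sub>R G y) * norm b)"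
    proof (intro always_eventually allI)
      fix y
      have "\<bar>G y \<bullet> b\<bar> * \<bar>k y\<bar> \<le> (norm (G y) * norm b) * (\<bar>B\<bar> * indicator (cball x R) y)"
        by (intro mult_mono Cauchy_Schwarz_ineq2 order_trans[OF assms(2) B]) auto
      then show "norm ((G y \<bullet> b) * k y) \<le> norm (\<bar>B\<bar> * norm (indicator (cball x R) y *\<^sub>R G y) * norm b)"
        by (simp add: abs_mult mult_ac)
    qed
  qed measurable
qed

text \<open>The kernel is at most \<open>1 / (bump_mass * e^n)\<close>; the factor
  \<open>e^n\<close> cancels against the normalisation of the maximal function, and the factor
  \<open>1 / bump_mass\<close> remains.\<close>

definition upper_gradient :: "'a \<Rightarrow> ennreal" where
  "upper_gradient x = ennreal (1 / bump_mass TYPE('a)) * hl_maximal (\<lambda>y. ennreal (norm (G y))) x"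

lemma upper_gradient_measurable [measurable]: "upper_gradient \<in> borel_measurable borel"
  unfolding upper_gradient_def[abs_def] by measurable

text \<open>The integral is what differentiation under the integral sign gives for
  \<open>mollify e u\<close> at \<open>z\<close> in direction \<open>h\<close>. The kernel is a test
  function of \<open>y\<close>, so the weak gradient identity moves the derivative onto
  \<open>G\<close>, and the result is at most a multiple of an average of \<open>|G|\<close> over
  the ball of radius \<open>e\<close>. The bound is free of \<open>e\<close>.\<close>

lemma mollified_derivative_bound:
  assumes e: "e > 0"
  shows "ennreal \<bar>LINT y|lborel. u y * frechet_derivative (mollifier e) (at (z - y)) h\<bar>
    \<le> ennreal (norm h) * upper_gradient z"
proof -
  let ?D = "\<lambda>z. frechet_derivative (mollifier e) (at z)"
  let ?c = "1 / (bump_mass TYPE('a) * e ^ DIM('a))"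
  have [measurable]: "(\<lambda>z. ?D z b) \<in> borel_measurable borel" for b :: 'a
    by (rule borel_measurable_continuous_onI[OF frechet_derivative_mollifier_continuous[OF e]])
  have intD: "integrable lborel (\<lambda>y. u y * ?D (z - y) b)" for b :: 'a
  proof -
    obtain B where "B \<ge> 0" "\<And>z. \<bar>?D z b\<bar> \<le> B * indicator (cball 0 e) z"
      using frechet_derivative_mollifier_bound[OF e, of b] by blast
    then show ?thesis
      by (intro integrable_times_compactly_supported(1)[where B = B and x = z and R = e])
         (auto simp: indicator_def dist_norm)
  qed
  have intG: "integrable lborel (\<lambda>y. (G y \<bullet> b) * mollifier e (z - y))" for b :: 'a
    using mollifier_bounded[OF e, where 'a = 'a] mollifier_eq_0[OF e, where 'a = 'a]
    by (intro integrable_times_compactly_supported(2)[where B = ?c and x = z and R = e])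
       (auto simp: indicator_def dist_norm)
  have basis: "(LINT y|lborel. u y * ?D (z - y) b) = (LINT y|lborel. (G y \<bullet> b) * mollifier e (z - y))"
    if "b \<in> Basis" for b
  proof -
    have test: "(\<lambda>y. mollifier e (z - y)) \<in> test_functions"
      using mollifier_test_function[OF e, of z] by (simp add: mollifier_minus_commute[of e z])
    \<comment> \<open>The sign from differentiating in \<open>y\<close> instead of \<open>z\<close>
      cancels the sign in the definition of the weak gradient.\<close>
    have "frechet_derivative (\<lambda>y. mollifier e (z - y)) (at y) = (\<lambda>h. - ?D (z - y) h)" for y
    proof -
      have lin: "linear (?D (z - y))"
        using mollifier_has_derivative[OF e] by (rule has_derivative_linear)
      have "((\<lambda>y. mollifier e (z - y)) has_derivative (\<lambda>h. ?D (z - y) (- h))) (at y)"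
        by (rule has_derivative_compose[OF _ mollifier_has_derivative[OF e]])
           (auto intro!: derivative_eq_intros)
      then show ?thesis
        using frechet_derivative_at linear_neg[OF lin] by fastforce
    qed
    then show ?thesis
      using weak[OF test that] by simp
  qed
  have "(LINT y|lborel. u y * ?D (z - y) h) = (LINT y|lborel. (\<Sum>b\<in>Basis. (h \<bullet> b) * (u y * ?D (z - y) b)))"
  proof (rule Bochner_Integration.integral_cong[OF refl])
    fix y
    have lin: "linear (?D (z - y))"
      using mollifier_has_derivative[OF e] by (rule has_derivative_linear)
    have "?D (z - y) h = ?D (z - y) (\<Sum>b\<in>Basis. (h \<bullet> b) *\<^sub>R b)"
      by (simp add: euclidean_representation)
    also have "\<dots> = (\<Sum>b\<in>Basis. (h \<bullet> b) * ?D (z - y) b)"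
      by (simp add: linear_sum[OF lin] linear_scale[OF lin])
    finally show "u y * ?D (z - y) h = (\<Sum>b\<in>Basis. (h \<bullet> b) * (u y * ?D (z - y) b))"
      by (simp add: sum_distrib_left mult_ac)
  qed
  also have "\<dots> = (\<Sum>b\<in>Basis. (h \<bullet> b) * (LINT y|lborel. u y * ?D (z - y) b))"
    using intD by (subst Bochner_Integration.integral_sum) auto
  also have "\<dots> = (\<Sum>b\<in>Basis. (h \<bullet> b) * (LINT y|lborel. (G y \<bullet> b) * mollifier e (z - y)))"
    by (simp add: basis)
  also have "\<dots> = (LINT y|lborel. (\<Sum>b\<in>Basis. (h \<bullet> b) * ((G y \<bullet> b) * mollifier e (z - y))))"
    using intG by (subst Bochner_Integration.integral_sum) auto
  also have "\<dots> = (LINT y|lborel. (G y \<bullet> h) * mollifier e (z - y))"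
    by (rule Bochner_Integration.integral_cong[OF refl])
       (simp add: euclidean_inner[of "G _" h] sum_distrib_left mult_ac)
  finally have "ennreal \<bar>LINT y|lborel. u y * ?D (z - y) h\<bar>
      = ennreal (norm (LINT y|lborel. (G y \<bullet> h) * mollifier e (z - y)))"
    by simp
  also have "\<dots> \<le> (\<integral>\<^sup>+y. ennreal (norm ((G y \<bullet> h) * mollifier e (z - y))) \<partial>lborel)"
    by (rule integral_norm_bound_ennreal[OF intG])
  also have "\<dots> \<le> (\<integral>\<^sup>+y. ennreal (norm h * ?c) * (ennreal (norm (G y)) * indicator (ball z e) y) \<partial>lborel)"
  proof (rule nn_integral_mono)
    fix y
    have c: "?c \<ge> 0" using bump_mass_pos[where 'a = 'a] e by (simp add: less_imp_le)
    have "\<bar>G y \<bullet> h\<bar> * \<bar>mollifier e (z - y)\<bar> \<le> (norm (G y) * norm h) * (?c * indicator (ball 0 e) (z - y))"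
      using mollifier_le[OF e, of "z - y"] mollifier_nonneg[OF e, of "z - y"]
      by (intro mult_mono Cauchy_Schwarz_ineq2) auto
    also have "\<dots> = (norm h * ?c) * (norm (G y) * indicator (ball z e) y)"
      by (auto simp: dist_norm norm_minus_commute[of y z] split: split_indicator)
    finally show "ennreal (norm ((G y \<bullet> h) * mollifier e (z - y))) \<le> ennreal (norm h * ?c) * (ennreal (norm (G y)) * indicator (ball z e) y)"
      using c by (auto simp: abs_mult ennreal_mult[symmetric] ennreal_indicator[symmetric] simp del: ennreal_indicator intro!: ennreal_leI)
  qed
  also have "\<dots> = ennreal (norm h * ?c) * (\<integral>\<^sup>+y\<in>ball z e. ennreal (norm (G y)) \<partial>lborel)"
    by (rule nn_integral_cmult) measurable
  also have "\<dots> \<le> ennreal (norm h * ?c) * (ennreal (e ^ DIM('a)) * hl_maximal (\<lambda>y. ennreal (norm (G y))) z)"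
    using e by (intro mult_left_mono nn_integral_ball_le_hl_maximal) auto
  also have "\<dots> = ennreal (norm h) * upper_gradient z"
  proof -
    have "norm h * ?c * e ^ DIM('a) = norm h * (1 / bump_mass TYPE('a))"
      using e by simp
    then show ?thesis
      using e bump_mass_pos[where 'a = 'a] unfolding upper_gradient_def
      by (simp only: mult.assoc[symmetric] ennreal_mult'[symmetric] ennreal_mult''[symmetric] norm_ge_zero zero_le_power less_imp_le)
  qed
  finally show ?thesis .
qed

text \<open>The fundamental theorem of calculus is applied to the kernel along the segment for each
  fixed \<open>y\<close>, and Fubini exchanges the integrals over \<open>y\<close> and
  \<open>t\<close>; differentiation under the integral sign is thereby avoided.\<close>

lemma mollify_diff_bound:
  assumes e: "e > 0"
  shows "ennreal \<bar>mollify e u (x + h) - mollify e u x\<bar>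
    \<le> ennreal (norm h) * (\<integral>\<^sup>+t\<in>{0..1}. upper_gradient (x + t *\<^sub>R h) \<partial>lborel)"
proof -
  let ?D = "\<lambda>z. frechet_derivative (mollifier e) (at z) h"
  let ?c = "1 / (bump_mass TYPE('a) * e ^ DIM('a))"
  have [measurable]: "?D \<in> borel_measurable borel"
    by (rule borel_measurable_continuous_onI[OF frechet_derivative_mollifier_continuous[OF e]])
  obtain B where B: "B \<ge> 0" "\<And>z. \<bar>?D z\<bar> \<le> B * indicator (cball 0 e) z"
    using frechet_derivative_mollifier_bound[OF e, of h] by blast
  define f where "f = (\<lambda>(t, y). indicator {0..1} t * (u y * ?D (x + t *\<^sub>R h - y)))"
  have [measurable]: "f \<in> borel_measurable (lborel \<Otimes>\<^sub>M lborel)"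
    unfolding f_def by measurable
  have int: "integrable lborel (\<lambda>y. u y * mollifier e (z - y))" for z
    using mollifier_bounded[OF e, where 'a = 'a] mollifier_eq_0[OF e, where 'a = 'a]
    by (intro integrable_times_compactly_supported(1)[where B = ?c and x = z and R = e])
       (auto simp: indicator_def dist_norm)
  have diff: "mollifier e (x + h - y) - mollifier e (x - y) = (LINT t|lborel. indicator {0..1} t *\<^sub>R ?D (x + t *\<^sub>R h - y))" for y
  proof -
    have deriv: "((\<lambda>t. mollifier e (x + t *\<^sub>R h - y)) has_vector_derivative ?D (x + t *\<^sub>R h - y)) (at t within {0..1})" for t
    proof -
      have lin: "linear (frechet_derivative (mollifier e) (at (x + t *\<^sub>R h - y)))"
        using mollifier_has_derivative[OF e] by (rule has_derivative_linear)
      have "((\<lambda>t. mollifier e (x + t *\<^sub>R h - y)) has_derivative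
          (\<lambda>s. frechet_derivative (mollifier e) (at (x + t *\<^sub>R h - y)) (s *\<^sub>R h))) (at t within {0..1})"
        by (rule has_derivative_compose[OF _ mollifier_has_derivative[OF e]])
           (auto intro!: derivative_eq_intros)
      then show ?thesis
        by (simp add: has_vector_derivative_def linear_scale[OF lin])
    qed
    have "continuous_on {0..1} (\<lambda>t. ?D (x + t *\<^sub>R h - y))"
      by (rule continuous_on_compose2[OF frechet_derivative_mollifier_continuous[OF e]])
         (auto intro!: continuous_intros)
    from integral_FTC_Icc[OF _ deriv this] show ?thesis by simp
  qed
  have int_f: "integrable (lborel \<Otimes>\<^sub>M lborel) f"
  proof (rule integrableI_bounded)
    \<comment> \<open>This ball contains every \<open>y\<close> within distance \<open>e\<close> of
      some point of the segment from \<open>x\<close> to \<open>x + h\<close>, so local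
      integrability of \<open>u\<close> makes the joint integrand integrable.\<close>
    let ?K = "cball x (e + norm h)"
    have bound: "ennreal (norm (f (t, y))) \<le> indicator {0..1} t * (ennreal B * ennreal (norm (indicator ?K y *\<^sub>R u y)))" for t y
    proof -
      have "\<bar>?D (x + t *\<^sub>R h - y)\<bar> \<le> B * indicator ?K y" if t: "0 \<le> t" "t \<le> 1"
      proof (rule order_trans[OF B(2)], intro mult_left_mono B(1))
        have "norm (x - y) \<le> norm (x + t *\<^sub>R h - y) + norm (t *\<^sub>R h)"
          using norm_triangle_ineq4[of "x + t *\<^sub>R h - y" "t *\<^sub>R h"] by simp
        also have "norm (t *\<^sub>R h) \<le> norm h"
          using t by (simp add: mult_left_le_one_le)
        finally show "indicator (cball 0 e) (x + t *\<^sub>R h - y) \<le> (indicator ?K y :: real)"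
          by (auto simp: dist_norm norm_minus_commute[of y "x + t *\<^sub>R h"] split: split_indicator)
      qed
      from mult_left_mono[OF this abs_ge_zero[of "u y"]] show ?thesis
        using B(1) by (auto simp: f_def abs_mult ennreal_mult[symmetric] mult_ac intro!: ennreal_leI split: split_indicator)
    qed
    have "(\<integral>\<^sup>+q. ennreal (norm (f q)) \<partial>(lborel \<Otimes>\<^sub>M lborel)) = (\<integral>\<^sup>+t. \<integral>\<^sup>+y. ennreal (norm (f (t, y))) \<partial>lborel \<partial>lborel)"
      by (rule lborel.nn_integral_fst[symmetric]) measurable
    also have "\<dots> \<le> (\<integral>\<^sup>+t. \<integral>\<^sup>+y. indicator {0..1::real} t * (ennreal B * ennreal (norm (indicator ?K y *\<^sub>R u y))) \<partial>lborel \<partial>lborel)"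
      by (intro nn_integral_mono bound)
    also have "\<dots> = (\<integral>\<^sup>+t. indicator {0..1::real} t * (ennreal B * (\<integral>\<^sup>+y. ennreal (norm (indicator ?K y *\<^sub>R u y)) \<partial>lborel)) \<partial>lborel)"
    proof -
      have [measurable]: "?K \<in> sets borel" by simp
      show ?thesis
        by (intro nn_integral_cong, subst nn_integral_cmult, measurable, subst nn_integral_cmult, measurable)
    qed
    also have "\<dots> = ennreal B * (\<integral>\<^sup>+y. ennreal (norm (indicator ?K y *\<^sub>R u y)) \<partial>lborel)"
      by (subst nn_integral_multc) (auto simp: one_ennreal_def[symmetric])
    also have "\<dots> < \<infinity>"
      using u_integrable[of ?K] by (simp add: set_integrable_def integrable_iff_bounded ennreal_mult_less_top)
    finally show "(\<integral>\<^sup>+q. ennreal (norm (f q)) \<partial>(lborel \<Otimes>\<^sub>M lborel)) < \<infinity>" .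
  qed measurable
  have "mollify e u (x + h) - mollify e u x = (LINT y|lborel. u y * mollifier e (x + h - y) - u y * mollifier e (x - y))"
    unfolding mollify_def by (rule Bochner_Integration.integral_diff[OF int int, symmetric])
  also have "\<dots> = (LINT y|lborel. LINT t|lborel. f (t, y))"
  proof (rule Bochner_Integration.integral_cong[OF refl])
    fix y
    have "u y * mollifier e (x + h - y) - u y * mollifier e (x - y)
        = u y * (LINT t|lborel. indicator {0..1} t *\<^sub>R ?D (x + t *\<^sub>R h - y))"
      by (simp add: right_diff_distrib[symmetric] diff)
    also have "\<dots> = (LINT t|lborel. u y * (indicator {0..1} t *\<^sub>R ?D (x + t *\<^sub>R h - y)))"
      by (rule integral_mult_right_zero[symmetric])
    finally show "u y * mollifier e (x + h - y) - u y * mollifier e (x - y) = (LINT t|lborel. f (t, y))"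
      by (simp add: f_def mult_ac)
  qed
  also have "\<dots> = (LINT t|lborel. LINT y|lborel. f (t, y))"
    by (rule lborel_pair.Fubini_integral) (use int_f in \<open>simp add: case_prod_beta'\<close>)
  finally have eq: "mollify e u (x + h) - mollify e u x = (LINT t|lborel. LINT y|lborel. f (t, y))" .
  have "integrable lborel (\<lambda>t. LINT y|lborel. f (t, y))"
    by (rule lborel_pair.integrable_fst') (rule int_f)
  then have "ennreal \<bar>mollify e u (x + h) - mollify e u x\<bar> \<le> (\<integral>\<^sup>+t. ennreal (norm (LINT y|lborel. f (t, y))) \<partial>lborel)"
    unfolding eq real_norm_def[symmetric] by (rule integral_norm_bound_ennreal)
  also have "\<dots> \<le> (\<integral>\<^sup>+t. ennreal (norm h) * (upper_gradient (x + t *\<^sub>R h) * indicator {0..1} t) \<partial>lborel)"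
  proof (rule nn_integral_mono)
    fix t :: real
    show "ennreal (norm (LINT y|lborel. f (t, y))) \<le> ennreal (norm h) * (upper_gradient (x + t *\<^sub>R h) * indicator {0..1} t)"
      using mollified_derivative_bound[OF e, of "x + t *\<^sub>R h" h]
      by (cases "t \<in> {0..1}") (auto simp: f_def)
  qed
  also have "\<dots> = ennreal (norm h) * (\<integral>\<^sup>+t\<in>{0..1}. upper_gradient (x + t *\<^sub>R h) \<partial>lborel)"
    by (rule nn_integral_cmult) measurable
  finally show ?thesis .
qed

text \<open>\<open>u\<close> is only locally integrable, so it is cut off outside the ball of radius
  \<open>N + 1\<close>. For \<open>|x| < N\<close> the mollification does not see the cut, as its
  radius is below 1.\<close>

lemma mollify_local_AE_subseq:
  "\<exists>r. strict_mono r \<and> (AE x in lborel. norm x < real N \<longrightarrow> (\<lambda>k. mollify (1 / (real (r k) + 2)) u x) \<longlonglongrightarrow> u x)"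
proof -
  let ?f = "\<lambda>y. indicator (cball 0 (real N + 1)) y *\<^sub>R u y"
  have "integrable lborel ?f"
    using u_integrable[of "cball 0 (real N + 1)"] by (simp add: set_integrable_def)
  then obtain r where r: "strict_mono r" "AE x in lborel. (\<lambda>k. mollify (1 / (real (r k) + 2)) ?f x) \<longlonglongrightarrow> ?f x"
    using mollify_AE_subseq by blast
  have eq: "mollify (1 / (real k + 2)) ?f x = mollify (1 / (real k + 2)) u x" if "norm x < real N" for x k
    unfolding mollify_def
  proof (rule Bochner_Integration.integral_cong[OF refl])
    fix y
    show "?f y * mollifier (1 / (real k + 2)) (x - y) = u y * mollifier (1 / (real k + 2)) (x - y)"
    proof (cases "norm y \<le> real N + 1")
      case False
      then have "1 / (real k + 2) \<le> norm (x - y)"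
        using that norm_triangle_ineq2[of y x] by (simp add: norm_minus_commute field_simps) (smt (verit) mult_nonneg_nonneg of_nat_0_le_iff)
      then show ?thesis by (simp add: mollifier_eq_0)
    qed simp
  qed
  have "AE x in lborel. norm x < real N \<longrightarrow> (\<lambda>k. mollify (1 / (real (r k) + 2)) u x) \<longlonglongrightarrow> u x"
    using r(2) by eventually_elim (auto simp: eq[simplified])
  with r(1) show ?thesis by blast
qed

text \<open>The subsequence depends on the cut-off \<open>N\<close>. Two points of \<open>E\<close>
  are compared along the subsequence of one \<open>N\<close> exceeding both norms, and the
  right-hand side is the same for every mollification radius, so it survives the limit.\<close>

lemma upper_gradient_inequality:
  "\<exists>E. (AE x in lborel. x \<in> E) \<and> (\<forall>x\<in>E. \<forall>y\<in>E. ennreal \<bar>u y - u x\<bar>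
    \<le> ennreal (norm (y - x)) * (\<integral>\<^sup>+t\<in>{0..1}. upper_gradient (x + t *\<^sub>R (y - x)) \<partial>lborel))"
proof -
  have "\<exists>r. \<forall>N. AE x in lborel. norm x < real N \<longrightarrow> (\<lambda>k. mollify (1 / (real (r N k) + 2)) u x) \<longlonglongrightarrow> u x"
    using mollify_local_AE_subseq by meson
  then obtain r where r: "\<And>N. AE x in lborel. norm x < real N \<longrightarrow> (\<lambda>k. mollify (1 / (real (r N k) + 2)) u x) \<longlonglongrightarrow> u x"
    by blast
  define E where "E = {x. \<forall>N. norm x < real N \<longrightarrow> (\<lambda>k. mollify (1 / (real (r N k) + 2)) u x) \<longlonglongrightarrow> u x}"
  have "AE x in lborel. x \<in> E"
    unfolding E_def mem_Collect_eq AE_all_countable using r by blast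
  moreover have "ennreal \<bar>u y - u x\<bar>
      \<le> ennreal (norm (y - x)) * (\<integral>\<^sup>+t\<in>{0..1}. upper_gradient (x + t *\<^sub>R (y - x)) \<partial>lborel)"
    if "x \<in> E" "y \<in> E" for x y
  proof -
    obtain N where N: "max (norm x) (norm y) < real N"
      using reals_Archimedean2 by blast
    have "(\<lambda>k. mollify (1 / (real (r N k) + 2)) u y - mollify (1 / (real (r N k) + 2)) u x) \<longlonglongrightarrow> u y - u x"
      using that N by (intro tendsto_diff) (auto simp: E_def)
    then have "(\<lambda>k. ennreal \<bar>mollify (1 / (real (r N k) + 2)) u y - mollify (1 / (real (r N k) + 2)) u x\<bar>) \<longlonglongrightarrow> ennreal \<bar>u y - u x\<bar>"
      by (intro tendsto_ennrealI tendsto_rabs)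
    then show ?thesis
      by (rule LIMSEQ_le_const2) (use mollify_diff_bound[of "1 / (real (r N _) + 2)" x "y - x"] in auto)
  qed
  ultimately show ?thesis by blast
qed

end

section \<open>Poincare and Hardy inequalities\<close>

lemma ennpowr_eq_0_iff: "ennpowr x a = 0 \<longleftrightarrow> x = 0"
  by (cases x) (auto simp: ennpowr_ennreal ennreal_eq_0_iff)

text \<open>If \<open>a > c\<close>, then \<open>a = a powr (1 - p) * a powr p\<close>, and since
  \<open>1 - p \<le> 0\<close> the first factor is at most \<open>c powr (1 - p)\<close>.\<close>

lemma young_split:
  assumes "c > 0" "p \<ge> 1"
  shows "a \<le> ennreal c + ennreal (c powr (1 - p)) * ennpowr a p"
proof (cases a)
  case (real b)
  have "b \<le> c + c powr (1 - p) * b powr p"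
  proof (cases "b \<le> c")
    case False
    then have "b = b powr (1 - p) * b powr p"
      using assms by (simp add: powr_add[symmetric])
    also have "\<dots> \<le> c powr (1 - p) * b powr p"
      using False assms by (intro mult_right_mono powr_mono2') auto
    finally show ?thesis using assms by linarith
  qed (simp add: add_increasing2)
  then have "ennreal b \<le> ennreal (c + c powr (1 - p) * b powr p)" by (rule ennreal_leI)
  also have "\<dots> = ennreal c + ennreal (c powr (1 - p)) * ennpowr a p"
    using assms real by (simp add: ennpowr_ennreal ennreal_mult)
  finally show ?thesis using real by simp
next
  case top
  then show ?thesis using assms by (simp add: ennreal_mult_top)
qed

text \<open>Hoelder's inequality up to a constant: integrate Young's inequality and optimise the scale.\<close>

lemma nn_integral_weighted_power_bound:
  assumes [measurable]: "f \<in> borel_measurable M" "\<tau> \<in> borel_measurable M" and p: "p \<ge> 1"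
    and pos: "\<And>t. t \<in> space M \<Longrightarrow> f t \<noteq> 0 \<Longrightarrow> \<tau> t > 0"
    and T: "(\<integral>\<^sup>+t. ennreal (\<tau> t) \<partial>M) \<le> ennreal T" "T \<ge> 0"
  shows "ennpowr (\<integral>\<^sup>+t. f t \<partial>M) p
    \<le> ennreal ((T + 1) powr p) * (\<integral>\<^sup>+t. ennpowr (f t) p * ennreal (\<tau> t powr (1 - p)) \<partial>M)"
proof (cases "\<integral>\<^sup>+t. ennpowr (f t) p * ennreal (\<tau> t powr (1 - p)) \<partial>M")
  case top
  then show ?thesis using T by (simp add: ennreal_mult_top)
next
  case (real j)
  show ?thesis
  proof (cases "j = 0")
    case True
    then have "AE t in M. ennpowr (f t) p * ennreal (\<tau> t powr (1 - p)) = 0"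
      using real by (subst nn_integral_0_iff_AE[symmetric]) auto
    moreover have "AE t in M. t \<in> space M" by (rule AE_space)
    ultimately have "AE t in M. f t = 0"
    proof eventually_elim
      case (elim t)
      then show ?case using pos[of t] by (force simp: ennpowr_eq_0_iff ennreal_eq_0_iff)
    qed
    then have "(\<integral>\<^sup>+t. f t \<partial>M) = 0" by (subst nn_integral_0_iff_AE) auto
    then show ?thesis by simp
  next
    case False
    define c where "c = j powr (1 / p)"
    have c: "c > 0" using False by (simp add: c_def)
    have cp: "c powr p = j" using p real(1) by (simp add: c_def powr_powr)
    have "(\<integral>\<^sup>+t. f t \<partial>M) \<le> (\<integral>\<^sup>+t. ennreal c * ennreal (\<tau> t) + ennreal (c powr (1 - p)) * (ennpowr (f t) p * ennreal (\<tau> t powr (1 - p))) \<partial>M)"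
    proof (rule nn_integral_mono)
      fix t assume t: "t \<in> space M"
      show "f t \<le> ennreal c * ennreal (\<tau> t) + ennreal (c powr (1 - p)) * (ennpowr (f t) p * ennreal (\<tau> t powr (1 - p)))"
      proof (cases "f t = 0")
        case False
        then have \<tau>: "\<tau> t > 0" using pos t by auto
        have "f t \<le> ennreal (c * \<tau> t) + ennreal ((c * \<tau> t) powr (1 - p)) * ennpowr (f t) p"
          using c \<tau> p by (intro young_split) auto
        also have "\<dots> = ennreal c * ennreal (\<tau> t) + ennreal (c powr (1 - p)) * (ennpowr (f t) p * ennreal (\<tau> t powr (1 - p)))"
          using c \<tau> by (simp add: powr_mult ennreal_mult mult_ac)
        finally show ?thesis .
      qed simp
    qed
    also have "\<dots> = ennreal c * (\<integral>\<^sup>+t. ennreal (\<tau> t) \<partial>M) + ennreal (c powr (1 - p)) * (\<integral>\<^sup>+t. ennpowr (f t) p * ennreal (\<tau> t powr (1 - p)) \<partial>M)"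
      by (subst nn_integral_add, measurable, subst nn_integral_cmult, measurable, subst nn_integral_cmult, measurable)
    also have "\<dots> \<le> ennreal c * ennreal T + ennreal (c powr (1 - p)) * ennreal j"
      using T real by (intro add_mono mult_left_mono) auto
    also have "\<dots> = ennreal (c * (T + 1))"
    proof -
      have "c powr (1 - p) * j = c" using c unfolding cp[symmetric] by (simp add: powr_add[symmetric])
      then show ?thesis
        using c T real(1) by (simp add: ennreal_mult[symmetric] ennreal_plus[symmetric] distrib_left del: ennreal_plus)
    qed
    finally have "ennpowr (\<integral>\<^sup>+t. f t \<partial>M) p \<le> ennpowr (ennreal (c * (T + 1))) p"
      using p by (intro ennpowr_mono) auto
    also have "\<dots> = ennreal ((c * (T + 1)) powr p)"
      using c T by (intro ennpowr_ennreal) auto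
    also have "\<dots> = ennreal ((T + 1) powr p) * ennreal j"
      using c T cp real(1) by (simp add: powr_mult ennreal_mult mult_ac)
    finally show ?thesis using real by simp
  qed
qed

section \<open>Integration along rays from the origin\<close>

lemma nn_integral_powr_atLeast_1:
  assumes "a < -1"
  shows "(\<integral>\<^sup>+t\<in>{1..}. ennreal (t powr a) \<partial>lborel) = ennreal (- 1 / (a + 1))"
proof -
  have "((\<lambda>t. t powr a) has_integral (- (1 powr (a + 1)) / (a + 1))) {1..}"
    using assms by (intro has_integral_powr_to_inf) auto
  then have "((\<lambda>t. t powr a * indicator {1..} t) has_integral (- 1 / (a + 1))) UNIV"
    by (subst (asm) has_integral_restrict_UNIV[symmetric])
       (simp add: indicator_def of_bool_def if_distrib cong: if_cong)
  then have "(\<integral>\<^sup>+t. ennreal (t powr a * indicator {1..} t) \<partial>lborel) = ennreal (- 1 / (a + 1))"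
    by (intro nn_integral_has_integral_lborel) auto
  then show ?thesis
    by (simp add: ennreal_mult'' ennreal_indicator)
qed

text \<open>\<sigma> is the midpoint of 1 and \<open>(n - 1) / (p - 1)\<close>, an interval that is
  nonempty because \<open>p < n\<close>. Above 1 the weight \<open>t powr (- \<sigma>)\<close> is
  integrable at infinity, and below the upper end so is
  \<open>t powr (\<sigma> * (p - 1) - n)\<close>; the two factors of the constant come from these
  two integrals.\<close>

definition radial_const :: "nat \<Rightarrow> real \<Rightarrow> real" where
  "radial_const n p = (let \<sigma> = (1 + (real n - 1) / (p - 1)) / 2 in
     (1 / (\<sigma> - 1) + 1) powr p * (1 / (real n - 1 - \<sigma> * (p - 1))))"

text \<open>Hoelder's inequality in \<open>t\<close> with weight \<open>t powr (- \<sigma>)\<close>,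
  then Fubini: the dilation by \<open>t\<close> contributes \<open>t powr (- n)\<close>, and the
  remaining integral over \<open>t\<close> converges by the choice of \<sigma>.\<close>

lemma nn_integral_ray_average:
  fixes w :: "'a::euclidean_space \<Rightarrow> ennreal"
  assumes [measurable]: "w \<in> borel_measurable borel" and p: "1 < p" "p < real DIM('a)"
  shows "(\<integral>\<^sup>+x. ennpowr (\<integral>\<^sup>+t\<in>{1..}. w (t *\<^sub>R x) \<partial>lborel) p \<partial>lborel)
    \<le> ennreal (radial_const DIM('a) p) * (\<integral>\<^sup>+x. ennpowr (w x) p \<partial>lborel)"
proof -
  let ?n = "real DIM('a)"
  define \<sigma> where "\<sigma> = (1 + (?n - 1) / (p - 1)) / 2"
  have "(?n - 1) / (p - 1) > 1" using p by (simp add: field_simps)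
  then have \<sigma>: "\<sigma> > 1" by (simp add: \<sigma>_def)
  have \<sigma>p: "\<sigma> * (p - 1) = ((p - 1) + (?n - 1)) / 2"
    using p by (simp add: \<sigma>_def field_simps)
  define T where "T = 1 / (\<sigma> - 1)"
  have T: "T \<ge> 0" using \<sigma> by (simp add: T_def)
  have "ennpowr (\<integral>\<^sup>+t\<in>{1..}. w (t *\<^sub>R x) \<partial>lborel) p
      \<le> ennreal ((T + 1) powr p) * (\<integral>\<^sup>+t\<in>{1..}. ennpowr (w (t *\<^sub>R x)) p * ennreal (t powr (\<sigma> * (p - 1))) \<partial>lborel)" for x
  proof -
    let ?\<tau> = "\<lambda>t::real. t powr (- \<sigma>) * indicator {1..} t"
    have "(\<integral>\<^sup>+t. ennreal (?\<tau> t) \<partial>lborel) = (\<integral>\<^sup>+t\<in>{1..}. ennreal (t powr (- \<sigma>)) \<partial>lborel)"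
      by (intro nn_integral_cong) (auto split: split_indicator)
    also have "\<dots> = ennreal T"
    proof -
      have "- 1 / (- \<sigma> + 1) = T" using \<sigma> by (simp add: T_def divide_simps)
      then show ?thesis using \<sigma> nn_integral_powr_atLeast_1[of "- \<sigma>"] by simp
    qed
    finally have \<tau>T: "(\<integral>\<^sup>+t. ennreal (?\<tau> t) \<partial>lborel) \<le> ennreal T" by simp
    have "ennpowr (\<integral>\<^sup>+t\<in>{1..}. w (t *\<^sub>R x) \<partial>lborel) p
        \<le> ennreal ((T + 1) powr p) * (\<integral>\<^sup>+t. ennpowr (w (t *\<^sub>R x) * indicator {1..} t) p * ennreal (?\<tau> t powr (1 - p)) \<partial>lborel)"
    proof (rule nn_integral_weighted_power_bound[OF _ _ _ _ \<tau>T T])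
      show "0 < ?\<tau> t" if "w (t *\<^sub>R x) * indicator {1..} t \<noteq> 0" for t
        using that by (auto split: split_indicator_asm)
    qed (use p in auto)
    also have "(\<integral>\<^sup>+t. ennpowr (w (t *\<^sub>R x) * indicator {1..} t) p * ennreal (?\<tau> t powr (1 - p)) \<partial>lborel)
        = (\<integral>\<^sup>+t\<in>{1..}. ennpowr (w (t *\<^sub>R x)) p * ennreal (t powr (\<sigma> * (p - 1))) \<partial>lborel)"
    proof (rule nn_integral_cong)
      fix t :: real
      have "(- \<sigma>) * (1 - p) = \<sigma> * (p - 1)" by (simp add: algebra_simps)
      then show "ennpowr (w (t *\<^sub>R x) * indicator {1..} t) p * ennreal (?\<tau> t powr (1 - p))
          = ennpowr (w (t *\<^sub>R x)) p * ennreal (t powr (\<sigma> * (p - 1))) * indicator {1..} t"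
        by (auto simp: powr_powr split: split_indicator)
    qed
    finally show ?thesis .
  qed
  then have "(\<integral>\<^sup>+x. ennpowr (\<integral>\<^sup>+t\<in>{1..}. w (t *\<^sub>R x) \<partial>lborel) p \<partial>lborel)
      \<le> (\<integral>\<^sup>+x. ennreal ((T + 1) powr p) * (\<integral>\<^sup>+t\<in>{1..}. ennpowr (w (t *\<^sub>R x)) p * ennreal (t powr (\<sigma> * (p - 1))) \<partial>lborel) \<partial>lborel)"
    by (rule nn_integral_mono)
  also have "\<dots> = ennreal ((T + 1) powr p) * (\<integral>\<^sup>+x. \<integral>\<^sup>+t. ennpowr (w (t *\<^sub>R x)) p * ennreal (t powr (\<sigma> * (p - 1))) * indicator {1..} t \<partial>lborel \<partial>lborel)"
    by (rule nn_integral_cmult) measurable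
  also have "(\<integral>\<^sup>+x. \<integral>\<^sup>+t. ennpowr (w (t *\<^sub>R x)) p * ennreal (t powr (\<sigma> * (p - 1))) * indicator {1..} t \<partial>lborel \<partial>lborel)
      = (\<integral>\<^sup>+t. \<integral>\<^sup>+x. ennpowr (w (t *\<^sub>R x)) p * ennreal (t powr (\<sigma> * (p - 1))) * indicator {1..} t \<partial>lborel \<partial>lborel)"
    by (rule lborel_pair.Fubini') measurable
  also have "\<dots> = (\<integral>\<^sup>+t. (\<integral>\<^sup>+x. ennpowr (w x) p \<partial>lborel) * (ennreal (t powr (\<sigma> * (p - 1) - ?n)) * indicator {1..} t) \<partial>lborel)"
  proof (rule nn_integral_cong)
    fix t :: real
    show "(\<integral>\<^sup>+x. ennpowr (w (t *\<^sub>R x)) p * ennreal (t powr (\<sigma> * (p - 1))) * indicator {1..} t \<partial>lborel)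
        = (\<integral>\<^sup>+x. ennpowr (w x) p \<partial>lborel) * (ennreal (t powr (\<sigma> * (p - 1) - ?n)) * indicator {1..} t)"
    proof (cases "t \<ge> 1")
      case True
      have "(\<integral>\<^sup>+x. ennpowr (w (t *\<^sub>R x)) p * ennreal (t powr (\<sigma> * (p - 1))) * indicator {1..} t \<partial>lborel)
          = (\<integral>\<^sup>+x. ennpowr (w (0 + t *\<^sub>R x)) p \<partial>lborel) * ennreal (t powr (\<sigma> * (p - 1)))"
        using True by (subst nn_integral_multc[symmetric]) auto
      also have "\<dots> = ennreal (1 / \<bar>t\<bar> ^ DIM('a)) * (\<integral>\<^sup>+x. ennpowr (w x) p \<partial>lborel) * ennreal (t powr (\<sigma> * (p - 1)))"
        using True by (subst nn_integral_lborel_affine) auto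
      also have "\<dots> = (\<integral>\<^sup>+x. ennpowr (w x) p \<partial>lborel) * (ennreal (1 / \<bar>t\<bar> ^ DIM('a)) * ennreal (t powr (\<sigma> * (p - 1))))"
        by (simp only: mult_ac)
      also have "ennreal (1 / \<bar>t\<bar> ^ DIM('a)) * ennreal (t powr (\<sigma> * (p - 1))) = ennreal (t powr (\<sigma> * (p - 1) - ?n))"
        using True by (simp add: ennreal_mult[symmetric] powr_diff powr_realpow)
      finally show ?thesis using True by simp
    qed simp
  qed
  also have "\<dots> = (\<integral>\<^sup>+x. ennpowr (w x) p \<partial>lborel) * (\<integral>\<^sup>+t\<in>{1..}. ennreal (t powr (\<sigma> * (p - 1) - ?n)) \<partial>lborel)"
    by (rule nn_integral_cmult) measurable
  also have "(\<integral>\<^sup>+t\<in>{1..}. ennreal (t powr (\<sigma> * (p - 1) - ?n)) \<partial>lborel) = ennreal (1 / (?n - 1 - \<sigma> * (p - 1)))"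
  proof -
    have "- 1 / (\<sigma> * (p - 1) - ?n + 1) = 1 / (?n - 1 - \<sigma> * (p - 1))"
      by (metis diff_diff_add minus_diff_eq minus_divide_divide add.commute diff_add_eq)
    moreover have "\<sigma> * (p - 1) - ?n < - 1" using p by (simp add: \<sigma>p field_simps)
    ultimately show ?thesis using nn_integral_powr_atLeast_1 by metis
  qed
  also have "ennreal ((T + 1) powr p) * ((\<integral>\<^sup>+x. ennpowr (w x) p \<partial>lborel) * ennreal (1 / (?n - 1 - \<sigma> * (p - 1))))
      = ennreal (radial_const DIM('a) p) * (\<integral>\<^sup>+x. ennpowr (w x) p \<partial>lborel)"
  proof -
    have "radial_const DIM('a) p = (T + 1) powr p * (1 / (?n - 1 - \<sigma> * (p - 1)))"
      by (simp add: radial_const_def Let_def \<sigma>_def[symmetric] T_def)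
    then have "ennreal (radial_const DIM('a) p) = ennreal ((T + 1) powr p) * ennreal (1 / (?n - 1 - \<sigma> * (p - 1)))"
      by (simp only: ennreal_mult' powr_ge_zero)
    then show ?thesis by (simp only: mult_ac)
  qed
  finally show ?thesis .
qed

locale upper_gradient_pair =
  fixes u :: "'a::euclidean_space \<Rightarrow> real" and w :: "'a \<Rightarrow> ennreal" and E :: "'a set"
  assumes u_borel [measurable]: "u \<in> borel_measurable borel"
    and w_borel [measurable]: "w \<in> borel_measurable borel"
    and AE_E: "AE x in lborel. x \<in> E"
    and segment: "\<And>x y. x \<in> E \<Longrightarrow> y \<in> E \<Longrightarrow> ennreal \<bar>u y - u x\<bar>
       \<le> ennreal (norm (y - x)) * (\<integral>\<^sup>+t\<in>{0..1}. w (x + t *\<^sub>R (y - x)) \<partial>lborel)"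
begin

lemma segment_triangle:
  assumes "x \<in> E" "y \<in> E"
  shows "ennreal \<bar>u x\<bar> \<le> ennreal \<bar>u y\<bar> + ennreal (norm (y - x)) * (\<integral>\<^sup>+t\<in>{0..1}. w (x + t *\<^sub>R (y - x)) \<partial>lborel)"
proof -
  have "ennreal \<bar>u x\<bar> \<le> ennreal (\<bar>u y\<bar> + \<bar>u y - u x\<bar>)" by (intro ennreal_leI) linarith
  also have "\<dots> = ennreal \<bar>u y\<bar> + ennreal \<bar>u y - u x\<bar>" by simp
  also have "\<dots> \<le> ennreal \<bar>u y\<bar> + ennreal (norm (y - x)) * (\<integral>\<^sup>+t\<in>{0..1}. w (x + t *\<^sub>R (y - x)) \<partial>lborel)"
    by (intro add_left_mono segment assms)
  finally show ?thesis .
qed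

text \<open>The contraction towards \<open>x\<close> maps the ball onto one of radius
  \<open>t * R\<close>. Its Jacobian \<open>t^n\<close> cancels against the volume factor of the
  smaller ball, so the bound is uniform in \<open>t\<close>.\<close>

lemma nn_integral_ball_segment:
  assumes "R > 0" "0 < t" "t \<le> 1"
  shows "(\<integral>\<^sup>+y\<in>ball x R. w (x + t *\<^sub>R (y - x)) \<partial>lborel) \<le> ennreal (R ^ DIM('a)) * hl_maximal w x"
proof -
  let ?F = "\<lambda>z. w z * indicator (ball x (t * R)) z"
  have "(\<integral>\<^sup>+y\<in>ball x R. w (x + t *\<^sub>R (y - x)) \<partial>lborel) = (\<integral>\<^sup>+y. ?F ((x - t *\<^sub>R x) + t *\<^sub>R y) \<partial>lborel)"
  proof (rule nn_integral_cong)
    fix y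
    have eq: "x - t *\<^sub>R x + t *\<^sub>R y = x + t *\<^sub>R (y - x)" by (simp add: algebra_simps)
    have "dist x (x + t *\<^sub>R (y - x)) = t * dist x y"
      using \<open>0 < t\<close> by (simp add: dist_norm norm_minus_commute)
    then have "x + t *\<^sub>R (y - x) \<in> ball x (t * R) \<longleftrightarrow> y \<in> ball x R"
      using \<open>0 < t\<close> by (simp add: mult_less_cancel_left)
    then show "w (x + t *\<^sub>R (y - x)) * indicator (ball x R) y = ?F ((x - t *\<^sub>R x) + t *\<^sub>R y)"
      unfolding eq by (simp add: indicator_def)
  qed
  also have "\<dots> = ennreal (1 / \<bar>t\<bar> ^ DIM('a)) * (\<integral>\<^sup>+z. ?F z \<partial>lborel)"
  proof -
    have "?F \<in> borel_measurable borel" by measurable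
    then show ?thesis using \<open>0 < t\<close> by (intro nn_integral_lborel_affine) auto
  qed
  also have "\<dots> \<le> ennreal (1 / \<bar>t\<bar> ^ DIM('a)) * (ennreal ((t * R) ^ DIM('a)) * hl_maximal w x)"
    using assms by (intro mult_left_mono nn_integral_ball_le_hl_maximal) auto
  also have "\<dots> = ennreal (R ^ DIM('a)) * hl_maximal w x"
    using assms by (simp add: mult.assoc[symmetric] ennreal_mult[symmetric] power_mult_distrib)
  finally show ?thesis .
qed

text \<open>Integrate the segment inequality over the endpoint \<open>y\<close> in the ball and
  exchange the integrals over \<open>y\<close> and \<open>t\<close>; each \<open>t\<close>
  contributes at most the same multiple of the maximal function at \<open>x\<close>.\<close>

lemma poincare_pointwise:
  assumes x: "x \<in> E" and R: "R > 0"
  shows "ennreal (R ^ DIM('a) * measure lborel (ball (0::'a) 1) * \<bar>u x\<bar>)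
    \<le> (\<integral>\<^sup>+y\<in>ball x R. ennreal \<bar>u y\<bar> \<partial>lborel) + ennreal (R ^ DIM('a) * R) * hl_maximal w x"
proof -
  let ?S = "\<lambda>y. (\<integral>\<^sup>+t\<in>{0..1}. w (x + t *\<^sub>R (y - x)) \<partial>lborel)"
  have "(\<integral>\<^sup>+y. ?S y * indicator (ball x R) y \<partial>lborel)
      = (\<integral>\<^sup>+y. \<integral>\<^sup>+t. w (x + t *\<^sub>R (y - x)) * indicator {0..1} t * indicator (ball x R) y \<partial>lborel \<partial>lborel)"
    by (intro nn_integral_cong nn_integral_multc[symmetric]) measurable
  also have "\<dots> = (\<integral>\<^sup>+t. \<integral>\<^sup>+y. w (x + t *\<^sub>R (y - x)) * indicator {0..1} t * indicator (ball x R) y \<partial>lborel \<partial>lborel)"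
    by (rule lborel_pair.Fubini') measurable
  also have "\<dots> \<le> (\<integral>\<^sup>+t. (ennreal (R ^ DIM('a)) * hl_maximal w x) * indicator {0..1::real} t \<partial>lborel)"
  proof (rule nn_integral_mono_AE)
    show "AE t::real in lborel. (\<integral>\<^sup>+y. w (x + t *\<^sub>R (y - x)) * indicator {0..1} t * indicator (ball x R) y \<partial>lborel)
        \<le> (ennreal (R ^ DIM('a)) * hl_maximal w x) * indicator {0..1} t"
      \<comment> \<open>At \<open>t = 0\<close> the contraction collapses the ball to its centre;
        this single value is discarded.\<close>
      using AE_lborel_singleton[of "0::real"]
    proof eventually_elim
      case (elim t)
      then show ?case
        using nn_integral_ball_segment[OF R, of t x] by (cases "t \<in> {0..1}") auto
    qed
  qed
  also have "\<dots> = ennreal (R ^ DIM('a)) * hl_maximal w x"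
    by (subst nn_integral_cmult_indicator) auto
  finally have inner: "(\<integral>\<^sup>+y. ?S y * indicator (ball x R) y \<partial>lborel) \<le> ennreal (R ^ DIM('a)) * hl_maximal w x" .
  have "ennreal (R ^ DIM('a) * measure lborel (ball (0::'a) 1) * \<bar>u x\<bar>) = (\<integral>\<^sup>+y\<in>ball x R. ennreal \<bar>u x\<bar> \<partial>lborel)"
    using R by (subst nn_integral_cmult_indicator) (auto simp: emeasure_lborel_ball ennreal_mult mult_ac)
  also have "\<dots> \<le> (\<integral>\<^sup>+y. ennreal \<bar>u y\<bar> * indicator (ball x R) y + ennreal R * (?S y * indicator (ball x R) y) \<partial>lborel)"
  proof (rule nn_integral_mono_AE)
    show "AE y in lborel. ennreal \<bar>u x\<bar> * indicator (ball x R) y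
        \<le> ennreal \<bar>u y\<bar> * indicator (ball x R) y + ennreal R * (?S y * indicator (ball x R) y)"
      using AE_E
    proof eventually_elim
      case (elim y)
      show ?case
      proof (cases "y \<in> ball x R")
        case True
        have "ennreal \<bar>u x\<bar> \<le> ennreal \<bar>u y\<bar> + ennreal (norm (y - x)) * ?S y"
          by (rule segment_triangle[OF x elim])
        also have "\<dots> \<le> ennreal \<bar>u y\<bar> + ennreal R * ?S y"
          using True by (intro add_left_mono mult_right_mono ennreal_leI) (auto simp: dist_norm norm_minus_commute)
        finally show ?thesis using True by simp
      qed simp
    qed
  qed
  also have "\<dots> = (\<integral>\<^sup>+y\<in>ball x R. ennreal \<bar>u y\<bar> \<partial>lborel) + ennreal R * (\<integral>\<^sup>+y. ?S y * indicator (ball x R) y \<partial>lborel)"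
    by (subst nn_integral_add, measurable, subst nn_integral_cmult, measurable)
  also have "\<dots> \<le> (\<integral>\<^sup>+y\<in>ball x R. ennreal \<bar>u y\<bar> \<partial>lborel) + ennreal R * (ennreal (R ^ DIM('a)) * hl_maximal w x)"
    by (intro add_left_mono mult_left_mono inner) auto
  also have "ennreal R * (ennreal (R ^ DIM('a)) * hl_maximal w x) = ennreal (R ^ DIM('a) * R) * hl_maximal w x"
    using R by (simp add: ennreal_mult mult_ac)
  finally show ?thesis .
qed

text \<open>The substitution \<open>s = 1 + (l - 1) * t\<close> turns the segment integral into one
  over \<open>s\<close> from 1 to \<open>l\<close>. Extending it to infinity makes the gradient term
  independent of \<open>l\<close>, so that \<open>l\<close> can be sent to infinity.\<close>

lemma segment_on_ray:
  assumes "x \<in> E" "l *\<^sub>R x \<in> E" "l > 1"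
  shows "ennreal \<bar>u x\<bar> \<le> ennreal \<bar>u (l *\<^sub>R x)\<bar> + ennreal (norm x) * (\<integral>\<^sup>+t\<in>{1..}. w (t *\<^sub>R x) \<partial>lborel)"
proof -
  have diff: "l *\<^sub>R x - x = (l - 1) *\<^sub>R x" by (simp add: algebra_simps)
  let ?F = "\<lambda>s. w (s *\<^sub>R x) * indicator {1..l} s"
  have "(\<integral>\<^sup>+s. ?F s \<partial>lborel) = ennreal \<bar>l - 1\<bar> * (\<integral>\<^sup>+t. ?F (1 + (l - 1) * t) \<partial>lborel)"
  proof -
    have "?F \<in> borel_measurable borel" by measurable
    then show ?thesis using \<open>l > 1\<close> by (intro nn_integral_real_affine) auto
  qed
  also have "(\<integral>\<^sup>+t. ?F (1 + (l - 1) * t) \<partial>lborel) = (\<integral>\<^sup>+t\<in>{0..1}. w (x + t *\<^sub>R (l *\<^sub>R x - x)) \<partial>lborel)"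
  proof (rule nn_integral_cong)
    fix t :: real
    have "1 + (l - 1) * t \<in> {1..l} \<longleftrightarrow> t \<in> {0..1}"
    proof -
      have "1 + (l - 1) * t \<le> l \<longleftrightarrow> (l - 1) * t \<le> (l - 1) * 1" by auto
      also have "\<dots> \<longleftrightarrow> t \<le> 1" using \<open>l > 1\<close> by (intro mult_le_cancel_left_pos) simp
      finally show ?thesis using \<open>l > 1\<close> by (auto simp: zero_le_mult_iff)
    qed
    moreover have "(1 + (l - 1) * t) *\<^sub>R x = x + t *\<^sub>R (l *\<^sub>R x - x)"
      unfolding diff by (simp add: scaleR_add_left mult.commute)
    ultimately show "?F (1 + (l - 1) * t) = w (x + t *\<^sub>R (l *\<^sub>R x - x)) * indicator {0..1} t"
      by (simp add: indicator_def)
  qed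
  finally have "ennreal (norm (l *\<^sub>R x - x)) * (\<integral>\<^sup>+t\<in>{0..1}. w (x + t *\<^sub>R (l *\<^sub>R x - x)) \<partial>lborel)
      = ennreal (norm x) * (\<integral>\<^sup>+s. ?F s \<partial>lborel)"
    using \<open>l > 1\<close> unfolding diff by (simp add: ennreal_mult mult_ac)
  also have "\<dots> \<le> ennreal (norm x) * (\<integral>\<^sup>+t\<in>{1..}. w (t *\<^sub>R x) \<partial>lborel)"
    by (intro mult_left_mono nn_integral_mono) (auto split: split_indicator)
  finally show ?thesis
    using segment_triangle[OF assms(1,2)] by (meson add_left_mono order_trans)
qed

text \<open>Dilation by \<open>2^k\<close> divides the integral of \<open>|u|^q\<close> by
  \<open>2^(k n)\<close>. The series of these integrals is dominated by a geometric one, so for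
  almost every \<open>x\<close> the series of values converges and its terms vanish in the limit.
  This is how integrability of a power of \<open>u\<close> acts as decay at infinity.\<close>

lemma AE_dyadic_tendsto_0:
  assumes "q > 0" and fin: "(\<integral>\<^sup>+x. ennreal (\<bar>u x\<bar> powr q) \<partial>lborel) < \<infinity>"
  shows "AE x in lborel. (\<lambda>k. u (2 ^ k *\<^sub>R x)) \<longlonglongrightarrow> 0"
proof -
  let ?I = "\<integral>\<^sup>+x. ennreal (\<bar>u x\<bar> powr q) \<partial>lborel"
  obtain I where I: "?I = ennreal I" "I \<ge> 0" using fin by (cases ?I) auto
  have scale: "(\<integral>\<^sup>+x. ennreal (\<bar>u (2 ^ k *\<^sub>R x)\<bar> powr q) \<partial>lborel) \<le> ennreal ((1/2) ^ k * I)" for k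
  proof -
    have "(\<integral>\<^sup>+x. ennreal (\<bar>u (0 + 2 ^ k *\<^sub>R x)\<bar> powr q) \<partial>lborel) = ennreal (1 / \<bar>2 ^ k\<bar> ^ DIM('a)) * ?I"
    proof -
      have "(\<lambda>x. ennreal (\<bar>u x\<bar> powr q)) \<in> borel_measurable borel" by measurable
      then show ?thesis by (rule nn_integral_lborel_affine) simp
    qed
    also have "\<dots> = ennreal (1 / (2 ^ k) ^ DIM('a) * I)"
      using I by (simp add: ennreal_mult[symmetric])
    also have "\<dots> \<le> ennreal ((1/2) ^ k * I)"
    proof (intro ennreal_leI mult_right_mono I(2))
      have "(2::real) ^ k \<le> (2 ^ k) ^ DIM('a)" by (rule self_le_power) auto
      then show "1 / (2 ^ k) ^ DIM('a) \<le> (1/2 :: real) ^ k"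
        by (simp add: power_one_over frac_le)
    qed
    finally show ?thesis by simp
  qed
  have "(\<integral>\<^sup>+x. (\<Sum>k. ennreal (\<bar>u (2 ^ k *\<^sub>R x)\<bar> powr q)) \<partial>lborel) = (\<Sum>k. \<integral>\<^sup>+x. ennreal (\<bar>u (2 ^ k *\<^sub>R x)\<bar> powr q) \<partial>lborel)"
    by (rule nn_integral_suminf) measurable
  also have "\<dots> \<le> (\<Sum>k. ennreal ((1/2) ^ k * I))"
    by (intro suminf_le scale) auto
  also have "\<dots> < \<infinity>"
    using I(2) by (subst suminf_ennreal_eq) (auto intro!: summable_mult2 summable_geometric summable_sums)
  finally have "AE x in lborel. (\<Sum>k. ennreal (\<bar>u (2 ^ k *\<^sub>R x)\<bar> powr q)) \<noteq> \<infinity>"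
    by (intro nn_integral_PInf_AE) auto
  then show ?thesis
  proof eventually_elim
    case (elim x)
    then have "summable (\<lambda>k. \<bar>u (2 ^ k *\<^sub>R x)\<bar> powr q)"
      by (intro summable_suminf_not_top) auto
    then have "(\<lambda>k. \<bar>u (2 ^ k *\<^sub>R x)\<bar> powr q) \<longlonglongrightarrow> 0" by (rule summable_LIMSEQ_zero)
    then have "(\<lambda>k. (\<bar>u (2 ^ k *\<^sub>R x)\<bar> powr q) powr (1 / q)) \<longlonglongrightarrow> 0"
      using \<open>q > 0\<close> by (rule_tac tendsto_zero_powrI[where b = "1 / q"]) auto
    then show ?case
      using \<open>q > 0\<close> by (simp add: powr_powr tendsto_rabs_zero_iff)
  qed
qed

text \<open>Only the dyadic points of a ray are used: the countably many preimages of
  \<open>E\<close> under dilations by \<open>2^k\<close> still have a common part of full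
  measure.\<close>

lemma AE_ray_bound:
  assumes "q > 0" and "(\<integral>\<^sup>+x. ennreal (\<bar>u x\<bar> powr q) \<partial>lborel) < \<infinity>"
  shows "AE x in lborel. ennreal \<bar>u x\<bar> \<le> ennreal (norm x) * (\<integral>\<^sup>+t\<in>{1..}. w (t *\<^sub>R x) \<partial>lborel)"
proof -
  have "AE x in lborel. \<forall>k. 2 ^ k *\<^sub>R x \<in> E"
    unfolding AE_all_countable
  proof
    fix k :: nat
    have "AE x in lborel. 0 + 2 ^ k *\<^sub>R x \<in> E" by (rule AE_lborel_affine[OF AE_E]) simp
    then show "AE x in lborel. 2 ^ k *\<^sub>R x \<in> E" by simp
  qed
  with AE_dyadic_tendsto_0[OF assms] show ?thesis
  proof eventually_elim
    case (elim x)
    let ?W = "ennreal (norm x) * (\<integral>\<^sup>+t\<in>{1..}. w (t *\<^sub>R x) \<partial>lborel)"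
    have "(\<lambda>k. ennreal \<bar>u (2 ^ k *\<^sub>R x)\<bar> + ?W) \<longlonglongrightarrow> ennreal \<bar>0\<bar> + ?W"
      by (intro tendsto_add tendsto_const tendsto_ennrealI tendsto_rabs elim(1))
    then have "ennreal \<bar>u x\<bar> \<le> ennreal \<bar>0\<bar> + ?W"
    proof (rule LIMSEQ_le_const)
      have "x \<in> E" using elim(2)[rule_format, of 0] by simp
      then have "ennreal \<bar>u x\<bar> \<le> ennreal \<bar>u (2 ^ k *\<^sub>R x)\<bar> + ?W" if "k \<ge> 1" for k
        using elim(2) that by (intro segment_on_ray) (auto intro: one_less_power)
      then show "\<exists>N. \<forall>k\<ge>N. ennreal \<bar>u x\<bar> \<le> ennreal \<bar>u (2 ^ k *\<^sub>R x)\<bar> + ?W" by blast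
    qed
    then show ?case by simp
  qed
qed

lemma hardy_inequality:
  assumes p: "1 < p" "p < real DIM('a)"
    and q: "q > 0" "(\<integral>\<^sup>+x. ennreal (\<bar>u x\<bar> powr q) \<partial>lborel) < \<infinity>"
  shows "(\<integral>\<^sup>+x. ennreal ((\<bar>u x\<bar> / norm x) powr p) \<partial>lborel)
    \<le> ennreal (radial_const DIM('a) p) * (\<integral>\<^sup>+x. ennpowr (w x) p \<partial>lborel)"
proof -
  have "(\<integral>\<^sup>+x. ennreal ((\<bar>u x\<bar> / norm x) powr p) \<partial>lborel)
      \<le> (\<integral>\<^sup>+x. ennpowr (\<integral>\<^sup>+t\<in>{1..}. w (t *\<^sub>R x) \<partial>lborel) p \<partial>lborel)"
  proof (rule nn_integral_mono_AE)
    show "AE x in lborel. ennreal ((\<bar>u x\<bar> / norm x) powr p) \<le> ennpowr (\<integral>\<^sup>+t\<in>{1..}. w (t *\<^sub>R x) \<partial>lborel) p"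
      using AE_ray_bound[OF q]
    proof eventually_elim
      case (elim x)
      show ?case
      proof (cases "x = 0")
        case False
        then have "ennreal (\<bar>u x\<bar> / norm x) = ennreal (1 / norm x) * ennreal \<bar>u x\<bar>"
          by (simp add: ennreal_mult[symmetric])
        also have "\<dots> \<le> ennreal (1 / norm x) * (ennreal (norm x) * (\<integral>\<^sup>+t\<in>{1..}. w (t *\<^sub>R x) \<partial>lborel))"
          by (intro mult_left_mono elim) auto
        also have "\<dots> = (\<integral>\<^sup>+t\<in>{1..}. w (t *\<^sub>R x) \<partial>lborel)"
          using False by (simp add: mult.assoc[symmetric] ennreal_mult[symmetric])
        finally have "ennpowr (ennreal (\<bar>u x\<bar> / norm x)) p \<le> ennpowr (\<integral>\<^sup>+t\<in>{1..}. w (t *\<^sub>R x) \<partial>lborel) p"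
          using p by (intro ennpowr_mono) auto
        then show ?thesis by (simp add: ennpowr_ennreal)
      qed simp
    qed
  qed
  also have "\<dots> \<le> ennreal (radial_const DIM('a) p) * (\<integral>\<^sup>+x. ennpowr (w x) p \<partial>lborel)"
    by (rule nn_integral_ray_average[OF w_borel p])
  finally show ?thesis .
qed

end

section \<open>The endpoint inequality\<close>

text \<open>Hedberg's optimisation at a single point: \<open>a\<close> is \<open>|u(x)|\<close>,
  \<rho> is \<open>|x|\<close>, \<open>W\<close> is the value of the maximal function and
  \<open>M\<close> the Morrey norm. The radius is chosen so that the Morrey term is half of
  \<open>a\<close> and can be absorbed.\<close>

lemma pointwise_interpolation:
  fixes n p \<alpha> q r a \<rho> M W A C :: real
  assumes p: "1 < p" "p < n" and \<alpha>: "0 < \<alpha>" "\<alpha> < p"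
    and q: "q = p * (n - \<alpha>) / (n - p)" and r: "r = \<alpha> / q"
    and nonneg: "a \<ge> 0" "W \<ge> 0" "C > 0" and pos: "\<rho> > 0" "M > 0" "A > 0"
    and bound: "\<And>R. 0 < R \<Longrightarrow> R \<le> \<rho> \<Longrightarrow> a \<le> A * \<rho> powr r * R powr (- (n / q)) * M + C * R * W"
  shows "a powr q * \<rho> powr (- \<alpha>)
    \<le> (2 * A) powr (q - p) * (1 + (2 * C) powr p) * M powr (q - p) * ((a / \<rho>) powr p + W powr p)"
proof -
  define s where "s = (n - p) / p"
  have n: "n > 0" "n - p > 0" "n - \<alpha> > 0" using p \<alpha> by auto
  have q0: "q > 0" using p n by (simp add: q)
  have qp: "q - p = p * (p - \<alpha>) / (n - p)" using n by (simp add: q field_simps)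
  have "q - p > 0" unfolding qp using p \<alpha> n by simp
  have sqp: "s * (q - p) = p - \<alpha>" unfolding qp s_def using p n by simp
  have rs: "r + s = n / q"
    unfolding r s_def q using p \<alpha> n by (simp add: divide_simps) (simp add: algebra_simps)
  \<comment> \<open>This is the power of \<open>y\<close> left over in the second case; being
    nonpositive, it does harm only for \<open>y < 1\<close>.\<close>
  have exps: "q - p - p * q / n = - (p * \<alpha> / n)"
    unfolding q using n by (simp add: divide_simps) (simp add: algebra_simps)
  define B where "B = 2 * A * M"
  have B: "B > 0" using pos by (simp add: B_def)
  \<comment> \<open>A scale-free size of \<open>u(x)\<close>: at \<open>R = \<rho>\<close> the
    Morrey term equals \<open>A * M * \<rho> powr (- s)\<close>, and \<open>y\<close> compares
    \<open>a\<close> with twice that. Thus \<open>y \<le> 1\<close> says that the balancing radius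
    would not lie below \<rho>.\<close>
  define y where "y = a * \<rho> powr s / B"
  have y: "y \<ge> 0" using nonneg B by (simp add: y_def)
  have a_eq: "a = y * B * \<rho> powr (- s)"
    using B pos by (simp add: y_def powr_minus field_simps)
  have aqp: "a powr (q - p) * \<rho> powr (- \<alpha>) = y powr (q - p) * B powr (q - p) * \<rho> powr (- p)"
  proof -
    have "a powr (q - p) = y powr (q - p) * B powr (q - p) * \<rho> powr (- s * (q - p))"
      unfolding a_eq using y B by (simp add: powr_mult powr_powr)
    also have "- s * (q - p) = \<alpha> - p" using sqp by simp
    finally show ?thesis using pos by (simp add: mult.assoc powr_add[symmetric])
  qed
  have split: "a powr q * \<rho> powr (- \<alpha>) = a powr (q - p) * \<rho> powr (- \<alpha>) * a powr p"
  proof -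
    have "a powr q = a powr ((q - p) + p)" by simp
    also have "\<dots> = a powr (q - p) * a powr p" by (rule powr_add)
    finally show ?thesis by simp
  qed
  have B_eq: "B powr (q - p) = (2 * A) powr (q - p) * M powr (q - p)"
    unfolding B_def using pos by (simp add: powr_mult)
  show ?thesis
  proof (cases "y \<le> 1")
    case True
    \<comment> \<open>For small \<open>y\<close> the surplus power \<open>q - p\<close> of
      \<open>a\<close> is absorbed by \<open>M\<close>, and what remains is exactly the Hardy term
      \<open>(a / \<rho>) powr p\<close>.\<close>
    then have "y powr (q - p) \<le> 1" using y \<open>q - p > 0\<close> by (simp add: powr_le1)
    then have "a powr q * \<rho> powr (- \<alpha>) \<le> 1 * B powr (q - p) * \<rho> powr (- p) * a powr p"
      unfolding split aqp by (intro mult_right_mono) auto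
    also have "\<dots> = B powr (q - p) * 1 * ((a / \<rho>) powr p + 0)"
      using nonneg pos by (simp add: powr_divide powr_minus_divide)
    also have "\<dots> \<le> B powr (q - p) * (1 + (2 * C) powr p) * ((a / \<rho>) powr p + W powr p)"
      by (intro mult_mono add_mono) auto
    finally show ?thesis unfolding B_eq by (simp only: mult_ac)
  next
    case False
    \<comment> \<open>Solves \<open>A * \<rho> powr r * R powr (- (n / q)) * M = a / 2\<close>; as
      \<open>y > 1\<close>, the solution does not exceed \<rho>.\<close>
    define R where "R = \<rho> * y powr (- (q / n))"
    have R: "R > 0" using False pos by (simp add: R_def)
    have y_neg: "y powr (- c) \<le> 1" if "c \<ge> 0" for c
      using False that powr_mono[of "- c" 0 y] by simp
    then have "y powr (- (q / n)) \<le> 1" using q0 n by simp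
    then have "R \<le> \<rho>" using pos by (simp add: R_def mult_le_cancel_left1)
    have "R powr (- (n / q)) = \<rho> powr (- (n / q)) * y"
      unfolding R_def using pos False q0 n by (simp add: powr_mult powr_powr)
    then have "A * \<rho> powr r * R powr (- (n / q)) * M = A * M * y * (\<rho> powr r * \<rho> powr (- (n / q)))"
      by simp
    also have "\<rho> powr r * \<rho> powr (- (n / q)) = \<rho> powr (- s)"
    proof -
      have "r - n / q = - s" using rs by linarith
      then show ?thesis by (simp add: powr_add[symmetric])
    qed
    also have "A * M * y * \<rho> powr (- s) = a / 2"
      by (subst a_eq) (simp add: B_def)
    finally have "a \<le> 2 * C * R * W"
      using bound[OF R \<open>R \<le> \<rho>\<close>] by linarith
    then have "a powr p \<le> (2 * C * R * W) powr p"
      using nonneg p by (intro powr_mono2) auto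
    also have "\<dots> = (2 * C) powr p * R powr p * W powr p"
      using nonneg R by (simp add: powr_mult)
    finally have ap: "a powr p \<le> (2 * C) powr p * R powr p * W powr p" .
    have Rp: "R powr p = \<rho> powr p * y powr (- (p * q / n))"
      unfolding R_def using pos False by (simp add: powr_mult powr_powr mult.commute)
    have "a powr q * \<rho> powr (- \<alpha>) \<le> y powr (q - p) * B powr (q - p) * \<rho> powr (- p) * ((2 * C) powr p * R powr p * W powr p)"
      unfolding split aqp by (intro mult_left_mono ap) auto
    also have "\<dots> = B powr (q - p) * (2 * C) powr p * W powr p * (y powr (q - p) * y powr (- (p * q / n))) * (\<rho> powr (- p) * \<rho> powr p)"
      unfolding Rp by (simp only: mult_ac)
    also have "y powr (q - p) * y powr (- (p * q / n)) = y powr (- (p * \<alpha> / n))"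
      using exps by (simp add: powr_add[symmetric])
    also have "\<rho> powr (- p) * \<rho> powr p = 1"
      using pos by (simp add: powr_add[symmetric])
    also have "B powr (q - p) * (2 * C) powr p * W powr p * y powr (- (p * \<alpha> / n)) * 1
        \<le> B powr (q - p) * (2 * C) powr p * W powr p * 1 * 1"
      using p \<alpha> n by (intro mult_right_mono mult_left_mono y_neg) auto
    also have "\<dots> = B powr (q - p) * (0 + (2 * C) powr p) * (0 + W powr p)" by simp
    also have "\<dots> \<le> B powr (q - p) * (1 + (2 * C) powr p) * ((a / \<rho>) powr p + W powr p)"
      by (intro mult_mono add_mono) auto
    finally show ?thesis unfolding B_eq by (simp only: mult_ac)
  qed
qed

text \<open>The endpoint bound combined with \<open>\<mu> \<le> \<Omega> * l\<close> allows
  \<open>\<mu> powr (1 - e)\<close> to be divided out, leaving \<mu> at most a multiple of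
  \<open>D\<close>. The surplus \<theta> - \<open>e\<close> in the power of \<mu> is then exchanged
  for the same power of \<open>D\<close>.\<close>

lemma interpolation_exponent_improve:
  fixes l \<mu> D k \<Omega> e \<theta> :: real
  assumes pos: "l \<ge> 0" "\<mu> > 0" "D > 0" "k > 0" "\<Omega> > 0" and e: "0 < e" "e < \<theta>" "\<theta> < 1"
    and endpoint: "l \<le> k * \<mu> powr (1 - e) * D powr e" and le: "\<mu> \<le> \<Omega> * l"
  shows "l \<le> k * max 1 ((\<Omega> * k) powr (1 / e)) * D powr \<theta> * \<mu> powr (1 - \<theta>)"
proof -
  let ?Z = "(\<Omega> * k) powr (1 / e)"
  have "\<mu> \<le> \<Omega> * (k * \<mu> powr (1 - e) * D powr e)"
    using le endpoint pos by (meson mult_left_mono order_trans less_imp_le)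
  also have "\<dots> = (\<Omega> * k * D powr e) * \<mu> powr (1 - e)" by (simp only: mult_ac)
  finally have "\<mu> powr e * \<mu> powr (1 - e) \<le> (\<Omega> * k * D powr e) * \<mu> powr (1 - e)"
    using pos by (simp add: powr_add[symmetric])
  then have "\<mu> powr e \<le> \<Omega> * k * D powr e"
    using pos by (simp add: mult_le_cancel_right)
  then have "(\<mu> powr e) powr (1 / e) \<le> (\<Omega> * k * D powr e) powr (1 / e)"
    using e by (intro powr_mono2) auto
  then have \<mu>: "\<mu> \<le> ?Z * D"
    using pos e by (simp add: powr_powr powr_mult)
  have "\<mu> powr (\<theta> - e) \<le> (?Z * D) powr (\<theta> - e)"
    using \<mu> pos e by (intro powr_mono2) auto
  also have "\<dots> = ?Z powr (\<theta> - e) * D powr (\<theta> - e)"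
    using pos by (simp add: powr_mult)
  \<comment> \<open>The exponent \<open>\<theta> - e\<close> lies between 0 and 1, so the maximum
    with 1 bounds this power for all \<theta> at once.\<close>
  also have "\<dots> \<le> max 1 ?Z * D powr (\<theta> - e)"
  proof (intro mult_right_mono)
    have "?Z powr (\<theta> - e) \<le> max 1 ?Z powr (\<theta> - e)" using e by (intro powr_mono2) auto
    also have "\<dots> \<le> max 1 ?Z powr 1" using e by (intro powr_mono) auto
    finally show "?Z powr (\<theta> - e) \<le> max 1 ?Z" by simp
  qed simp
  finally have *: "\<mu> powr (\<theta> - e) \<le> max 1 ?Z * D powr (\<theta> - e)" .
  have "l \<le> k * \<mu> powr (1 - \<theta>) * D powr e * \<mu> powr (\<theta> - e)"
    using endpoint pos by (simp add: mult_ac powr_add[symmetric])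
  also have "\<dots> \<le> k * \<mu> powr (1 - \<theta>) * D powr e * (max 1 ?Z * D powr (\<theta> - e))"
    using pos by (intro mult_left_mono *) auto
  also have "\<dots> = k * max 1 ?Z * (D powr e * D powr (\<theta> - e)) * \<mu> powr (1 - \<theta>)"
    by (simp only: mult_ac)
  also have "D powr e * D powr (\<theta> - e) = D powr \<theta>"
    by (simp add: powr_add[symmetric])
  finally show ?thesis .
qed

section \<open>Morrey norms and averages over balls\<close>

lemma ennpowr_le_ennrealD:
  assumes "ennpowr x a \<le> ennreal b" "a > 0" "b \<ge> 0"
  shows "x \<le> ennreal (b powr (1 / a))"
proof (cases x)
  case (real c)
  then have "c powr a \<le> b" using assms by (simp add: ennpowr_ennreal)
  then have "(c powr a) powr (1 / a) \<le> b powr (1 / a)"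
    using assms by (intro powr_mono2) auto
  then show ?thesis using real assms by (simp add: powr_powr)
next
  case top
  then show ?thesis using assms by (simp add: top_unique)
qed

text \<open>Hoelder's inequality on a ball, from the weight \<open>R^(- n)\<close>, whose mass is
  the unit ball volume. The constant is kept as a \<open>p\<close>-th power so that its
  \<open>p\<close>-th root is the same for every exponent.\<close>

lemma nn_integral_ball_power_bound:
  fixes v :: "'a::euclidean_space \<Rightarrow> ennreal"
  assumes [measurable]: "v \<in> borel_measurable borel" and "p \<ge> 1" "R > 0"
  shows "ennpowr (\<integral>\<^sup>+y\<in>ball x R. v y \<partial>lborel) p
    \<le> ennreal ((measure lborel (ball (0::'a) 1) + 1) powr p * R powr (real DIM('a) * (p - 1)))
        * (\<integral>\<^sup>+y\<in>ball x R. ennpowr (v y) p \<partial>lborel)"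
proof -
  let ?n = "real DIM('a)" and ?w = "measure lborel (ball (0::'a) 1)"
  let ?\<tau> = "\<lambda>y. R powr (- ?n) * indicator (ball x R) y"
  have "(\<integral>\<^sup>+y. ennreal (?\<tau> y) \<partial>lborel) = (\<integral>\<^sup>+y. ennreal (R powr (- ?n)) * indicator (ball x R) y \<partial>lborel)"
    by (intro nn_integral_cong) (auto split: split_indicator)
  also have "\<dots> = ennreal (R powr (- ?n)) * emeasure lborel (ball x R)"
    by (rule nn_integral_cmult_indicator) simp
  also have "\<dots> = ennreal (R powr (- ?n) * (R ^ DIM('a) * ?w))"
    using \<open>R > 0\<close> by (subst emeasure_lborel_ball) (auto simp: ennreal_mult)
  also have "R powr (- ?n) * (R ^ DIM('a) * ?w) = ?w"
    using \<open>R > 0\<close> by (simp add: powr_minus powr_realpow)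
  finally have T: "(\<integral>\<^sup>+y. ennreal (?\<tau> y) \<partial>lborel) \<le> ennreal ?w" by simp
  have "ennpowr (\<integral>\<^sup>+y\<in>ball x R. v y \<partial>lborel) p
      \<le> ennreal ((?w + 1) powr p) * (\<integral>\<^sup>+y. ennpowr (v y * indicator (ball x R) y) p * ennreal (?\<tau> y powr (1 - p)) \<partial>lborel)"
  proof (rule nn_integral_weighted_power_bound[OF _ _ \<open>p \<ge> 1\<close> _ T])
    show "0 < ?\<tau> y" if "v y * indicator (ball x R) y \<noteq> 0" for y
      using that \<open>R > 0\<close> by (auto split: split_indicator_asm)
    show "(\<lambda>y. v y * indicator (ball x R) y) \<in> borel_measurable lborel" by measurable
    show "?\<tau> \<in> borel_measurable lborel" by measurable
  qed simp
  also have "(\<integral>\<^sup>+y. ennpowr (v y * indicator (ball x R) y) p * ennreal (?\<tau> y powr (1 - p)) \<partial>lborel)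
      = (\<integral>\<^sup>+y. ennreal (R powr (?n * (p - 1))) * (ennpowr (v y) p * indicator (ball x R) y) \<partial>lborel)"
  proof (rule nn_integral_cong)
    fix y
    have "(- ?n) * (1 - p) = ?n * (p - 1)" by (simp add: algebra_simps)
    then show "ennpowr (v y * indicator (ball x R) y) p * ennreal (?\<tau> y powr (1 - p))
        = ennreal (R powr (?n * (p - 1))) * (ennpowr (v y) p * indicator (ball x R) y)"
      by (auto simp: powr_powr mult.commute split: split_indicator)
  qed
  also have "\<dots> = ennreal (R powr (?n * (p - 1))) * (\<integral>\<^sup>+y\<in>ball x R. ennpowr (v y) p \<partial>lborel)"
    by (rule nn_integral_cmult) measurable
  finally show ?thesis by (simp add: ennreal_mult mult.assoc)
qed

lemma ennpowr_weighted:
  "m > 0 \<Longrightarrow> ennpowr (ennreal (\<bar>a\<bar> / norm y powr r)) m = ennreal (\<bar>a\<bar> powr m / norm y powr (m * r))"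
  by (simp add: ennpowr_ennreal powr_divide powr_powr mult.commute)

lemma morrey_norm_le_iff:
  fixes u :: "'a::euclidean_space \<Rightarrow> real"
  assumes "m > 0"
  shows "morrey_norm m \<kappa> (m * r) u \<le> c \<longleftrightarrow> (\<forall>R>0. \<forall>x.
    ennpowr (ennreal (R powr (\<kappa> - real DIM('a))) *
      (\<integral>\<^sup>+y\<in>ball x R. ennpowr (ennreal (\<bar>u y\<bar> / norm y powr r)) m \<partial>lborel)) (1 / m) \<le> c)"
  unfolding morrey_norm_def nn_integral_completion ennpowr_weighted[OF assms]
  by (auto simp: SUP_le_iff)

text \<open>Hoelder passes from the power \<open>m\<close> to the power 1; the powers of
  \<open>R\<close> combine to \<open>(n - k) * m\<close>, and after the root neither the constant
  nor the exponent contains \<open>m\<close>. This makes the final constant uniform in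
  \<open>m\<close>.\<close>

lemma morrey_ball_bound:
  fixes u :: "'a::euclidean_space \<Rightarrow> real"
  assumes [measurable]: "u \<in> borel_measurable borel" and m: "1 \<le> m" and \<mu>: "\<mu> \<ge> 0"
    and M: "morrey_norm m (m * k) (m * r) u \<le> ennreal \<mu>" and R: "R > 0"
  shows "(\<integral>\<^sup>+y\<in>ball x R. ennreal (\<bar>u y\<bar> / norm y powr r) \<partial>lborel)
    \<le> ennreal ((measure lborel (ball (0::'a) 1) + 1) * \<mu> * R powr (real DIM('a) - k))"
proof -
  let ?n = "real DIM('a)" and ?w = "measure lborel (ball (0::'a) 1)"
  let ?v = "\<lambda>y. ennreal (\<bar>u y\<bar> / norm y powr r)"
  let ?J = "\<integral>\<^sup>+y\<in>ball x R. ennpowr (?v y) m \<partial>lborel"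
  have "ennpowr (ennreal (R powr (m * k - ?n)) * ?J) (1 / m) \<le> ennreal \<mu>"
    using M R m by (subst (asm) morrey_norm_le_iff) auto
  then have "ennreal (R powr (m * k - ?n)) * ?J \<le> ennreal (\<mu> powr (1 / (1 / m)))"
    using m \<mu> by (intro ennpowr_le_ennrealD) auto
  then have "ennreal (R powr (?n - m * k)) * (ennreal (R powr (m * k - ?n)) * ?J) \<le> ennreal (R powr (?n - m * k)) * ennreal (\<mu> powr m)"
    by (intro mult_left_mono) auto
  also have "ennreal (R powr (?n - m * k)) * (ennreal (R powr (m * k - ?n)) * ?J) = ?J"
    using R by (simp add: mult.assoc[symmetric] ennreal_mult[symmetric] powr_add[symmetric])
  finally have J: "?J \<le> ennreal (R powr (?n - m * k)) * ennreal (\<mu> powr m)" .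
  have "ennpowr (\<integral>\<^sup>+y\<in>ball x R. ?v y \<partial>lborel) m \<le> ennreal ((?w + 1) powr m * R powr (?n * (m - 1))) * ?J"
    using m R by (intro nn_integral_ball_power_bound) auto
  also have "\<dots> \<le> ennreal ((?w + 1) powr m * R powr (?n * (m - 1))) * (ennreal (R powr (?n - m * k)) * ennreal (\<mu> powr m))"
    by (intro mult_left_mono J) auto
  also have "\<dots> = ennreal (((?w + 1) * \<mu> * R powr (?n - k)) powr m)"
  proof -
    have "(?w + 1) powr m * R powr (?n * (m - 1)) * (R powr (?n - m * k) * \<mu> powr m)
        = (?w + 1) powr m * \<mu> powr m * R powr (?n * (m - 1) + (?n - m * k))"
      by (simp add: powr_add)
    also have "?n * (m - 1) + (?n - m * k) = (?n - k) * m" by (simp add: algebra_simps)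
    also have "(?w + 1) powr m * \<mu> powr m * R powr ((?n - k) * m) = ((?w + 1) * \<mu> * R powr (?n - k)) powr m"
      using \<mu> by (simp add: powr_mult powr_powr)
    finally have eq: "(?w + 1) powr m * R powr (?n * (m - 1)) * (R powr (?n - m * k) * \<mu> powr m)
        = ((?w + 1) * \<mu> * R powr (?n - k)) powr m" .
    show ?thesis unfolding eq[symmetric] by (simp add: ennreal_mult)
  qed
  finally have "(\<integral>\<^sup>+y\<in>ball x R. ?v y \<partial>lborel) \<le> ennreal ((((?w + 1) * \<mu> * R powr (?n - k)) powr m) powr (1 / m))"
    using m by (intro ennpowr_le_ennrealD) auto
  then show ?thesis using m \<mu> by (simp add: powr_powr)
qed

text \<open>Hoelder with exponent \<open>q / m\<close> produces exactly the power of
  \<open>R\<close> that the Morrey normalisation removes, so the supremum over balls is bounded by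
  the global weighted norm.\<close>

lemma morrey_norm_le_weighted_Lp:
  fixes u :: "'a::euclidean_space \<Rightarrow> real"
  assumes [measurable]: "u \<in> borel_measurable borel" and m: "1 \<le> m" "m < q" and l: "l \<ge> 0"
    and L: "(\<integral>\<^sup>+y. ennpowr (ennreal (\<bar>u y\<bar> / norm y powr r)) q \<partial>lborel) \<le> ennreal (l powr q)"
  shows "morrey_norm m (m * (real DIM('a) / q)) (m * r) u
    \<le> ennreal ((measure lborel (ball (0::'a) 1) + 1) * l)"
proof (subst morrey_norm_le_iff, goal_cases)
  case 2
  let ?n = "real DIM('a)" and ?w = "measure lborel (ball (0::'a) 1)"
  let ?v = "\<lambda>y. ennreal (\<bar>u y\<bar> / norm y powr r)"
  show ?case
  proof (intro allI impI)
    fix R :: real and x :: 'a assume R: "R > 0"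
    let ?J = "\<integral>\<^sup>+y\<in>ball x R. ennpowr (?v y) m \<partial>lborel"
    have "ennpowr ?J (q / m) \<le> ennreal ((?w + 1) powr (q / m) * R powr (?n * (q / m - 1)))
        * (\<integral>\<^sup>+y\<in>ball x R. ennpowr (ennpowr (?v y) m) (q / m) \<partial>lborel)"
      using m R by (intro nn_integral_ball_power_bound) auto
    also have "\<dots> \<le> ennreal ((?w + 1) powr (q / m) * R powr (?n * (q / m - 1))) * ennreal (l powr q)"
    proof (intro mult_left_mono order_trans[OF _ L] nn_integral_mono)
      fix y
      have "ennpowr (ennpowr (?v y) m) (q / m) = ennpowr (?v y) q"
        using m by (simp add: ennpowr_ennreal powr_powr)
      then show "ennpowr (ennpowr (?v y) m) (q / m) * indicator (ball x R) y \<le> ennpowr (?v y) q"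
        by (auto split: split_indicator)
    qed simp
    finally have "ennpowr ?J (q / m) \<le> ennreal ((?w + 1) powr (q / m) * R powr (?n * (q / m - 1)) * l powr q)"
      by (simp add: ennreal_mult)
    then have "?J \<le> ennreal (((?w + 1) powr (q / m) * R powr (?n * (q / m - 1)) * l powr q) powr (1 / (q / m)))"
      using m by (intro ennpowr_le_ennrealD) auto
    also have "((?w + 1) powr (q / m) * R powr (?n * (q / m - 1)) * l powr q) powr (1 / (q / m))
        = (?w + 1) * R powr (?n - m * (?n / q)) * l powr m"
    proof -
      have "?n * (q / m - 1) * (m / q) = ?n - m * (?n / q)" using m by (simp add: field_simps)
      then show ?thesis using m by (simp add: powr_mult powr_powr)
    qed
    finally have "ennreal (R powr (m * (?n / q) - ?n)) * ?J
        \<le> ennreal (R powr (m * (?n / q) - ?n)) * ennreal ((?w + 1) * R powr (?n - m * (?n / q)) * l powr m)"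
      by (intro mult_left_mono) auto
    also have "\<dots> = ennreal ((?w + 1) * l powr m * (R powr (m * (?n / q) - ?n) * R powr (?n - m * (?n / q))))"
      by (simp add: ennreal_mult'[symmetric] mult_ac)
    also have "R powr (m * (?n / q) - ?n) * R powr (?n - m * (?n / q)) = 1"
      using R by (simp add: powr_add[symmetric])
    finally have "ennpowr (ennreal (R powr (m * (?n / q) - ?n)) * ?J) (1 / m) \<le> ennpowr (ennreal ((?w + 1) * l powr m * 1)) (1 / m)"
      using m by (intro ennpowr_mono) auto
    also have "\<dots> = ennreal (((?w + 1) * l powr m * 1) powr (1 / m))"
      by (rule ennpowr_ennreal) simp
    also have "((?w + 1) * l powr m * 1) powr (1 / m) = (?w + 1) powr (1 / m) * l"
      using m l by (simp add: powr_mult powr_powr)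
    \<comment> \<open>The base is at least 1 and \<open>1 / m\<close> at most 1, so dropping the
      root removes \<open>m\<close> from the constant.\<close>
    also have "ennreal ((?w + 1) powr (1 / m) * l) \<le> ennreal ((?w + 1) * l)"
    proof (intro ennreal_leI mult_right_mono l)
      have "(?w + 1) powr (1 / m) \<le> (?w + 1) powr 1" using m by (intro powr_mono) auto
      then show "(?w + 1) powr (1 / m) \<le> ?w + 1" by simp
    qed
    finally show "ennpowr (ennreal (R powr (m * (?n / q) - ?n)) * ?J) (1 / m) \<le> ennreal ((?w + 1) * l)" .
  qed
qed (use m in auto)

text \<open>The constant of \<open>pointwise_interpolation\<close> with
  \<open>A = 2^r (\<omega> + 1) / \<omega>\<close> and \<open>C = 1 / \<omega>\<close>:
  \<open>2^r\<close> comes from \<open>|y| \<le> 2|x|\<close>, \<open>\<omega> + 1\<close> from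
  Hoelder on balls, and \<open>1 / \<omega>\<close> from dividing the Poincare inequality by the
  volume of the ball.\<close>

definition endpoint_const :: "'a::euclidean_space itself \<Rightarrow> real \<Rightarrow> real \<Rightarrow> real \<Rightarrow> real" where
  "endpoint_const _ p q r = (let \<omega> = measure lborel (ball (0::'a) 1) in
     (2 * (2 powr r * (\<omega> + 1) / \<omega>)) powr (q - p) * (1 + (2 * (1 / \<omega>)) powr p))"

context upper_gradient_pair
begin

text \<open>The pointwise interpolation is integrated: Hardy's inequality handles the
  \<open>p\<close>-th power of \<open>|u| / |x|\<close>, the strong type inequality that of the
  maximal function. The Morrey norm enters only as a bound on first-power integrals over balls, free
  of \<open>m\<close>.\<close>

lemma weighted_integral_endpoint:
  assumes p: "1 < p" "p < real DIM('a)" and \<alpha>: "0 < \<alpha>" "\<alpha> < p"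
    and q: "q = p * (real DIM('a) - \<alpha>) / (real DIM('a) - p)" and r: "r = \<alpha> / q"
    and decay: "q' > 0" "(\<integral>\<^sup>+x. ennreal (\<bar>u x\<bar> powr q') \<partial>lborel) < \<infinity>"
    and fin: "(\<integral>\<^sup>+x. ennpowr (w x) p \<partial>lborel) < \<infinity>"
    and \<mu>: "\<mu> > 0"
    and ball: "\<And>x R. R > 0 \<Longrightarrow> (\<integral>\<^sup>+y\<in>ball x R. ennreal (\<bar>u y\<bar> / norm y powr r) \<partial>lborel)
      \<le> ennreal ((measure lborel (ball (0::'a) 1) + 1) * \<mu> * R powr (real DIM('a) - real DIM('a) / q))"
  shows "(\<integral>\<^sup>+x. ennreal (\<bar>u x\<bar> powr q / norm x powr \<alpha>) \<partial>lborel)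
    \<le> ennreal (endpoint_const TYPE('a) p q r * \<mu> powr (q - p)) *
      ((ennreal (radial_const DIM('a) p) + ennreal (maximal_const TYPE('a) p)) * (\<integral>\<^sup>+x. ennpowr (w x) p \<partial>lborel))"
proof -
  let ?n = "real DIM('a)"
  define \<omega> where "\<omega> = measure lborel (ball (0::'a) 1)"
  have \<omega>: "\<omega> > 0" unfolding \<omega>_def by (rule content_unit_ball_pos)
  define A where "A = 2 powr r * (\<omega> + 1) / \<omega>"
  define C where "C = 1 / \<omega>"
  have AC: "A > 0" "C > 0" using \<omega> by (auto simp: A_def C_def)
  have K: "endpoint_const TYPE('a) p q r = (2 * A) powr (q - p) * (1 + (2 * C) powr p)"
    by (simp add: endpoint_const_def Let_def A_def C_def \<omega>_def)
  have q0: "q > 0" using p \<alpha> unfolding q by (intro divide_pos_pos mult_pos_pos) auto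
  have r0: "r > 0" using \<alpha> q0 by (simp add: r)
  have strong: "(\<integral>\<^sup>+x. ennpowr (hl_maximal w x) p \<partial>lborel) \<le> ennreal (maximal_const TYPE('a) p) * (\<integral>\<^sup>+x. ennpowr (w x) p \<partial>lborel)"
    by (rule hl_maximal_strong_type[OF w_borel p(1)])
  also have "\<dots> < \<infinity>" using fin by (simp add: ennreal_mult_less_top)
  finally have "(\<integral>\<^sup>+x. ennpowr (hl_maximal w x) p \<partial>lborel) \<noteq> \<infinity>" by simp
  \<comment> \<open>The scalar interpolation needs a real value \<open>W\<close>, so points with
    infinite maximal function are discarded.\<close>
  then have AE_fin: "AE x in lborel. ennpowr (hl_maximal w x) p \<noteq> \<infinity>"
    by (intro nn_integral_PInf_AE) auto
  have "AE x in lborel. ennreal (\<bar>u x\<bar> powr q / norm x powr \<alpha>)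
      \<le> ennreal (endpoint_const TYPE('a) p q r * \<mu> powr (q - p)) * (ennreal ((\<bar>u x\<bar> / norm x) powr p) + ennpowr (hl_maximal w x) p)"
    using AE_fin AE_E AE_lborel_singleton[of "0::'a"]
  proof eventually_elim
    case (elim x)
    obtain W where W: "hl_maximal w x = ennreal W" "W \<ge> 0"
      using elim(1) by (cases "hl_maximal w x") auto
    have \<rho>: "norm x > 0" using elim(3) by simp
    have "\<bar>u x\<bar> \<le> A * norm x powr r * R powr (- (?n / q)) * \<mu> + C * R * W" if R: "0 < R" "R \<le> norm x" for R
    proof -
      have "(\<integral>\<^sup>+y\<in>ball x R. ennreal \<bar>u y\<bar> \<partial>lborel)
          \<le> (\<integral>\<^sup>+y. ennreal ((2 * norm x) powr r) * (ennreal (\<bar>u y\<bar> / norm y powr r) * indicator (ball x R) y) \<partial>lborel)"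
      proof (rule nn_integral_mono_AE)
        show "AE y in lborel. ennreal \<bar>u y\<bar> * indicator (ball x R) y
            \<le> ennreal ((2 * norm x) powr r) * (ennreal (\<bar>u y\<bar> / norm y powr r) * indicator (ball x R) y)"
          using AE_lborel_singleton[of "0::'a"]
        proof eventually_elim
          case (elim y)
          show ?case
          proof (cases "y \<in> ball x R")
            case True
            have "norm y \<le> norm x + dist x y"
              using norm_triangle_ineq2[of y x] by (simp add: dist_norm norm_minus_commute)
            \<comment> \<open>Here \<open>R \<le> norm x\<close> enters: on the ball the weight
              \<open>norm y powr r\<close> is at most a multiple of its value at the centre.\<close>
            then have "norm y \<le> 2 * norm x" using True R by simp
            then have "norm y powr r \<le> (2 * norm x) powr r" using r0 by (intro powr_mono2) auto
            then have "\<bar>u y\<bar> * norm y powr r \<le> \<bar>u y\<bar> * (2 * norm x) powr r"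
              by (intro mult_left_mono) auto
            then have "\<bar>u y\<bar> \<le> (2 * norm x) powr r * (\<bar>u y\<bar> / norm y powr r)"
              using elim by (simp add: field_simps)
            then have "ennreal \<bar>u y\<bar> \<le> ennreal ((2 * norm x) powr r) * ennreal (\<bar>u y\<bar> / norm y powr r)"
              by (subst ennreal_mult[symmetric]) (auto intro: ennreal_leI)
            then show ?thesis using True by simp
          qed simp
        qed
      qed
      also have "\<dots> = ennreal ((2 * norm x) powr r) * (\<integral>\<^sup>+y\<in>ball x R. ennreal (\<bar>u y\<bar> / norm y powr r) \<partial>lborel)"
        by (rule nn_integral_cmult) measurable
      also have "\<dots> \<le> ennreal ((2 * norm x) powr r) * ennreal ((\<omega> + 1) * \<mu> * R powr (?n - ?n / q))"
        unfolding \<omega>_def by (intro mult_left_mono ball R) auto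
      finally have "ennreal (R ^ DIM('a) * \<omega> * \<bar>u x\<bar>)
          \<le> ennreal ((2 * norm x) powr r) * ennreal ((\<omega> + 1) * \<mu> * R powr (?n - ?n / q)) + ennreal (R ^ DIM('a) * R) * ennreal W"
        using order_trans[OF poincare_pointwise[OF elim(2) R(1)] add_right_mono] by (simp add: \<omega>_def W)
      also have "\<dots> = ennreal ((2 * norm x) powr r * ((\<omega> + 1) * \<mu> * R powr (?n - ?n / q)) + R ^ DIM('a) * R * W)"
        using \<omega> \<mu> R W by (simp add: ennreal_mult[symmetric] ennreal_plus[symmetric] del: ennreal_plus)
      finally have "R ^ DIM('a) * \<omega> * \<bar>u x\<bar> \<le> (2 * norm x) powr r * ((\<omega> + 1) * \<mu> * R powr (?n - ?n / q)) + R ^ DIM('a) * R * W"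
        using \<omega> \<mu> R W by (subst (asm) ennreal_le_iff) auto
      \<comment> \<open>Extracting the common factor \<open>R^n \<omega>\<close> brings out
        \<open>A\<close> and \<open>C\<close> and turns \<open>R powr (n - n / q)\<close> into
        \<open>R powr (- (n / q))\<close>.\<close>
      also have "(2 * norm x) powr r * ((\<omega> + 1) * \<mu> * R powr (?n - ?n / q)) + R ^ DIM('a) * R * W
          = (R ^ DIM('a) * \<omega>) * (A * norm x powr r * R powr (- (?n / q)) * \<mu> + C * R * W)"
      proof -
        have "R powr (?n - ?n / q) = R ^ DIM('a) * R powr (- (?n / q))"
          using R by (simp add: powr_realpow[symmetric] powr_add[symmetric])
        then show ?thesis using \<omega> by (simp add: A_def C_def powr_mult field_simps)
      qed
      finally show ?thesis
        using \<omega> R by (simp add: mult_le_cancel_left_pos)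
    qed
    then have "\<bar>u x\<bar> powr q * norm x powr (- \<alpha>)
        \<le> (2 * A) powr (q - p) * (1 + (2 * C) powr p) * \<mu> powr (q - p) * ((\<bar>u x\<bar> / norm x) powr p + W powr p)"
      using p \<alpha> q r W AC \<rho> \<mu> by (intro pointwise_interpolation[where n = ?n and r = r]) auto
    then have "\<bar>u x\<bar> powr q / norm x powr \<alpha>
        \<le> endpoint_const TYPE('a) p q r * \<mu> powr (q - p) * ((\<bar>u x\<bar> / norm x) powr p + W powr p)"
      by (simp add: K powr_minus_divide)
    then have "ennreal (\<bar>u x\<bar> powr q / norm x powr \<alpha>)
        \<le> ennreal (endpoint_const TYPE('a) p q r * \<mu> powr (q - p) * ((\<bar>u x\<bar> / norm x) powr p + W powr p))"
      by (rule ennreal_leI)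
    also have "\<dots> = ennreal (endpoint_const TYPE('a) p q r * \<mu> powr (q - p)) * (ennreal ((\<bar>u x\<bar> / norm x) powr p) + ennpowr (hl_maximal w x) p)"
      using W by (subst ennreal_mult) (auto simp: K ennpowr_ennreal)
    finally show ?case .
  qed
  then have "(\<integral>\<^sup>+x. ennreal (\<bar>u x\<bar> powr q / norm x powr \<alpha>) \<partial>lborel)
      \<le> (\<integral>\<^sup>+x. ennreal (endpoint_const TYPE('a) p q r * \<mu> powr (q - p)) * (ennreal ((\<bar>u x\<bar> / norm x) powr p) + ennpowr (hl_maximal w x) p) \<partial>lborel)"
    by (rule nn_integral_mono_AE)
  also have "\<dots> = ennreal (endpoint_const TYPE('a) p q r * \<mu> powr (q - p)) *
      ((\<integral>\<^sup>+x. ennreal ((\<bar>u x\<bar> / norm x) powr p) \<partial>lborel) + (\<integral>\<^sup>+x. ennpowr (hl_maximal w x) p \<partial>lborel))"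
    by (subst nn_integral_cmult, measurable, subst nn_integral_add, measurable)
  also have "\<dots> \<le> ennreal (endpoint_const TYPE('a) p q r * \<mu> powr (q - p)) *
      (ennreal (radial_const DIM('a) p) * (\<integral>\<^sup>+x. ennpowr (w x) p \<partial>lborel) + ennreal (maximal_const TYPE('a) p) * (\<integral>\<^sup>+x. ennpowr (w x) p \<partial>lborel))"
    by (intro mult_left_mono add_mono strong hardy_inequality[OF p decay]) auto
  finally show ?thesis by (simp only: distrib_right)
qed

end

definition gradient_const :: "'a::euclidean_space itself \<Rightarrow> real \<Rightarrow> real" where
  "gradient_const _ p = (1 / bump_mass TYPE('a)) powr p * maximal_const TYPE('a) p"

text \<open>\<open>ennreal\<close> truncates negative reals to 0; \<open>max 0\<close> performs the
  same truncation on the real side, so that positivity can be read off from the other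
  factors.\<close>

definition endpoint_total_const :: "'a::euclidean_space itself \<Rightarrow> real \<Rightarrow> real \<Rightarrow> real \<Rightarrow> real" where
  "endpoint_total_const _ p q r = endpoint_const TYPE('a) p q r *
     ((max 0 (radial_const DIM('a) p) + maximal_const TYPE('a) p) * gradient_const TYPE('a) p)"

lemma gradient_const_pos: "p > 1 \<Longrightarrow> gradient_const TYPE('a::euclidean_space) p > 0"
  using bump_mass_pos[where 'a = 'a] maximal_const_pos[of p, where 'a = 'a]
  by (simp add: gradient_const_def)

lemma endpoint_const_pos: "endpoint_const TYPE('a::euclidean_space) p q r > 0"
proof -
  have "measure lborel (ball (0::'a) 1) > 0" by (rule content_unit_ball_pos)
  then show ?thesis
    unfolding endpoint_const_def Let_def
    by (intro mult_pos_pos add_pos_nonneg) (auto simp: add_nonneg_eq_0_iff)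
qed

lemma endpoint_total_const_pos: "p > 1 \<Longrightarrow> endpoint_total_const TYPE('a::euclidean_space) p q r > 0"
  unfolding endpoint_total_const_def
  by (intro mult_pos_pos add_nonneg_pos endpoint_const_pos gradient_const_pos maximal_const_pos) auto

context borel_weak_gradient
begin

lemma nn_integral_upper_gradient:
  assumes "p > 1"
  shows "(\<integral>\<^sup>+x. ennpowr (upper_gradient x) p \<partial>lborel)
    \<le> ennreal (gradient_const TYPE('a) p) * (\<integral>\<^sup>+x. ennreal (norm (G x) powr p) \<partial>lborel)"
proof -
  have "(\<integral>\<^sup>+x. ennpowr (upper_gradient x) p \<partial>lborel)
      = ennreal ((1 / bump_mass TYPE('a)) powr p) * (\<integral>\<^sup>+x. ennpowr (hl_maximal (\<lambda>y. ennreal (norm (G y))) x) p \<partial>lborel)"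
    using bump_mass_pos[where 'a = 'a]
    by (simp add: upper_gradient_def ennpowr_cmult nn_integral_cmult)
  also have "\<dots> \<le> ennreal ((1 / bump_mass TYPE('a)) powr p) *
      (ennreal (maximal_const TYPE('a) p) * (\<integral>\<^sup>+x. ennpowr (ennreal (norm (G x))) p \<partial>lborel))"
    using assms by (intro mult_left_mono hl_maximal_strong_type) auto
  also have "\<dots> = ennreal (gradient_const TYPE('a) p) * (\<integral>\<^sup>+x. ennreal (norm (G x) powr p) \<partial>lborel)"
    using maximal_const_pos[OF assms, where 'a = 'a]
    by (simp add: gradient_const_def ennpowr_ennreal ennreal_mult mult.assoc)
  finally show ?thesis .
qed

text \<open>The strong type inequality is applied at two levels: to bound
  \<open>upper_gradient\<close> by \<open>G\<close>, and, within the pair estimate, to bound the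
  maximal function of \<open>upper_gradient\<close>.\<close>

lemma sobolev_endpoint:
  assumes p: "1 < p" "p < real DIM('a)" and \<alpha>: "0 < \<alpha>" "\<alpha> < p"
    and q: "q = p * (real DIM('a) - \<alpha>) / (real DIM('a) - p)" and r: "r = \<alpha> / q"
    and decay: "q' > 0" "(\<integral>\<^sup>+x. ennreal (\<bar>u x\<bar> powr q') \<partial>lborel) < \<infinity>"
    and fin: "(\<integral>\<^sup>+x. ennreal (norm (G x) powr p) \<partial>lborel) < \<infinity>"
    and \<mu>: "\<mu> > 0" and m: "1 \<le> m" and M: "morrey_norm m (m * (real DIM('a) / q)) (m * r) u \<le> ennreal \<mu>"
  shows "(\<integral>\<^sup>+x. ennreal (\<bar>u x\<bar> powr q / norm x powr \<alpha>) \<partial>lborel)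
    \<le> ennreal (endpoint_total_const TYPE('a) p q r * \<mu> powr (q - p)) * (\<integral>\<^sup>+x. ennreal (norm (G x) powr p) \<partial>lborel)"
proof -
  obtain E where E: "AE x in lborel. x \<in> E" "\<forall>x\<in>E. \<forall>y\<in>E. ennreal \<bar>u y - u x\<bar>
      \<le> ennreal (norm (y - x)) * (\<integral>\<^sup>+t\<in>{0..1}. upper_gradient (x + t *\<^sub>R (y - x)) \<partial>lborel)"
    using upper_gradient_inequality by blast
  interpret P: upper_gradient_pair u upper_gradient E
    by standard (use E in auto)
  let ?I = "\<integral>\<^sup>+x. ennpowr (upper_gradient x) p \<partial>lborel"
  let ?J = "\<integral>\<^sup>+x. ennreal (norm (G x) powr p) \<partial>lborel"
  let ?c = "endpoint_const TYPE('a) p q r * \<mu> powr (q - p)"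
  let ?s = "max 0 (radial_const DIM('a) p) + maximal_const TYPE('a) p"
  have I: "?I \<le> ennreal (gradient_const TYPE('a) p) * ?J"
    by (rule nn_integral_upper_gradient[OF p(1)])
  also have "\<dots> < \<infinity>" using fin by (simp add: ennreal_mult_less_top)
  finally have "?I < \<infinity>" .
  then have "(\<integral>\<^sup>+x. ennreal (\<bar>u x\<bar> powr q / norm x powr \<alpha>) \<partial>lborel)
      \<le> ennreal ?c * ((ennreal (radial_const DIM('a) p) + ennreal (maximal_const TYPE('a) p)) * ?I)"
    using \<mu> m by (intro P.weighted_integral_endpoint[OF p \<alpha> q r decay] morrey_ball_bound[OF _ _ _ M]) auto
  also have "\<dots> \<le> ennreal ?c * (ennreal ?s * (ennreal (gradient_const TYPE('a) p) * ?J))"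
  proof (intro mult_left_mono mult_mono I)
    have "ennreal (radial_const DIM('a) p) \<le> ennreal (max 0 (radial_const DIM('a) p))" by (intro ennreal_leI) simp
    then show "ennreal (radial_const DIM('a) p) + ennreal (maximal_const TYPE('a) p) \<le> ennreal ?s"
      using maximal_const_pos[OF p(1), where 'a = 'a] by (subst ennreal_plus) (auto intro: add_mono)
  qed auto
  also have "\<dots> = ennreal (?c * (?s * gradient_const TYPE('a) p)) * ?J"
    using endpoint_const_pos[of p q r, where 'a = 'a] gradient_const_pos[OF p(1), where 'a = 'a] maximal_const_pos[OF p(1), where 'a = 'a]
    by (simp add: ennreal_mult mult.assoc del: ennreal_plus)
  also have "?c * (?s * gradient_const TYPE('a) p) = endpoint_total_const TYPE('a) p q r * \<mu> powr (q - p)"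
    by (simp add: endpoint_total_const_def)
  finally show ?thesis .
qed

text \<open>Hardy's inequality with vanishing right-hand side. Since
  \<open>0 * \<infinity> = 0\<close> in \<open>ennreal\<close>, the interpolation inequality for a
  zero gradient norm asserts that the left-hand side vanishes even if the Morrey norm is
  infinite.\<close>

lemma gradient_zero_imp_zero:
  assumes p: "1 < p" "p < real DIM('a)"
    and decay: "q' > 0" "(\<integral>\<^sup>+x. ennreal (\<bar>u x\<bar> powr q') \<partial>lborel) < \<infinity>"
    and zero: "(\<integral>\<^sup>+x. ennreal (norm (G x) powr p) \<partial>lborel) = 0"
  shows "AE x in lborel. u x = 0"
proof -
  obtain E where E: "AE x in lborel. x \<in> E" "\<forall>x\<in>E. \<forall>y\<in>E. ennreal \<bar>u y - u x\<bar>
      \<le> ennreal (norm (y - x)) * (\<integral>\<^sup>+t\<in>{0..1}. upper_gradient (x + t *\<^sub>R (y - x)) \<partial>lborel)"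
    using upper_gradient_inequality by blast
  interpret P: upper_gradient_pair u upper_gradient E
    by standard (use E in auto)
  have "(\<integral>\<^sup>+x. ennpowr (upper_gradient x) p \<partial>lborel) = 0"
    using nn_integral_upper_gradient[OF p(1)] by (simp add: zero)
  then have "(\<integral>\<^sup>+x. ennreal ((\<bar>u x\<bar> / norm x) powr p) \<partial>lborel) = 0"
    using P.hardy_inequality[OF p decay] by simp
  then have "AE x in lborel. ennreal ((\<bar>u x\<bar> / norm x) powr p) = 0"
    by (subst (asm) nn_integral_0_iff_AE) auto
  with AE_lborel_singleton[of "0::'a"] show ?thesis
    by eventually_elim (auto simp: ennreal_eq_0_iff)
qed

end

text \<open>The ball bound with \<open>\<mu> = 0\<close>, on balls about the origin that exhaust the
  space. The origin is set aside, as division by the vanishing weight carries no information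
  there.\<close>

lemma morrey_zero_imp_zero:
  fixes u :: "'a::euclidean_space \<Rightarrow> real"
  assumes [measurable]: "u \<in> borel_measurable borel" and m: "1 \<le> m"
    and M: "morrey_norm m (m * k) (m * r) u = 0"
  shows "AE x in lborel. u x = 0"
proof -
  have "AE x in lborel. \<forall>N::nat. ennreal (\<bar>u x\<bar> / norm x powr r) * indicator (ball 0 (real (Suc N))) x = 0"
    unfolding AE_all_countable
  proof
    fix N :: nat
    have "(\<integral>\<^sup>+y\<in>ball 0 (real (Suc N)). ennreal (\<bar>u y\<bar> / norm y powr r) \<partial>lborel) \<le> ennreal 0"
      using morrey_ball_bound[of u m 0 k r "real (Suc N)" 0] m M by simp
    then show "AE x in lborel. ennreal (\<bar>u x\<bar> / norm x powr r) * indicator (ball 0 (real (Suc N))) x = 0"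
      by (subst nn_integral_0_iff_AE[symmetric]) auto
  qed
  with AE_lborel_singleton[of "0::'a"] show ?thesis
  proof eventually_elim
    case (elim x)
    obtain N where "norm x < real N" using reals_Archimedean2 by blast
    then have "x \<in> ball 0 (real (Suc N))" by simp
    then have "ennreal (\<bar>u x\<bar> / norm x powr r) = 0"
      using elim(2)[rule_format, of N] by simp
    then have "\<bar>u x\<bar> / norm x powr r \<le> 0" by (simp only: ennreal_eq_0_iff)
    then show "u x = 0" using elim(1) by (auto simp: divide_le_0_iff)
  qed
qed

section \<open>Passage from Lebesgue measurable to Borel functions\<close>

lemma lebesgue_borel_representative:
  fixes f :: "'a::euclidean_space \<Rightarrow> 'b::euclidean_space"
  assumes [measurable]: "f \<in> borel_measurable lebesgue"
  obtains f' where "f' \<in> borel_measurable borel" "AE x in lborel. f x = f' x"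
proof -
  have "\<exists>g\<in>borel_measurable lborel. AE x in lborel. f x \<bullet> b = g x" for b
    by (rule completion_ex_borel_measurable_real) measurable
  then obtain g where g: "\<And>b. g b \<in> borel_measurable lborel" "\<And>b. AE x in lborel. f x \<bullet> b = g b x"
    by metis
  have [measurable]: "g b \<in> borel_measurable borel" for b using g(1)[of b] by simp
  show ?thesis
  proof (rule that)
    show "(\<lambda>x. \<Sum>b\<in>Basis. g b x *\<^sub>R b) \<in> borel_measurable borel" by measurable
    have "AE x in lborel. \<forall>b\<in>Basis. f x \<bullet> b = g b x"
      using g(2) by (intro AE_finite_allI) auto
    then show "AE x in lborel. f x = (\<Sum>b\<in>Basis. g b x *\<^sub>R b)"
      by eventually_elim (metis (mono_tags, lifting) euclidean_representation sum.cong)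
  qed
qed

lemma integrable_lborel_representative:
  fixes f f' :: "'a::euclidean_space \<Rightarrow> 'b::{banach, second_countable_topology}"
  assumes f: "f \<in> borel_measurable lebesgue" and f': "f' \<in> borel_measurable borel"
    and eq: "AE x in lborel. f x = f' x"
  shows "integrable lebesgue f \<longleftrightarrow> integrable lborel f'"
    and "integral\<^sup>L lebesgue f = integral\<^sup>L lborel f'"
proof -
  have f'_leb: "f' \<in> borel_measurable lebesgue"
    using f' by (simp add: measurable_completion)
  have AE: "AE x in lebesgue. f x = f' x"
    by (rule AE_completion[OF eq])
  have "integrable lebesgue f \<longleftrightarrow> integrable lebesgue f'"
    by (rule integrable_cong_AE[OF f f'_leb AE])
  also have "\<dots> \<longleftrightarrow> integrable lborel f'"
    using f' by (intro integrable_completion) simp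
  finally show "integrable lebesgue f \<longleftrightarrow> integrable lborel f'" .
  have "integral\<^sup>L lebesgue f = integral\<^sup>L lebesgue f'"
    by (rule integral_cong_AE[OF f f'_leb AE])
  also have "\<dots> = integral\<^sup>L lborel f'"
    using f' by (intro integral_completion) simp
  finally show "integral\<^sup>L lebesgue f = integral\<^sup>L lborel f'" .
qed

text \<open>Changing \<open>u\<close> and \<open>G\<close> on null sets leaves every integral in the
  definition unchanged; test functions and their derivatives are continuous, so the products stay
  Borel.\<close>

lemma has_weak_gradient_borel:
  fixes u u' :: "'a::euclidean_space \<Rightarrow> real"
  assumes wg: "has_weak_gradient u G"
    and u: "u \<in> borel_measurable lebesgue" and G: "G \<in> borel_measurable lebesgue"
    and u': "u' \<in> borel_measurable borel" "AE x in lborel. u x = u' x"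
    and G': "G' \<in> borel_measurable borel" "AE x in lborel. G x = G' x"
  shows "borel_weak_gradient u' G'"
proof
  have [measurable]: "u \<in> borel_measurable lebesgue" "G \<in> borel_measurable lebesgue"
    "u' \<in> borel_measurable borel" "G' \<in> borel_measurable borel" by fact+
  show "u' \<in> borel_measurable borel" "G' \<in> borel_measurable borel" by fact+
  fix K :: "'a set" assume K: "compact K"
  then have [measurable]: "K \<in> sets borel" by (rule borel_compact)
  have Kl [measurable]: "K \<in> sets lebesgue" by simp
  have "integrable lebesgue (\<lambda>x. indicator K x *\<^sub>R u x)"
    using wg K by (auto simp: has_weak_gradient_def locally_integrable_def set_integrable_def)
  moreover have "AE x in lborel. indicator K x *\<^sub>R u x = indicator K x *\<^sub>R u' x"
    using u'(2) by eventually_elim simp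
  ultimately show "set_integrable lborel K u'"
    unfolding set_integrable_def
    by (subst (asm) integrable_lborel_representative(1)[where f' = "\<lambda>x. indicator K x *\<^sub>R u' x"]) auto
  have "integrable lebesgue (\<lambda>x. indicator K x *\<^sub>R G x)"
    using wg K by (auto simp: has_weak_gradient_def locally_integrable_def set_integrable_def)
  moreover have "AE x in lborel. indicator K x *\<^sub>R G x = indicator K x *\<^sub>R G' x"
    using G'(2) by eventually_elim simp
  ultimately show "set_integrable lborel K G'"
    unfolding set_integrable_def
    by (subst (asm) integrable_lborel_representative(1)[where f' = "\<lambda>x. indicator K x *\<^sub>R G' x"]) auto
next
  have [measurable]: "u \<in> borel_measurable lebesgue" "G \<in> borel_measurable lebesgue"
    "u' \<in> borel_measurable borel" "G' \<in> borel_measurable borel" by fact+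
  fix \<phi> :: "'a \<Rightarrow> real" and b :: 'a assume \<phi>: "\<phi> \<in> test_functions" and b: "b \<in> Basis"
  have C: "C_k (Suc 0) \<phi>" "C_k 0 \<phi>" using \<phi> unfolding test_functions_def by blast+
  have \<phi>_borel [measurable]: "\<phi> \<in> borel_measurable borel"
    using C(2) by (intro borel_measurable_continuous_onI) simp
  have D_borel [measurable]: "(\<lambda>x. frechet_derivative \<phi> (at x) b) \<in> borel_measurable borel"
    using C(1) b by (intro borel_measurable_continuous_onI) simp
  have [measurable]: "\<phi> \<in> borel_measurable lebesgue" "(\<lambda>x. frechet_derivative \<phi> (at x) b) \<in> borel_measurable lebesgue"
    using \<phi>_borel D_borel by (simp_all add: measurable_completion)
  have "(LINT x|lebesgue. u x * frechet_derivative \<phi> (at x) b) = (LINT x|lborel. u' x * frechet_derivative \<phi> (at x) b)"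
    by (rule integrable_lborel_representative(2)) (measurable, use u'(2) in auto)
  moreover have "(LINT x|lebesgue. (G x \<bullet> b) * \<phi> x) = (LINT x|lborel. (G' x \<bullet> b) * \<phi> x)"
    by (rule integrable_lborel_representative(2)) (measurable, use G'(2) in auto)
  moreover have "(LINT x|lebesgue. u x * frechet_derivative \<phi> (at x) b) = - (LINT x|lebesgue. (G x \<bullet> b) * \<phi> x)"
    using wg \<phi> b by (auto simp: has_weak_gradient_def)
  ultimately show "(LINT x|lborel. u' x * frechet_derivative \<phi> (at x) b) = - (LINT x|lborel. (G' x \<bullet> b) * \<phi> x)"
    by simp
qed

text \<open>The whole range above the endpoint \<open>p / q\<close>, with the Morrey exponent in the
  form \<open>m n / q\<close> produced by Hoelder on balls.\<close>

lemma improved_hardy_sobolev: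
  fixes p \<alpha> q r :: real
  assumes p: "1 < p" "p < real DIM('a::euclidean_space)" and \<alpha>: "0 < \<alpha>" "\<alpha> < p"
    and q: "q = p * (real DIM('a) - \<alpha>) / (real DIM('a) - p)" and r: "r = \<alpha> / q"
  obtains C where "C > 0" "\<And>\<theta> m (u :: 'a \<Rightarrow> real).
    p / q < \<theta> \<Longrightarrow> \<theta> < 1 \<Longrightarrow> 1 \<le> m \<Longrightarrow> m < q \<Longrightarrow> u \<in> D1p p \<Longrightarrow>
      ennpowr (\<integral>\<^sup>+y. ennreal (\<bar>u y\<bar> powr q / norm y powr \<alpha>) \<partial>lebesgue) (1 / q)
        \<le> ennreal C * ennpowr (D1p_norm p u) \<theta>
            * ennpowr (morrey_norm m (m * (real DIM('a) / q)) (m * r) u) (1 - \<theta>)"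
proof
  let ?n = "real DIM('a)"
  define \<Omega> where "\<Omega> = measure lborel (ball (0::'a) 1) + 1"
  have \<Omega>: "\<Omega> > 0" unfolding \<Omega>_def by (simp add: add_nonneg_pos)
  define K where "K = endpoint_total_const TYPE('a) p q r"
  have K: "K > 0" unfolding K_def by (rule endpoint_total_const_pos[OF p(1)])
  define k where "k = K powr (1 / q)"
  have k: "k > 0" using K by (simp add: k_def)
  have q0: "q > 0" using p \<alpha> unfolding q by (intro divide_pos_pos mult_pos_pos) auto
  \<comment> \<open>\<open>k\<close> is the \<open>q\<close>-th root of the endpoint constant, and
    the maximum is the one from raising the exponent. Neither \<theta> nor \<open>m\<close> has been
    fixed at this point.\<close>
  define C where "C = k * max 1 ((\<Omega> * k) powr (1 / (p / q)))"
  show C: "C > 0" using k by (simp add: C_def less_max_iff_disj)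
  fix \<theta> m and u :: "'a \<Rightarrow> real"
  assume \<theta>: "p / q < \<theta>" "\<theta> < 1" and m: "1 \<le> m" "m < q" and u: "u \<in> D1p p"
  define G where "G = weak_gradient u"
  have wg: "has_weak_gradient u G"
  proof -
    have "\<exists>G. has_weak_gradient u G" using u by (auto simp: D1p_def)
    then show ?thesis unfolding G_def weak_gradient_def by (rule someI_ex)
  qed
  have u_meas: "u \<in> borel_measurable lebesgue" and G_meas: "G \<in> borel_measurable lebesgue"
    using u by (auto simp: D1p_def Lp_functions_def G_def)
  obtain u' where u': "u' \<in> borel_measurable borel" "AE x in lborel. u x = u' x"
    using lebesgue_borel_representative[OF u_meas] by blast
  obtain G' where G': "G' \<in> borel_measurable borel" "AE x in lborel. G x = G' x"
    using lebesgue_borel_representative[OF G_meas] by blast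
  interpret W: borel_weak_gradient u' G'
    by (rule has_weak_gradient_borel[OF wg u_meas G_meas u' G'])
  define q' where "q' = sobolev_exponent DIM('a) p"
  have q': "q' > 0" using p by (simp add: q'_def sobolev_exponent_def)
  have "(\<integral>\<^sup>+x. ennreal (\<bar>u' x\<bar> powr q') \<partial>lborel) = (\<integral>\<^sup>+x. ennreal (norm (u x) powr q') \<partial>lebesgue)"
    unfolding nn_integral_completion using u'(2) by (intro nn_integral_cong_AE) auto
  also have "\<dots> < \<infinity>"
    using u by (auto simp: D1p_def Lp_functions_def q'_def integrable_iff_bounded)
  finally have decay: "(\<integral>\<^sup>+x. ennreal (\<bar>u' x\<bar> powr q') \<partial>lborel) < \<infinity>" .
  define J where "J = (\<integral>\<^sup>+x. ennreal (norm (G' x) powr p) \<partial>lborel)"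
  have J_eq: "(\<integral>\<^sup>+x. ennreal (norm (G x) powr p) \<partial>lebesgue) = J"
    unfolding nn_integral_completion J_def using G'(2) by (intro nn_integral_cong_AE) auto
  have "(\<integral>\<^sup>+x. ennreal (norm (G x) powr p) \<partial>lebesgue) < \<infinity>"
    using u by (auto simp: D1p_def Lp_functions_def G_def integrable_iff_bounded)
  then have J_fin: "J < \<infinity>" by (simp add: J_eq)
  then obtain \<delta> where \<delta>: "J = ennreal \<delta>" "\<delta> \<ge> 0" by (cases J) auto
  define D where "D = \<delta> powr (1 / p)"
  have D: "D1p_norm p u = ennreal D"
    unfolding D1p_norm_def G_def[symmetric] J_eq using \<delta> by (simp add: ennpowr_ennreal D_def)
  have Dp: "D powr p = \<delta>" using \<delta> p by (simp add: D_def powr_powr)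
  define L where "L = (\<integral>\<^sup>+y. ennreal (\<bar>u' y\<bar> powr q / norm y powr \<alpha>) \<partial>lborel)"
  have L_eq: "(\<integral>\<^sup>+y. ennreal (\<bar>u y\<bar> powr q / norm y powr \<alpha>) \<partial>lebesgue) = L"
    unfolding nn_integral_completion L_def using u'(2) by (intro nn_integral_cong_AE) auto
  define M where "M = morrey_norm m (m * (?n / q)) (m * r) u'"
  have M_eq: "morrey_norm m (m * (?n / q)) (m * r) u = M"
  proof -
    have "(\<integral>\<^sup>+y\<in>ball x R. ennreal (\<bar>u y\<bar> powr m / norm y powr (m * r)) \<partial>lborel)
        = (\<integral>\<^sup>+y\<in>ball x R. ennreal (\<bar>u' y\<bar> powr m / norm y powr (m * r)) \<partial>lborel)" for x R
      using u'(2) by (intro nn_integral_cong_AE) auto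
    then show ?thesis by (simp only: M_def morrey_norm_def nn_integral_completion)
  qed
  have L_zero: "L = 0" if "AE x in lborel. u' x = 0"
  proof -
    have "L = (\<integral>\<^sup>+y. 0 \<partial>(lborel :: 'a measure))"
      unfolding L_def using that by (intro nn_integral_cong_AE) (auto elim!: eventually_mono)
    then show ?thesis by simp
  qed
  show "ennpowr (\<integral>\<^sup>+y. ennreal (\<bar>u y\<bar> powr q / norm y powr \<alpha>) \<partial>lebesgue) (1 / q)
      \<le> ennreal C * ennpowr (D1p_norm p u) \<theta> * ennpowr (morrey_norm m (m * (?n / q)) (m * r) u) (1 - \<theta>)"
    unfolding L_eq M_eq D
  proof -
    \<comment> \<open>The gradient norm is finite by membership of \<open>u\<close>. If it or
      \<open>M\<close> is 0, the right-hand side is 0 and the left must be shown to vanish; if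
      \<open>\<delta> > 0\<close> and \<open>M = \<infinity>\<close>, the right-hand side is
      infinite. The last case is the only one where real arithmetic applies.\<close>
    consider "\<delta> = 0" | "M = 0" | "\<delta> > 0" "M = \<infinity>" | \<mu> where "\<delta> > 0" "M = ennreal \<mu>" "\<mu> > 0"
    proof (cases M)
      case (real b)
      then show ?thesis using that \<delta>(2) by (cases "b = 0"; cases "\<delta> = 0") auto
    next
      case top
      then show ?thesis using that \<delta>(2) by (cases "\<delta> = 0") auto
    qed
    then show "ennpowr L (1 / q) \<le> ennreal C * ennpowr (ennreal D) \<theta> * ennpowr M (1 - \<theta>)"
    proof cases
      case 1
      then have "L = 0"
        using W.gradient_zero_imp_zero[OF p q' decay] \<delta> J_def by (intro L_zero) auto
      then show ?thesis by simp
    next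
      case 2
      then have "L = 0"
        unfolding M_def by (intro L_zero morrey_zero_imp_zero[OF u'(1) m(1)])
      then show ?thesis by simp
    next
      case 3
      then have "D > 0" by (simp add: D_def)
      then show ?thesis using C 3 by (simp add: ennpowr_ennreal ennreal_mult_top ennreal_mult[symmetric])
    next
      case (4 \<mu>)
      have D0: "D > 0" using 4 by (simp add: D_def)
      have "L \<le> ennreal (K * \<mu> powr (q - p)) * J"
        unfolding L_def J_def K_def
        by (rule W.sobolev_endpoint[OF p \<alpha> q r q' decay _ 4(3) m(1)])
           (use J_fin 4 in \<open>simp_all only: J_def M_def order_refl\<close>)
      also have "\<dots> = ennreal (K * \<mu> powr (q - p) * D powr p)"
        using K by (simp add: \<delta> Dp ennreal_mult)
      \<comment> \<open>Finiteness of the left-hand side is itself a consequence of the endpoint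
        estimate; it gives the real number \<open>l\<close> needed for the comparison with
        \<mu>.\<close>
      finally have L_le: "L \<le> ennreal (K * \<mu> powr (q - p) * D powr p)" .
      then obtain \<Lambda> where \<Lambda>: "L = ennreal \<Lambda>" "\<Lambda> \<ge> 0"
        by (cases L) (auto simp: top_unique)
      define l where "l = \<Lambda> powr (1 / q)"
      have l: "l \<ge> 0" "l powr q = \<Lambda>" using \<Lambda> q0 by (auto simp: l_def powr_powr)
      have "\<Lambda> \<le> K * \<mu> powr (q - p) * D powr p"
        using L_le \<Lambda> K by (simp add: ennreal_le_iff)
      then have "l \<le> (K * \<mu> powr (q - p) * D powr p) powr (1 / q)"
        unfolding l_def using \<Lambda> q0 by (intro powr_mono2) auto
      also have "\<dots> = k * \<mu> powr (1 - p / q) * D powr (p / q)"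
      proof -
        have "(q - p) * (1 / q) = 1 - p / q" using q0 by (simp add: field_simps)
        then show ?thesis using K 4 D0 by (simp add: powr_mult powr_powr k_def)
      qed
      finally have endpoint: "l \<le> k * \<mu> powr (1 - p / q) * D powr (p / q)" .
      \<comment> \<open>The converse comparison, which permits exchanging a power of \<mu> for a
        power of \<open>D\<close> and so raises the exponent from \<open>p / q\<close> to
        \<theta>.\<close>
      have "M \<le> ennreal (\<Omega> * l)"
        unfolding M_def \<Omega>_def
      proof (rule morrey_norm_le_weighted_Lp[OF u'(1) m l(1)])
        have "q * r = \<alpha>" using q0 by (simp add: r)
        then show "(\<integral>\<^sup>+y. ennpowr (ennreal (\<bar>u' y\<bar> / norm y powr r)) q \<partial>lborel) \<le> ennreal (l powr q)"
          using \<Lambda> unfolding l(2) L_def by (simp add: ennpowr_weighted[OF q0])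
      qed
      then have "\<mu> \<le> \<Omega> * l" using 4 \<Omega> l by (simp add: ennreal_le_iff)
      then have "l \<le> C * D powr \<theta> * \<mu> powr (1 - \<theta>)"
        unfolding C_def using p q0 \<theta> l 4 D0 k \<Omega> endpoint
        by (intro interpolation_exponent_improve) auto
      then have "ennreal l \<le> ennreal (C * D powr \<theta> * \<mu> powr (1 - \<theta>))" by (rule ennreal_leI)
      then show ?thesis
        using C D0 4 \<Lambda> by (simp add: ennpowr_ennreal l_def ennreal_mult)
    qed
  qed
qed

theorem corollary1p4:
  fixes n :: nat and p \<alpha> ps psa r \<theta>bar :: real
  assumes "n = CARD('n::finite)" and "n \<ge> 2"
    and "1 < p" and "p < real n"
    and "0 < \<alpha>" and "\<alpha> < p"
    and "ps = sobolev_exponent n p"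
    and "psa = hardy_sobolev_exponent n p \<alpha>"
    and "r = \<alpha> / psa"
    and "\<theta>bar = max (p / psa) ((ps - 1) / psa)"
  shows "\<theta>bar > 0 \<and>
    (\<exists>C>0. \<forall>\<theta> m. \<theta>bar < \<theta> \<and> \<theta> < 1 \<and> 1 \<le> m \<and> m < psa \<longrightarrow>
      (\<forall>u :: real ^ 'n \<Rightarrow> real. u \<in> D1p p \<longrightarrow>
        ennpowr (\<integral>\<^sup>+ y. ennreal (\<bar>u y\<bar> powr psa / norm y powr \<alpha>) \<partial>lebesgue) (1 / psa)
          \<le> ennreal C * ennpowr (D1p_norm p u) \<theta>
              * ennpowr (morrey_norm m ((real n - p) / p * m + m * r) (m * r) u) (1 - \<theta>)))"
proof
  have n: "real DIM(real ^ 'n) = real n" using assms(1) by simp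
  have psa: "psa = p * (real n - \<alpha>) / (real n - p)"
    using assms(8) by (simp add: hardy_sobolev_exponent_def)
  have psa_pos: "psa > 0"
    unfolding psa using assms(3-6) by (intro divide_pos_pos mult_pos_pos) auto
  show "\<theta>bar > 0"
    unfolding assms(10) using assms(3) psa_pos by (simp add: less_max_iff_disj)
  \<comment> \<open>The scaling identity \<open>(n - p) / p + r = n / q\<close> rewrites the Morrey
    exponent as the multiple \<open>m n / q\<close> that Hoelder on balls produces.\<close>
  have \<kappa>: "(real n - p) / p * m + m * r = m * (real n / psa)" for m
  proof -
    have "(real n - p) / p + r = real n / psa"
      unfolding assms(9) psa using assms(3-6) by (simp add: divide_simps) (simp add: algebra_simps)
    then have "m * ((real n - p) / p + r) = m * (real n / psa)" by simp
    then show ?thesis by (simp add: algebra_simps)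
  qed
  have dim: "p < real DIM(real ^ 'n)"
    and psa_dim: "psa = p * (real DIM(real ^ 'n) - \<alpha>) / (real DIM(real ^ 'n) - p)"
    unfolding n by (fact assms(4) psa)+
  obtain C where "C > 0" and C: "\<And>\<theta> m (u :: real ^ 'n \<Rightarrow> real).
    p / psa < \<theta> \<Longrightarrow> \<theta> < 1 \<Longrightarrow> 1 \<le> m \<Longrightarrow> m < psa \<Longrightarrow> u \<in> D1p p \<Longrightarrow>
      ennpowr (\<integral>\<^sup>+y. ennreal (\<bar>u y\<bar> powr psa / norm y powr \<alpha>) \<partial>lebesgue) (1 / psa)
        \<le> ennreal C * ennpowr (D1p_norm p u) \<theta>
            * ennpowr (morrey_norm m (m * (real DIM(real ^ 'n) / psa)) (m * r) u) (1 - \<theta>)"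
    using improved_hardy_sobolev[where 'a = "real ^ 'n", OF assms(3) dim assms(5,6) psa_dim assms(9)] by blast
  show "\<exists>C>0. \<forall>\<theta> m. \<theta>bar < \<theta> \<and> \<theta> < 1 \<and> 1 \<le> m \<and> m < psa \<longrightarrow>
      (\<forall>u :: real ^ 'n \<Rightarrow> real. u \<in> D1p p \<longrightarrow>
        ennpowr (\<integral>\<^sup>+ y. ennreal (\<bar>u y\<bar> powr psa / norm y powr \<alpha>) \<partial>lebesgue) (1 / psa)
          \<le> ennreal C * ennpowr (D1p_norm p u) \<theta>
              * ennpowr (morrey_norm m ((real n - p) / p * m + m * r) (m * r) u) (1 - \<theta>))"
    \<comment> \<open>\<open>\<theta>bar\<close> is at least the endpoint exponent
      \<open>p / psa\<close>, so every admissible \<theta> lies in the range already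
      covered.\<close>
    using \<open>C > 0\<close> C[unfolded n] unfolding \<kappa> assms(10) by auto
qed

end
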